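(* There are absolute constants $c_1,c_2,c_3>0$ such that the following holds. Let $D\subset\mathbb R^d$ be compact, let $K\colon D\times D\to\mathbb C$ be a continuous Hermitian positive definite kernel with $\|K\|_\infty:=\sup_{x\in D}\sqrt{K(x,x)}<\infty$ whose reproducing kernel Hilbert space $H(K)$ is infinite dimensional, and let $\varrho_D$ be a finite Borel measure on $D$ with full support. Let $(\sigma_k)_{k\ge1}$ be the non-increasing sequence of singular numbers of the embedding $\mathrm{Id}\colon H(K)\to L_2(D,\varrho_D)$. Let $r>1$ and let $n\in\mathbb N$ be such that $$m:=\Big\lfloor \frac{n}{c_1 r\log n}\Big\rfloor\ge 2 .$$ Let the nodes $\mathbf X=(x^1,\dots,x^n)$ be drawn i.i.d. according to the probability measure $\varrho_m(\cdot)\,d\varrho_D$. Then the weighted least squares reconstruction operator $\widetilde S^m_{\mathbf X}$ satisfies $$\mathbb P\Big(\sup_{\|f\|_{H(K)}\le1}\|f-\widetilde S^m_{\mathbf X}f\|^2_{\ell_\infty(D)}\le c_3\max\Big\{\frac{N_{K,\varrho_D}(m)}{m}\sum_{k\ge\lfloor m/2\rfloor}\sigma_k^2,\ \sum_{k\ge\lfloor m/2\rfloor}\frac{N_{K,\varrho_D}(4k)\,\sigma_k^2}{k}\Big\}\Big)\ \ge\ 1-c_2n^{1-r}.$$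
   Context: $\log$ is the natural logarithm. $\|f\|_{\ell_\infty(D)}=\sup_{x\in D}|f(x)|$ (a true supremum, not essential). Spectral data: $\mathrm{Id}\colon H(K)\to L_2(D,\varrho_D)$ is compact. Let $\lambda_1\ge\lambda_2\ge\dots>0$ be the eigenvalues of $\mathrm{Id}^*\circ\mathrm{Id}\colon H(K)\to H(K)$, $\sigma_k=\sqrt{\lambda_k}$, and let $(e_k^* )_{k\ge1}$ be a corresponding system of eigenfunctions that is orthonormal in $H(K)$ (under the assumptions it is an orthonormal basis of $H(K)$). Put $\eta_k:=\sigma_k^{-1}e_k^*$ (as pointwise defined functions on $D$); $(\eta_k)_{k\ge1}$ is orthonormal in $L_2(D,\varrho_D)$. Christoffel function: $N_{K,\varrho_D}(m):=\sup_{x\in D}\sum_{k=1}^{m-1}|\eta_k(x)|^2$. Density: $$\varrho_m(x)=\frac12\Big(\frac1{m-1}\sum_{k=1}^{m-1}|\eta_k(x)|^2+\frac{1}{\sum_{k=m}^\infty\lambda_k}\sum_{k=m}^\infty|e_k^*(x)|^2\Big).$$ Weighted least squares operator $\widetilde S^m_{\mathbf X}$: given $\mathbf X=(x^1,\dots,x^n)\in D^n$ and $f$, put $g_j=f(x^j)/\sqrt{\varrho_m(x^j)}$ if $\varrho_m(x^j)\ne0$ and $g_j=0$ otherwise; let $\widetilde{\mathbf L}=(l_{j,k})_{j=1,k=1}^{n,\,m-1}$ with $l_{j,k}=\eta_k(x^j)/\sqrt{\varrho_m(x^j)}$ if $\varrho_m(x^j)\neq0$ and $l_{j,k}=0$ otherwise.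 If $\widetilde{\mathbf L}$ has full column rank, let $(\tilde c_1,\dots,\tilde c_{m-1})^\top=(\widetilde{\mathbf L}^*\widetilde{\mathbf L})^{-1}\widetilde{\mathbf L}^*\mathbf g$ with $\mathbf g=(g_j)_{j=1}^n$ and $\widetilde S^m_{\mathbf X}f:=\sum_{k=1}^{m-1}\tilde c_k\eta_k$. The event in the claim is understood to include that $\widetilde{\mathbf L}$ has full column rank. *)

theory Defs
  imports
    "HOL-Probability.Probability"
    "HOL-Library.Function_Algebras"
    "Jordan_Normal_Form.DL_Rank"
    "Jordan_Normal_Form.Gauss_Jordan_Elimination"
    "Jordan_Normal_Form.Schur_Decomposition"
begin

(* R^d as the real sequences vanishing from index d on. The product topology of nat => real
   (and hence the Borel sigma-algebra) restricts to the Euclidean one on this set. The usual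
   real ^ 'd is avoided because constants that are absolute must not depend on d, and a
   dimension carried by a type could only be quantified outside the existential. *)
definition real_space :: "nat \<Rightarrow> (nat \<Rightarrow> real) set" where
  "real_space d = {x. \<forall>i\<ge>d. x i = 0}"

definition cscale :: "complex \<Rightarrow> ('a \<Rightarrow> complex) \<Rightarrow> 'a \<Rightarrow> complex" where
  "cscale c f = (\<lambda>x. c * f x)"

interpretation cfun: vector_space "cscale :: complex \<Rightarrow> ('a \<Rightarrow> complex) \<Rightarrow> 'a \<Rightarrow> complex"
  by unfold_locales (auto simp: cscale_def fun_eq_iff algebra_simps)

definition infinite_dimensional :: "('a \<Rightarrow> complex) set \<Rightarrow> bool" where
  "infinite_dimensional H \<longleftrightarrow> \<not> (\<exists>B. finite B \<and> B \<subseteq> H \<and> H \<subseteq> cfun.span B)"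

(* Positive definite in the sense of kernel theory: the quadratic forms are nonnegative. *)
definition hermitian_pos_def :: "'a set \<Rightarrow> ('a \<Rightarrow> 'a \<Rightarrow> complex) \<Rightarrow> bool" where
  "hermitian_pos_def D K \<longleftrightarrow>
     (\<forall>x\<in>D. \<forall>y\<in>D. K y x = cnj (K x y)) \<and>
     (\<forall>A c. finite A \<and> A \<subseteq> D \<longrightarrow>
        0 \<le> Re (\<Sum>x\<in>A. \<Sum>y\<in>A. cnj (c x) * c y * K x y))"

definition hnorm :: "(('a \<Rightarrow> complex) \<Rightarrow> ('a \<Rightarrow> complex) \<Rightarrow> complex) \<Rightarrow> ('a \<Rightarrow> complex) \<Rightarrow> real" where
  "hnorm ip f = sqrt (Re (ip f f))"

(* The kernel section K(., x), extended by 0 outside D. *)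
definition ksection :: "'a set \<Rightarrow> ('a \<Rightarrow> 'a \<Rightarrow> complex) \<Rightarrow> 'a \<Rightarrow> 'a \<Rightarrow> complex" where
  "ksection D K x = (\<lambda>y. if y \<in> D then K y x else 0)"

(* H with inner product ip (linear in the first argument) is the reproducing kernel Hilbert
   space of K; by Moore-Aronszajn it exists and is unique. Functions on D are represented by
   functions vanishing outside D; ip is only meaningful on H. *)
locale rkhs =
  fixes D :: "'a set"
    and K :: "'a \<Rightarrow> 'a \<Rightarrow> complex"
    and H :: "('a \<Rightarrow> complex) set"
    and ip :: "('a \<Rightarrow> complex) \<Rightarrow> ('a \<Rightarrow> complex) \<Rightarrow> complex"
  assumes subspace: "cfun.subspace H"
    and zero_outside: "f \<in> H \<Longrightarrow> x \<notin> D \<Longrightarrow> f x = 0"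
    and ip_add: "f \<in> H \<Longrightarrow> g \<in> H \<Longrightarrow> h \<in> H \<Longrightarrow> ip (f + g) h = ip f h + ip g h"
    and ip_scale: "f \<in> H \<Longrightarrow> g \<in> H \<Longrightarrow> ip (cscale c f) g = c * ip f g"
    and ip_cnj: "f \<in> H \<Longrightarrow> g \<in> H \<Longrightarrow> ip g f = cnj (ip f g)"
    and ip_pos: "f \<in> H \<Longrightarrow> f \<noteq> 0 \<Longrightarrow> 0 < Re (ip f f)"
    and complete: "(\<And>n. F n \<in> H) \<Longrightarrow>
          (\<And>\<epsilon>. \<epsilon> > 0 \<Longrightarrow> \<exists>N. \<forall>i\<ge>N. \<forall>j\<ge>N. hnorm ip (F i - F j) < \<epsilon>) \<Longrightarrow>
          \<exists>f\<in>H. (\<lambda>n::nat. hnorm ip (F n - f)) \<longlonglongrightarrow> 0"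
    and ksection_mem: "x \<in> D \<Longrightarrow> ksection D K x \<in> H"
    and reproducing: "f \<in> H \<Longrightarrow> x \<in> D \<Longrightarrow> f x = ip f (ksection D K x)"

definition finite_borel_full_support :: "'a::topological_space set \<Rightarrow> 'a measure \<Rightarrow> bool" where
  "finite_borel_full_support D \<rho> \<longleftrightarrow>
     finite_measure \<rho> \<and> sets \<rho> = sets (restrict_space borel D) \<and>
     (\<forall>U. open U \<and> U \<inter> D \<noteq> {} \<longrightarrow> emeasure \<rho> (U \<inter> D) > 0)"

definition l2_inner :: "'a measure \<Rightarrow> ('a \<Rightarrow> complex) \<Rightarrow> ('a \<Rightarrow> complex) \<Rightarrow> complex" where
  "l2_inner \<rho> f g = (LINT x|\<rho>. f x * cnj (g x))"

(* u is the image of g under the adjoint of the embedding Id : H(K) -> L_2. *)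
definition is_adjoint_image ::
  "'a measure \<Rightarrow> ('a \<Rightarrow> complex) set \<Rightarrow> (('a \<Rightarrow> complex) \<Rightarrow> ('a \<Rightarrow> complex) \<Rightarrow> complex) \<Rightarrow>
   ('a \<Rightarrow> complex) \<Rightarrow> ('a \<Rightarrow> complex) \<Rightarrow> bool" where
  "is_adjoint_image \<rho> H ip g u \<longleftrightarrow> u \<in> H \<and> (\<forall>h\<in>H. ip u h = l2_inner \<rho> g h)"

(* f is an eigenvector of the composition of Id with its adjoint, for the eigenvalue \<mu>. *)
definition is_eigenpair ::
  "'a measure \<Rightarrow> ('a \<Rightarrow> complex) set \<Rightarrow> (('a \<Rightarrow> complex) \<Rightarrow> ('a \<Rightarrow> complex) \<Rightarrow> complex) \<Rightarrow>
   real \<Rightarrow> ('a \<Rightarrow> complex) \<Rightarrow> bool" where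
  "is_eigenpair \<rho> H ip \<mu> f \<longleftrightarrow>
     f \<in> H \<and> f \<noteq> 0 \<and> is_adjoint_image \<rho> H ip f (cscale (complex_of_real \<mu>) f)"

(* lam 1 >= lam 2 >= ... > 0 lists the eigenvalues with multiplicity, e 1, e 2, ... are
   corresponding H(K)-orthonormal eigenfunctions; index 0 is not used. The last condition says
   that no positive eigenvalue and no part of its eigenspace is missing from the list. *)
definition spectral_system ::
  "'a measure \<Rightarrow> ('a \<Rightarrow> complex) set \<Rightarrow> (('a \<Rightarrow> complex) \<Rightarrow> ('a \<Rightarrow> complex) \<Rightarrow> complex) \<Rightarrow>
   (nat \<Rightarrow> real) \<Rightarrow> (nat \<Rightarrow> 'a \<Rightarrow> complex) \<Rightarrow> bool" where
  "spectral_system \<rho> H ip lam e \<longleftrightarrow>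
     (\<forall>k\<ge>1. 0 < lam k \<and> lam (Suc k) \<le> lam k) \<and>
     (\<forall>k\<ge>1. is_eigenpair \<rho> H ip (lam k) (e k)) \<and>
     (\<forall>j\<ge>1. \<forall>k\<ge>1. ip (e j) (e k) = (if j = k then 1 else 0)) \<and>
     (\<forall>\<mu>>0. \<forall>f. is_eigenpair \<rho> H ip \<mu> f \<longrightarrow> f \<in> cfun.span {e k | k. 1 \<le> k \<and> lam k = \<mu>})"

definition singular_number :: "(nat \<Rightarrow> real) \<Rightarrow> nat \<Rightarrow> real" where
  "singular_number lam k = sqrt (lam k)"

definition eta :: "(nat \<Rightarrow> real) \<Rightarrow> (nat \<Rightarrow> 'a \<Rightarrow> complex) \<Rightarrow> nat \<Rightarrow> 'a \<Rightarrow> complex" where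
  "eta lam e k x = e k x / complex_of_real (singular_number lam k)"

definition christoffel ::
  "'a set \<Rightarrow> (nat \<Rightarrow> real) \<Rightarrow> (nat \<Rightarrow> 'a \<Rightarrow> complex) \<Rightarrow> nat \<Rightarrow> ennreal" where
  "christoffel D lam e m = (SUP x\<in>D. ennreal (\<Sum>k=1..m-1. (cmod (eta lam e k x))\<^sup>2))"

definition sampling_density ::
  "(nat \<Rightarrow> real) \<Rightarrow> (nat \<Rightarrow> 'a \<Rightarrow> complex) \<Rightarrow> nat \<Rightarrow> 'a \<Rightarrow> real" where
  "sampling_density lam e m x =
     1/2 * (1 / real (m - 1) * (\<Sum>k=1..m-1. (cmod (eta lam e k x))\<^sup>2)
          + 1 / (\<Sum>\<^sub>\<infinity>k\<in>{m..}. lam k) * (\<Sum>\<^sub>\<infinity>k\<in>{m..}. (cmod (e k x))\<^sup>2))"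

definition sampling_measure ::
  "'a measure \<Rightarrow> (nat \<Rightarrow> real) \<Rightarrow> (nat \<Rightarrow> 'a \<Rightarrow> complex) \<Rightarrow> nat \<Rightarrow> 'a measure" where
  "sampling_measure \<rho> lam e m = density \<rho> (\<lambda>x. ennreal (sampling_density lam e m x))"

(* Matrix rows, columns and nodes are numbered from 0, so column k belongs to eta_(k+1). *)
definition ls_matrix ::
  "(nat \<Rightarrow> real) \<Rightarrow> (nat \<Rightarrow> 'a \<Rightarrow> complex) \<Rightarrow> nat \<Rightarrow> nat \<Rightarrow> (nat \<Rightarrow> 'a) \<Rightarrow> complex Matrix.mat" where
  "ls_matrix lam e m n X = Matrix.mat n (m - 1) (\<lambda>(j, k).
     if sampling_density lam e m (X j) \<noteq> 0
     then eta lam e (Suc k) (X j) / complex_of_real (sqrt (sampling_density lam e m (X j)))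
     else 0)"

definition ls_data ::
  "(nat \<Rightarrow> real) \<Rightarrow> (nat \<Rightarrow> 'a \<Rightarrow> complex) \<Rightarrow> nat \<Rightarrow> nat \<Rightarrow> (nat \<Rightarrow> 'a) \<Rightarrow> ('a \<Rightarrow> complex) \<Rightarrow>
   complex Matrix.vec" where
  "ls_data lam e m n X f = Matrix.vec n (\<lambda>j.
     if sampling_density lam e m (X j) \<noteq> 0
     then f (X j) / complex_of_real (sqrt (sampling_density lam e m (X j)))
     else 0)"

definition full_column_rank :: "complex Matrix.mat \<Rightarrow> bool" where
  "full_column_rank A \<longleftrightarrow> vec_space.rank (dim_row A) A = dim_col A"

definition ls_coeffs ::
  "(nat \<Rightarrow> real) \<Rightarrow> (nat \<Rightarrow> 'a \<Rightarrow> complex) \<Rightarrow> nat \<Rightarrow> nat \<Rightarrow> (nat \<Rightarrow> 'a) \<Rightarrow> ('a \<Rightarrow> complex) \<Rightarrow>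
   complex Matrix.vec" where
  "ls_coeffs lam e m n X f =
     (let L = ls_matrix lam e m n X
      in the (mat_inverse (mat_adjoint L * L)) *\<^sub>v (mat_adjoint L *\<^sub>v ls_data lam e m n X f))"

(* Meaningful only if ls_matrix lam e m n X has full column rank. *)
definition ls_operator ::
  "(nat \<Rightarrow> real) \<Rightarrow> (nat \<Rightarrow> 'a \<Rightarrow> complex) \<Rightarrow> nat \<Rightarrow> nat \<Rightarrow> (nat \<Rightarrow> 'a) \<Rightarrow> ('a \<Rightarrow> complex) \<Rightarrow>
   'a \<Rightarrow> complex" where
  "ls_operator lam e m n X f =
     (\<lambda>x. \<Sum>k=1..m-1. vec_index (ls_coeffs lam e m n X f) (k - 1) * eta lam e k x)"

definition sup_norm :: "'a set \<Rightarrow> ('a \<Rightarrow> complex) \<Rightarrow> ennreal" where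
  "sup_norm D f = (SUP x\<in>D. ennreal (cmod (f x)))"

definition worst_case_sq_error ::
  "'a set \<Rightarrow> ('a \<Rightarrow> complex) set \<Rightarrow> (('a \<Rightarrow> complex) \<Rightarrow> ('a \<Rightarrow> complex) \<Rightarrow> complex) \<Rightarrow>
   (('a \<Rightarrow> complex) \<Rightarrow> 'a \<Rightarrow> complex) \<Rightarrow> ennreal" where
  "worst_case_sq_error D H ip S = (SUP f\<in>{f \<in> H. hnorm ip f \<le> 1}. (sup_norm D (f - S f))\<^sup>2)"

(* Extended-valued, as the second series may diverge (the bound is then infinite). *)
definition error_bound ::
  "'a set \<Rightarrow> (nat \<Rightarrow> real) \<Rightarrow> (nat \<Rightarrow> 'a \<Rightarrow> complex) \<Rightarrow> nat \<Rightarrow> ennreal" where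
  "error_bound D lam e m =
     max (christoffel D lam e m / of_nat m
            * (\<Sum>\<^sub>\<infinity>k\<in>{m div 2..}. ennreal ((singular_number lam k)\<^sup>2)))
         (\<Sum>\<^sub>\<infinity>k\<in>{m div 2..}.
            christoffel D lam e (4 * k) * ennreal ((singular_number lam k)\<^sup>2) / of_nat k)"

end

(* Let f be in the unit ball of H(K) and P the H(K)-orthogonal projection onto the span of
   eta_1, ..., eta_{m-1}. Then |(f - P f)(x)|^2 <= sum_{k >= m} |e_k(x)|^2, and the operator
   reproduces P f; so only the least squares image of f - P f must be controlled. That needs two
   bounds on the random sampling matrices: a lower frame bound n/4 for eta_1, ..., eta_{m-1} and
   an upper frame bound of order n lambda_m + (log n) r sum_{k >= m} lambda_k for the e_k, k >= m.

   Both come from tr A^p with p of order n (lower) or r log n (upper), where A is the identity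
   scaled by c plus or minus the sum of the sampled rank-one operators. If A' = A + v v^* and
   A >= mu >= 2 p |v|^2, then log-convexity of the moments <A'^k v, v> gives
   p <A^{p-1} v, v> <= tr A'^p - tr A^p <= p <A'^{p-1} v, v>, the two outer terms being comparable.
   Taking expectations one sample at a time replaces the Golden-Thompson inequality. In the upper
   bound only tr (A^p - c^p) enters, so the truncation level of the infinite matrix drops out.

   The e_k form a basis of H(K): otherwise the quotient of the L_2 norm and the H(K) norm would
   have a maximizer on their orthogonal complement, that is, an eigenfunction missing in the list. *)
theory Submission
  imports Defs "HOL-Complex_Analysis.Great_Picard"
begin

section \<open>Sesquilinear forms and moments of self-adjoint operators\<close>

(* Eta-expansion would otherwise turn f + g into \<lambda>x. f x + g x. *)
declare plus_fun_apply [simp del] minus_apply [simp del]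

text \<open>Comparing moments of A and A' of degree N loses a factor 1 - N R / \<mu>, where R bounds
  |v|^2. This forces the shift by a large multiple of the identity. In the upper estimate the shift
  c is itself the frame bound, so p is kept of order r log n; in the lower estimate the shift is 2 n
  R in any case, so p may grow like n. The sampling density is the average of two densities, one for
  each matrix. It caps the squared row norms by 2 (m - 1) and by twice the tail sum of the
  eigenvalues, however large the eigenfunctions are. The second matrix has infinitely many columns.
  Each truncation has its own good event, of a probability that does not depend on the truncation;
  nodes that lie in infinitely many of these events suffice, since the quantity to be bounded
  converges as the truncation grows. Measurability is a separate obstacle: the success event
  involves a supremum over an uncountable ball and domain, and a matrix inverse computed by
  elimination. The supremum over the ball is the squared norm of a functional, a series over the
  e_k, which is read off on a countable dense set of points; the inverse is rewritten by Cramer's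
  rule.\<close>

locale psd_form =
  fixes V :: "('a \<Rightarrow> complex) set" and B :: "('a \<Rightarrow> complex) \<Rightarrow> ('a \<Rightarrow> complex) \<Rightarrow> complex"
  assumes sub: "cfun.subspace V"
    and add: "f \<in> V \<Longrightarrow> g \<in> V \<Longrightarrow> h \<in> V \<Longrightarrow> B (f + g) h = B f h + B g h"
    and scale: "f \<in> V \<Longrightarrow> g \<in> V \<Longrightarrow> B (cscale c f) g = c * B f g"
    and sym: "f \<in> V \<Longrightarrow> g \<in> V \<Longrightarrow> B g f = cnj (B f g)"
    and nonneg: "f \<in> V \<Longrightarrow> 0 \<le> Re (B f f)"
begin

lemma add_mem: "f \<in> V \<Longrightarrow> g \<in> V \<Longrightarrow> f + g \<in> V"
  using sub cfun.subspace_add by blast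

lemma scale_mem: "f \<in> V \<Longrightarrow> cscale c f \<in> V"
  using sub cfun.subspace_scale by blast

lemma diff_mem: "f \<in> V \<Longrightarrow> g \<in> V \<Longrightarrow> f - g \<in> V"
  using sub cfun.subspace_diff by blast

lemma zero_mem: "0 \<in> V"
  using sub cfun.subspace_0 by blast

lemma sum_mem: "(\<And>i. i \<in> S \<Longrightarrow> f i \<in> V) \<Longrightarrow> sum f S \<in> V"
  using sub cfun.subspace_sum by blast

lemma zero_left: "g \<in> V \<Longrightarrow> B 0 g = 0"
  using scale[of 0 g 0] zero_mem by (simp add: cscale_def zero_fun_def)

lemma zero_right: "g \<in> V \<Longrightarrow> B g 0 = 0"
  using sym[of 0 g] zero_mem zero_left by simp

lemma diff: "f \<in> V \<Longrightarrow> g \<in> V \<Longrightarrow> h \<in> V \<Longrightarrow> B (f - g) h = B f h - B g h"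
  using add[of "f - g" g h] diff_mem by simp

lemma add_right: "f \<in> V \<Longrightarrow> g \<in> V \<Longrightarrow> h \<in> V \<Longrightarrow> B h (f + g) = B h f + B h g"
  using sym[of "f + g" h] sym[of f h] sym[of g h] add add_mem by simp

lemma diff_right: "f \<in> V \<Longrightarrow> g \<in> V \<Longrightarrow> h \<in> V \<Longrightarrow> B h (f - g) = B h f - B h g"
  using sym[of "f - g" h] sym[of f h] sym[of g h] diff diff_mem by simp

lemma scale_right: "f \<in> V \<Longrightarrow> g \<in> V \<Longrightarrow> B f (cscale c g) = cnj c * B f g"
  using sym[of "cscale c g" f] sym[of g f] scale scale_mem by simp

lemma sum_left: "finite S \<Longrightarrow> (\<And>i. i \<in> S \<Longrightarrow> f i \<in> V) \<Longrightarrow> g \<in> V \<Longrightarrow> B (sum f S) g = (\<Sum>i\<in>S. B (f i) g)"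
  by (induction S rule: finite_induct) (auto simp: zero_left add sum_mem)

lemma sum_right: "finite S \<Longrightarrow> (\<And>i. i \<in> S \<Longrightarrow> f i \<in> V) \<Longrightarrow> g \<in> V \<Longrightarrow> B g (sum f S) = (\<Sum>i\<in>S. B g (f i))"
  by (induction S rule: finite_induct) (auto simp: zero_right add_right sum_mem)

lemma self_real: "f \<in> V \<Longrightarrow> B f f = of_real (Re (B f f))"
  using sym[of f f] by (simp add: complex_eq_iff)

lemma Re_sym: "f \<in> V \<Longrightarrow> g \<in> V \<Longrightarrow> Re (B g f) = Re (B f g)"
  using sym[of f g] by simp

lemma self_add: "f \<in> V \<Longrightarrow> g \<in> V \<Longrightarrow>
    Re (B (f + g) (f + g)) = Re (B f f) + 2 * Re (B f g) + Re (B g g)"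
  using Re_sym[of f g] by (simp add: add add_right add_mem)

lemma self_diff: "f \<in> V \<Longrightarrow> g \<in> V \<Longrightarrow>
    Re (B (f - g) (f - g)) = Re (B f f) - 2 * Re (B f g) + Re (B g g)"
  using Re_sym[of f g] by (simp add: diff diff_right diff_mem)

lemma self_scale: "f \<in> V \<Longrightarrow> Re (B (cscale c f) (cscale c f)) = (cmod c)\<^sup>2 * Re (B f f)"
proof -
  assume f: "f \<in> V"
  have "B (cscale c f) (cscale c f) = (c * cnj c) * B f f"
    using f by (simp add: scale scale_right scale_mem)
  also have "\<dots> = of_real ((cmod c)\<^sup>2 * Re (B f f))"
    using self_real[OF f] by (simp add: complex_norm_square[symmetric])
  finally show ?thesis by (metis Re_complex_of_real)
qed

lemma parallelogram: "f \<in> V \<Longrightarrow> g \<in> V \<Longrightarrow>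
    Re (B (f - g) (f - g)) = 2 * Re (B f f) + 2 * Re (B g g) - Re (B (f + g) (f + g))"
  by (simp add: self_add self_diff)

text \<open>Degenerate forms have to be covered: the inequality is also used for a power of an
  operator minus a multiple of the identity and for the gap between two forms at a maximizer.
  Expanding the form at f - t z g with real t and z = \<open>B f g\<close> gives a real quadratic in
  t.\<close>

lemma cauchy_schwarz:
  assumes f: "f \<in> V" and g: "g \<in> V"
  shows "(cmod (B f g))\<^sup>2 \<le> Re (B f f) * Re (B g g)"
proof -
  define a b z where "a = Re (B f f)" "b = Re (B g g)" "z = B f g"
  have key: "0 \<le> a - 2 * t * (cmod z)\<^sup>2 + t\<^sup>2 * (cmod z)\<^sup>2 * b" for t
  proof -
    have "0 \<le> Re (B (f - cscale (of_real t * z) g) (f - cscale (of_real t * z) g))"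
      using f g by (intro nonneg diff_mem scale_mem)
    also have "\<dots> = a - 2 * Re (cnj (of_real t * z) * z) + (cmod (of_real t * z))\<^sup>2 * b"
      unfolding a_b_z_def by (simp only: self_diff[OF f scale_mem[OF g]] scale_right[OF f g] self_scale[OF g])
    also have "cnj (of_real t * z) * z = of_real (t * (cmod z)\<^sup>2)"
      by (simp add: complex_norm_square mult.commute del: of_real_power)
    also have "(cmod (of_real t * z))\<^sup>2 = t\<^sup>2 * (cmod z)\<^sup>2"
      by (simp add: norm_mult power_mult_distrib)
    finally show ?thesis by simp
  qed
  have b0: "b \<ge> 0" unfolding a_b_z_def using g nonneg by simp
  show ?thesis
  proof (cases "b = 0")
    case True
    show ?thesis
    proof (cases "z = 0")
      case False
      then have "(cmod z)\<^sup>2 > 0" by simp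
      \<comment> \<open>For b = 0 the quadratic is affine in t with slope -2 |z|^2; this t would
        make its value -1.\<close>
      then have "2 * ((a + 1) / (2 * (cmod z)\<^sup>2)) * (cmod z)\<^sup>2 = a + 1" by (simp add: field_simps)
      with key[of "(a + 1) / (2 * (cmod z)\<^sup>2)"] True show ?thesis by simp
    qed (use True a_b_z_def in simp)
  next
    case False
    then have "b > 0" using b0 by simp
    with key[of "1 / b"] have "(cmod z)\<^sup>2 \<le> a * b"
      by (simp add: field_simps power2_eq_square)
    then show ?thesis unfolding a_b_z_def .
  qed
qed

lemma seminorm_add:
  assumes f: "f \<in> V" and g: "g \<in> V"
  shows "sqrt (Re (B (f + g) (f + g))) \<le> sqrt (Re (B f f)) + sqrt (Re (B g g))"
proof -
  have "Re (B f g) \<le> cmod (B f g)" by (rule complex_Re_le_cmod)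
  also have "\<dots> \<le> sqrt (Re (B f f) * Re (B g g))"
    using cauchy_schwarz[OF f g] by (simp add: real_le_rsqrt)
  finally have "Re (B (f + g) (f + g)) \<le> (sqrt (Re (B f f)) + sqrt (Re (B g g)))\<^sup>2"
    using nonneg[OF f] nonneg[OF g] self_add[OF f g]
    by (simp add: power2_sum real_sqrt_mult)
  then show ?thesis
    using nonneg[OF f] nonneg[OF g] by (intro real_le_lsqrt) auto
qed

lemma seminorm_sum:
  "finite S \<Longrightarrow> (\<And>i. i \<in> S \<Longrightarrow> f i \<in> V) \<Longrightarrow>
    sqrt (Re (B (sum f S) (sum f S))) \<le> (\<Sum>i\<in>S. sqrt (Re (B (f i) (f i))))"
proof (induction S rule: finite_induct)
  case (insert i S)
  have "sqrt (Re (B (f i + sum f S) (f i + sum f S)))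
      \<le> sqrt (Re (B (f i) (f i))) + sqrt (Re (B (sum f S) (sum f S)))"
    using insert by (intro seminorm_add sum_mem) auto
  with insert(1,2) insert(3)[OF insert(4)] show ?case by simp
qed (simp add: zero_left zero_mem)

end

lemma sum_fun_apply: "(\<Sum>i\<in>S. f i) x = (\<Sum>i\<in>S. f i x)" for f :: "'i \<Rightarrow> 'a \<Rightarrow> 'b::comm_monoid_add"
  by (induction S rule: infinite_finite_induct) (auto simp: plus_fun_apply)

section \<open>Log-convex sequences\<close>

text \<open>The ratios of consecutive terms do not decrease. The inequality is cross-multiplied
  because \<open>a 0\<close> may vanish.\<close>

lemma log_convex_ratio:
  fixes a :: "nat \<Rightarrow> real"
  assumes pos: "\<And>n. n \<ge> 1 \<Longrightarrow> a n > 0" and a0: "a 0 \<ge> 0"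
    and conv: "\<And>n. (a (Suc n))\<^sup>2 \<le> a n * a (Suc (Suc n))"
  shows "a (Suc j) * a (j + k) \<le> a j * a (Suc (j + k))"
proof (induction k)
  case (Suc k)
  let ?x = "a (j + k)" and ?y = "a (Suc (j + k))" and ?z = "a (Suc (Suc (j + k)))"
  have y: "?y > 0" by (rule pos) simp
  have "a (Suc j) * ?y * ?y \<le> a (Suc j) * (?x * ?z)"
    using mult_left_mono[OF conv[of "j + k"], of "a (Suc j)"] pos[of "Suc j"]
    by (simp add: power2_eq_square mult.assoc)
  also have "\<dots> \<le> (a j * ?y) * ?z"
    using mult_right_mono[OF Suc, of ?z] pos[of "Suc (Suc (j + k))"] by (simp add: mult_ac)
  finally have "(a (Suc j) * ?y) * ?y \<le> (a j * ?z) * ?y" by (simp add: mult_ac)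
  then show ?case using y by simp
qed simp

text \<open>For the moments of a measure on the half-line this is Chebyshev's association
  inequality. Going from j to j + 1 multiplies the left side by the ratio at position j and the
  right side by the later, hence larger, ratio at position j + k.\<close>

lemma log_convex_chebyshev:
  fixes a :: "nat \<Rightarrow> real"
  assumes nonneg: "\<And>n. a n \<ge> 0"
    and conv: "\<And>n. (a (Suc n))\<^sup>2 \<le> a n * a (Suc (Suc n))"
  shows "a j * a k \<le> a 0 * a (j + k)"
\<comment> \<open>The ratios need positive terms. A zero at a positive index spreads in both
  directions but stops before index 0: the moments of a point mass at 0 are of this kind.\<close>
proof (cases "\<exists>i\<ge>1. a i = 0")
  case True
  then obtain i where i: "a (Suc i) = 0" by (metis Suc_le_D One_nat_def)
  have up: "a (Suc i + l) = 0" for l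
  proof (induction l)
    case (Suc l)
    from conv[of "Suc i + l"] Suc show ?case by simp
  qed (use i in simp)
  have down: "l \<le> i \<Longrightarrow> a (Suc (i - l)) = 0" for l
  proof (induction l)
    case (Suc l)
    then have "Suc (Suc (i - Suc l)) = Suc (i - l)" by simp
    with conv[of "i - Suc l"] Suc show ?case by simp
  qed (use i in simp)
  have "a n = 0" if "n \<ge> 1" for n
  proof (cases "n \<le> Suc i")
    case True
    with down[of "Suc i - n"] that show ?thesis
      by (metis Suc_diff_le diff_diff_cancel diff_le_self One_nat_def Suc_le_D diff_Suc_Suc)
  next
    case False
    with up[of "n - Suc i"] show ?thesis by simp
  qed
  then show ?thesis using nonneg by (cases "j = 0"; cases "k = 0") auto
next
  case False
  then have pos: "\<And>n. n \<ge> 1 \<Longrightarrow> a n > 0" using nonneg by (metis less_le)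
  show ?thesis
  proof (induction j)
    case (Suc j)
    show ?case
    proof (cases "j = 0")
      case True
      then show ?thesis using log_convex_ratio[of a 0 k, OF pos nonneg[of 0] conv] by simp
    next
      case False
      then have aj: "a j > 0" using pos by simp
      have "a j * (a (Suc j) * a k) = a (Suc j) * (a j * a k)" by simp
      also have "\<dots> \<le> a (Suc j) * (a 0 * a (j + k))"
        using Suc nonneg by (intro mult_left_mono) auto
      also have "\<dots> \<le> a 0 * (a j * a (Suc (j + k)))"
        using mult_left_mono[OF log_convex_ratio[of a j k, OF pos nonneg[of 0] conv] nonneg[of 0]]
        by (simp add: mult_ac)
      also have "\<dots> = a j * (a 0 * a (Suc j + k))" by (simp add: mult_ac)
      finally show ?thesis using aj by simp
    qed
  qed simp
qed

section \<open>Moments and powers of self-adjoint operators\<close>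

text \<open>Vectors are functions on the whole index type, of which only the entries in I count. So
  the form is merely semidefinite, and no carrier set has to be tracked.\<close>

definition dot :: "'i set \<Rightarrow> ('i \<Rightarrow> complex) \<Rightarrow> ('i \<Rightarrow> complex) \<Rightarrow> complex" where
  "dot I x y = (\<Sum>i\<in>I. x i * cnj (y i))"

definition unit_vec_fun :: "'i \<Rightarrow> 'i \<Rightarrow> complex" where
  "unit_vec_fun i = (\<lambda>j. if j = i then 1 else 0)"

lemma dot_add: "dot I (x + y) z = dot I x z + dot I y z"
  by (simp add: dot_def sum.distrib algebra_simps plus_fun_apply)
lemma dot_add_right: "dot I z (x + y) = dot I z x + dot I z y"
  by (simp add: dot_def sum.distrib algebra_simps plus_fun_apply)
lemma dot_scale: "dot I (cscale c x) y = c * dot I x y"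
  by (simp add: dot_def cscale_def sum_distrib_left mult.assoc)
lemma dot_scale_right: "dot I x (cscale c y) = cnj c * dot I x y"
  by (simp add: dot_def cscale_def sum_distrib_left mult_ac)
lemma dot_sym: "dot I y x = cnj (dot I x y)"
  by (simp add: dot_def mult.commute)
lemma dot_self: "dot I x x = of_real (\<Sum>i\<in>I. (cmod (x i))\<^sup>2)"
  by (simp add: dot_def complex_norm_square del: of_real_power)
lemma dot_self_nonneg: "0 \<le> Re (dot I x x)"
  by (simp add: dot_self sum_nonneg)

lemma psd_form_dot: "psd_form UNIV (dot I)"
  by unfold_locales (simp_all add: dot_add dot_scale dot_self_nonneg, rule dot_sym)

lemma dot_cauchy_schwarz: "(cmod (dot I x y))\<^sup>2 \<le> Re (dot I x x) * Re (dot I y y)"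
  using psd_form.cauchy_schwarz[OF psd_form_dot] by simp

lemma dot_unit: "finite I \<Longrightarrow> i \<in> I \<Longrightarrow> dot I x (unit_vec_fun i) = x i"
  by (simp add: dot_def unit_vec_fun_def if_distrib[of cnj] if_distrib[of "\<lambda>t. _ * t"] cong: if_cong)

text \<open>The N-th moment of the spectral measure of A at u. The inequalities between these
  numbers stand in for a diagonalization of A.\<close>

definition mom :: "'i set \<Rightarrow> (('i \<Rightarrow> complex) \<Rightarrow> 'i \<Rightarrow> complex) \<Rightarrow> ('i \<Rightarrow> complex) \<Rightarrow> nat \<Rightarrow> real" where
  "mom I A u N = Re (dot I ((A ^^ N) u) u)"

definition trace_pow :: "'i set \<Rightarrow> (('i \<Rightarrow> complex) \<Rightarrow> 'i \<Rightarrow> complex) \<Rightarrow> nat \<Rightarrow> real" where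
  "trace_pow I A N = (\<Sum>i\<in>I. mom I A (unit_vec_fun i) N)"

locale sa_op =
  fixes I :: "'i set" and A :: "('i \<Rightarrow> complex) \<Rightarrow> 'i \<Rightarrow> complex"
  assumes fin: "finite I"
    and op_add: "A (x + y) = A x + A y"
    and op_scale: "A (cscale c x) = cscale c (A x)"
    and sa: "dot I (A x) y = dot I x (A y)"
begin

lemma pow_add: "(A ^^ N) (x + y) = (A ^^ N) x + (A ^^ N) y"
  by (induction N) (simp_all add: op_add)

lemma pow_scale: "(A ^^ N) (cscale c x) = cscale c ((A ^^ N) x)"
  by (induction N) (simp_all add: op_scale)

lemma pow_sa: "dot I ((A ^^ N) x) y = dot I x ((A ^^ N) y)"
proof (induction N arbitrary: y)
  case (Suc N)
  then show ?case by (simp add: sa) (metis funpow_swap1)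
qed simp

text \<open>Moving half of the powers to the other argument makes all moments of a positive operator
  nonnegative without taking a square root of it.\<close>

lemma mom_even_odd:
  "mom I A x (2 * k) = Re (dot I ((A ^^ k) x) ((A ^^ k) x))"
  "mom I A x (Suc (2 * k)) = Re (dot I (A ((A ^^ k) x)) ((A ^^ k) x))"
proof -
  have "(A ^^ (2 * k)) x = (A ^^ k) ((A ^^ k) x)" by (simp add: mult_2 funpow_add)
  then show "mom I A x (2 * k) = Re (dot I ((A ^^ k) x) ((A ^^ k) x))"
    unfolding mom_def by (simp add: pow_sa)
  have "(A ^^ (Suc (2 * k))) x = (A ^^ k) (A ((A ^^ k) x))"
    by (simp add: mult_2 funpow_add funpow_swap1)
  then show "mom I A x (Suc (2 * k)) = Re (dot I (A ((A ^^ k) x)) ((A ^^ k) x))"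
    unfolding mom_def by (simp only: pow_sa)
qed

lemma dot_pow_real: "dot I ((A ^^ N) u) u = of_real (mom I A u N)"
  unfolding mom_def using pow_sa[of N u u] dot_sym[of I "(A ^^ N) u" u]
  by (simp add: complex_eq_iff)

lemma dot_pow_real': "dot I u ((A ^^ N) u) = of_real (mom I A u N)"
  by (metis dot_pow_real pow_sa)

end

locale pos_op = sa_op +
  fixes \<mu> :: real
  assumes mu_pos: "0 < \<mu>"
    and ge: "\<mu> * Re (dot I x x) \<le> Re (dot I (A x) x)"
begin

lemma op_nonneg: "0 \<le> Re (dot I (A x) x)"
  using ge[of x] mu_pos dot_self_nonneg[of I x] by (meson less_imp_le mult_nonneg_nonneg order_trans)

lemma mom_nonneg: "0 \<le> mom I A x N"
  by (cases "even N") (auto simp: mom_even_odd dot_self_nonneg op_nonneg elim!: evenE oddE)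

lemma psd_form_pow: "psd_form UNIV (\<lambda>x y. dot I ((A ^^ N) x) y)"
proof unfold_locales
  fix f g :: "'a \<Rightarrow> complex"
  show "dot I ((A ^^ N) g) f = cnj (dot I ((A ^^ N) f) g)"
    by (metis dot_sym pow_sa)
  show "0 \<le> Re (dot I ((A ^^ N) f) f)" using mom_nonneg unfolding mom_def .
qed (auto simp: pow_add pow_scale dot_add dot_scale)

text \<open>Cauchy-Schwarz for the form of A^N, applied to A u and u.\<close>

lemma mom_log_convex: "(mom I A u (Suc N))\<^sup>2 \<le> mom I A u N * mom I A u (Suc (Suc N))"
proof -
  have 1: "(A ^^ N) (A u) = (A ^^ Suc N) u" by (simp add: funpow_swap1)
  have 2: "dot I ((A ^^ Suc N) u) (A u) = dot I ((A ^^ Suc (Suc N)) u) u"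
    by (simp add: sa)
  have "(mom I A u (Suc N))\<^sup>2 \<le> (cmod (dot I ((A ^^ N) (A u)) u))\<^sup>2"
    unfolding mom_def 1 by (intro power2_le_iff_abs_le[THEN iffD2] abs_Re_le_cmod) simp
  also have "\<dots> \<le> Re (dot I ((A ^^ N) (A u)) (A u)) * Re (dot I ((A ^^ N) u) u)"
    using psd_form.cauchy_schwarz[OF psd_form_pow] by simp
  finally show ?thesis unfolding mom_def 1 2 by (simp add: mult.commute)
qed

lemma mom_chebyshev: "mom I A u j * mom I A u k \<le> mom I A u 0 * mom I A u (j + k)"
  using log_convex_chebyshev[of "mom I A u", OF mom_nonneg mom_log_convex] .

text \<open>The Chebyshev inequality with index 1 passes a Rayleigh quotient of at least \<beta> on
  to all later ratios of moments. A direction in which a frame bound fails thus produces a large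
  p-th moment, hence a large trace.\<close>

lemma mom_growth:
  assumes "\<beta> * mom I A u 0 \<le> mom I A u 1" "0 \<le> \<beta>"
  shows "\<beta> * mom I A u N \<le> mom I A u (Suc N)" "\<beta> ^ N * mom I A u 0 \<le> mom I A u N"
proof -
  show *: "\<beta> * mom I A u N \<le> mom I A u (Suc N)" for N
  proof (cases "mom I A u 0 = 0")
    case True
    with mom_chebyshev[of u N N] have "mom I A u N = 0"
      using zero_le_square[of "mom I A u N"] by simp
    then show ?thesis using mom_nonneg by simp
  next
    case False
    then have 0: "mom I A u 0 > 0" using mom_nonneg by (metis less_le)
    have "mom I A u 0 * (\<beta> * mom I A u N) \<le> mom I A u 1 * mom I A u N"
      using mult_right_mono[OF assms(1) mom_nonneg[of u N]] by (simp add: mult_ac)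
    also have "\<dots> \<le> mom I A u 0 * mom I A u (Suc N)" using mom_chebyshev[of u 1 N] by simp
    finally show ?thesis using 0 by simp
  qed
  show "\<beta> ^ N * mom I A u 0 \<le> mom I A u N"
  proof (induction N)
    case (Suc N)
    have "\<beta> ^ Suc N * mom I A u 0 \<le> \<beta> * mom I A u N"
      using mult_left_mono[OF Suc assms(2)] by (simp add: mult_ac)
    with *[of N] show ?case by linarith
  qed simp
qed

lemma mom_growth_mu: "\<mu> * mom I A u N \<le> mom I A u (Suc N)" "\<mu> ^ N * mom I A u 0 \<le> mom I A u N"
  using mom_growth[of \<mu> u N] ge[of u] mu_pos by (simp_all add: mom_def)

lemma trace_pow_nonneg: "0 \<le> trace_pow I A N"
  unfolding trace_pow_def by (intro sum_nonneg mom_nonneg)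

text \<open>A semidefinite operator, here A^N - \<gamma>, is bounded by its trace: the triangle
  inequality along the coordinates, followed by Cauchy-Schwarz for sums, gives this directly.
  Vanishing outside I makes z equal to its coordinate expansion as a function. The value of \<gamma>
  is c^p in the upper estimate and 0 in the lower one.\<close>

lemma mom_le_trace_pow:
  assumes supp: "\<And>i. i \<notin> I \<Longrightarrow> z i = 0"
    and \<gamma>: "\<And>x. \<gamma> * mom I A x 0 \<le> mom I A x N"
  shows "mom I A z N - \<gamma> * mom I A z 0 \<le> (trace_pow I A N - \<gamma> * card I) * mom I A z 0"
proof -
  define B where "B = (\<lambda>x y. dot I ((A ^^ N) x) y - of_real \<gamma> * dot I x y)"
  interpret B: psd_form UNIV B
  proof unfold_locales
    fix f g :: "'a \<Rightarrow> complex"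
    show "B g f = cnj (B f g)" unfolding B_def
      by (simp add: dot_sym[of I f g]) (metis dot_sym pow_sa)
    show "0 \<le> Re (B f f)" using \<gamma>[of f] unfolding B_def mom_def by simp
  qed (auto simp: B_def pow_add pow_scale dot_add dot_scale algebra_simps)
  have BB: "Re (B x x) = mom I A x N - \<gamma> * mom I A x 0" for x
    unfolding B_def mom_def by simp
  have z: "z = (\<Sum>i\<in>I. cscale (z i) (unit_vec_fun i))"
    by (rule ext) (use fin supp in \<open>auto simp: sum_fun_apply cscale_def unit_vec_fun_def if_distrib[of "\<lambda>t. _ * t"] cong: if_cong\<close>)
  have unit0: "mom I A (unit_vec_fun i) 0 = 1" if "i \<in> I" for i
    using that fin unfolding mom_def by (simp add: dot_unit) (simp add: unit_vec_fun_def)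
  have "sqrt (Re (B z z)) \<le> (\<Sum>i\<in>I. sqrt (Re (B (cscale (z i) (unit_vec_fun i)) (cscale (z i) (unit_vec_fun i)))))"
    using B.seminorm_sum[OF fin, of "\<lambda>i. cscale (z i) (unit_vec_fun i)"] unfolding z[symmetric] by simp
  also have "\<dots> = (\<Sum>i\<in>I. cmod (z i) * sqrt (Re (B (unit_vec_fun i) (unit_vec_fun i))))"
    by (simp add: B.self_scale real_sqrt_mult)
  finally have "Re (B z z) \<le> (\<Sum>i\<in>I. cmod (z i) * sqrt (Re (B (unit_vec_fun i) (unit_vec_fun i))))\<^sup>2"
    using sqrt_le_D by blast
  also have "\<dots> \<le> (\<Sum>i\<in>I. (cmod (z i))\<^sup>2) * (\<Sum>i\<in>I. (sqrt (Re (B (unit_vec_fun i) (unit_vec_fun i))))\<^sup>2)"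
    by (rule Cauchy_Schwarz_ineq_sum)
  also have "(\<Sum>i\<in>I. (sqrt (Re (B (unit_vec_fun i) (unit_vec_fun i))))\<^sup>2)
      = (\<Sum>i\<in>I. mom I A (unit_vec_fun i) N - \<gamma>)"
  proof (intro sum.cong refl)
    fix i assume i: "i \<in> I"
    show "(sqrt (Re (B (unit_vec_fun i) (unit_vec_fun i))))\<^sup>2 = mom I A (unit_vec_fun i) N - \<gamma>"
      using \<gamma>[of "unit_vec_fun i"] by (simp add: BB unit0[OF i])
  qed
  also have "(\<Sum>i\<in>I. (cmod (z i))\<^sup>2) = mom I A z 0" by (simp add: mom_def dot_self)
  finally show ?thesis unfolding BB trace_pow_def by (simp add: sum_subtractf mult_ac)
qed

end

section \<open>Rank-one updates\<close>

text \<open>A' is always the larger operator. Where samples are added it is the operator after the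
  new sample; where they are subtracted it is the one before.\<close>

locale rank_one_step = pos_op I A \<mu> for I :: "'i set" and A \<mu> +
  fixes A' v R
  assumes step: "A' x = A x + cscale (dot I x v) v"
    and vR: "Re (dot I v v) \<le> R"
begin

lemma pos_op_step: "pos_op I A' \<mu>"
proof (unfold_locales)
  fix x y :: "'i \<Rightarrow> complex" and c
  show "A' (x + y) = A' x + A' y"
    by (simp add: step op_add dot_add fun_eq_iff plus_fun_apply cscale_def algebra_simps)
  show "A' (cscale c x) = cscale c (A' x)"
    by (simp add: step op_scale dot_scale) (simp add: fun_eq_iff plus_fun_apply cscale_def algebra_simps)
  show "dot I (A' x) y = dot I x (A' y)"
    by (simp add: step dot_add dot_add_right sa dot_scale dot_scale_right dot_sym[of I y v])
  have "Re (dot I (A' x) x) = Re (dot I (A x) x) + (cmod (dot I x v))\<^sup>2"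
    by (simp add: step dot_add dot_scale dot_sym[of I x v] cmod_power2) (simp add: power2_eq_square)
  then show "\<mu> * Re (dot I x x) \<le> Re (dot I (A' x) x)"
    using ge[of x] zero_le_power2[of "cmod (dot I x v)"] by linarith
qed (use fin mu_pos in auto)

sublocale up: pos_op I A' \<mu> by (rule pos_op_step)

text \<open>Split the outermost A' into A plus the rank-one part. A crosses over to the other
  argument, and the rank-one part factors into two real moments.\<close>

lemma mixed_step:
  "Re (dot I ((A' ^^ Suc j) v) ((A ^^ k) v)) =
     Re (dot I ((A' ^^ j) v) ((A ^^ Suc k) v)) + mom I A' v j * mom I A v k"
  by (simp add: step dot_add dot_scale sa up.dot_pow_real dot_pow_real')

text \<open>By \<open>mixed_step\<close>, trading one power of A for one of A' adds a product of
  nonnegative moments. So the mixed moments of a fixed degree increase from the pure moment of A to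
  that of A'.\<close>

lemma mixed_bounds:
  "mom I A v (j + k) \<le> Re (dot I ((A' ^^ j) v) ((A ^^ k) v))"
  "Re (dot I ((A' ^^ j) v) ((A ^^ k) v)) \<le> mom I A' v (j + k)"
proof -
  have mn: "0 \<le> mom I A' v j * mom I A v k" for j k
    using mom_nonneg up.mom_nonneg by simp
  show "mom I A v (j + k) \<le> Re (dot I ((A' ^^ j) v) ((A ^^ k) v))"
  proof (induction j arbitrary: k)
    case 0
    then show ?case by (simp add: dot_pow_real')
  next
    case (Suc j)
    show ?case using Suc[of "Suc k"] mn[of j k] unfolding mixed_step by simp
  qed
  show "Re (dot I ((A' ^^ j) v) ((A ^^ k) v)) \<le> mom I A' v (j + k)"
  proof (induction k arbitrary: j)
    case 0
    then show ?case by (simp add: up.dot_pow_real)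
  next
    case (Suc k)
    show ?case using Suc[of "Suc j"] mn[of j k] mixed_step[of j k] by simp
  qed
qed

text \<open>The reverse comparison, with a controlled loss. The two moments differ by N products of
  a moment of A' and one of A, whose degrees add up to N - 1. Replacing A by A' and using Chebyshev
  bounds each of them by the moments of A' of degrees 0 and N - 1; these are at most R and 1 / \<mu>
  times the N-th moment.\<close>

lemma mom_step_le: "mom I A' v N * (1 - N * R / \<mu>) \<le> mom I A v N"
proof -
  have ha: "mom I A v j \<le> mom I A' v j" for j using mixed_bounds[of 0 j] mixed_bounds(1)[of 0 j]
    by simp
  have "mom I A' v N - mom I A v N
      = (\<Sum>j<N. Re (dot I ((A' ^^ Suc j) v) ((A ^^ (N - Suc j)) v)) - Re (dot I ((A' ^^ j) v) ((A ^^ (N - j)) v)))"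
    by (subst sum_lessThan_telescope[of "\<lambda>j. Re (dot I ((A' ^^ j) v) ((A ^^ (N - j)) v))" N])
      (simp add: up.dot_pow_real dot_pow_real')
  also have "\<dots> = (\<Sum>j<N. mom I A' v j * mom I A v (N - Suc j))"
  proof (intro sum.cong refl)
    fix j assume "j \<in> {..<N}"
    then have "N - j = Suc (N - Suc j)" by auto
    then show "Re (dot I ((A' ^^ Suc j) v) ((A ^^ (N - Suc j)) v)) - Re (dot I ((A' ^^ j) v) ((A ^^ (N - j)) v))
        = mom I A' v j * mom I A v (N - Suc j)"
      using mixed_step[of j "N - Suc j"] by simp
  qed
  also have "\<dots> \<le> (\<Sum>j<N. R * mom I A' v N / \<mu>)"
  proof (rule sum_mono)
    fix j assume j: "j \<in> {..<N}"
    have "mom I A' v j * mom I A v (N - Suc j) \<le> mom I A' v j * mom I A' v (N - Suc j)"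
      by (intro mult_left_mono ha up.mom_nonneg)
    also have "\<dots> \<le> mom I A' v 0 * mom I A' v (N - 1)"
      using up.mom_chebyshev[of v j "N - Suc j"] j by simp
    also have "\<dots> \<le> R * mom I A' v (N - 1)"
      using vR by (intro mult_right_mono up.mom_nonneg) (simp add: mom_def)
    also have "\<dots> \<le> R * (mom I A' v N / \<mu>)"
    proof (rule mult_left_mono)
      show "mom I A' v (N - 1) \<le> mom I A' v N / \<mu>"
        using up.mom_growth_mu(1)[of v "N - 1"] j mu_pos by (simp add: field_simps)
      show "0 \<le> R" using vR dot_self_nonneg[of I v] by linarith
    qed
    finally show "mom I A' v j * mom I A v (N - Suc j) \<le> R * mom I A' v N / \<mu>" by simp
  qed
  finally show ?thesis by (simp add: algebra_simps)
qed

text \<open>The trace of A'^j A^(p - j) telescopes in j. By cyclicity of the trace each rank-one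
  increment collapses to a single mixed moment at v, although A and A' need not commute.\<close>

lemma trace_step_eq:
  "trace_pow I A' p - trace_pow I A p = (\<Sum>j<p. Re (dot I ((A' ^^ j) v) ((A ^^ (p - Suc j)) v)))"
proof -
  define T where "T j = (\<Sum>i\<in>I. Re (dot I ((A' ^^ j) ((A ^^ (p - j)) (unit_vec_fun i))) (unit_vec_fun i)))" for j
  have "trace_pow I A' p - trace_pow I A p = T p - T 0"
    unfolding T_def trace_pow_def mom_def by simp
  also have "\<dots> = (\<Sum>j<p. T (Suc j) - T j)" by (rule sum_lessThan_telescope[symmetric])
  also have "\<dots> = (\<Sum>j<p. Re (dot I ((A' ^^ j) v) ((A ^^ (p - Suc j)) v)))"
  proof (intro sum.cong refl)
    fix j assume "j \<in> {..<p}"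
    then have pj: "p - j = Suc (p - Suc j)" by auto
    define q where "q = p - Suc j"
    have "T (Suc j) - T j = (\<Sum>i\<in>I. Re ((A' ^^ j) v i * cnj ((A ^^ q) v i)))"
      unfolding T_def sum_subtractf[symmetric] pj q_def[symmetric]
    proof (intro sum.cong refl)
      fix i assume i: "i \<in> I"
      define y where "y = (A ^^ q) (unit_vec_fun i)"
      have "(A' ^^ Suc j) y = (A' ^^ j) (A' y)" by (simp add: funpow_swap1)
      also have "\<dots> = (A' ^^ j) (A y) + cscale (dot I y v) ((A' ^^ j) v)"
        by (simp add: step up.pow_add up.pow_scale)
      finally have "dot I ((A' ^^ Suc j) y) (unit_vec_fun i)
          = dot I ((A' ^^ j) (A y)) (unit_vec_fun i) + dot I y v * (A' ^^ j) v i"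
        by (simp add: dot_add dot_scale dot_unit[OF fin i])
      \<comment> \<open>Cyclicity in coordinates: A^q moves from the unit vector to v, and the sum
        over i then reassembles an inner product.\<close>
      moreover have "dot I y v = cnj ((A ^^ q) v i)"
        unfolding y_def pow_sa using dot_sym[of I "unit_vec_fun i" "(A ^^ q) v"] dot_unit[OF fin i]
        by (metis complex_cnj_cnj)
      ultimately show "Re (dot I ((A' ^^ Suc j) ((A ^^ q) (unit_vec_fun i))) (unit_vec_fun i)) -
          Re (dot I ((A' ^^ j) ((A ^^ Suc q) (unit_vec_fun i))) (unit_vec_fun i)) =
          Re ((A' ^^ j) v i * cnj ((A ^^ q) v i))"
        unfolding y_def by (simp add: mult.commute)
    qed
    then show "T (Suc j) - T j = Re (dot I ((A' ^^ j) v) ((A ^^ (p - Suc j)) v))"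
      unfolding dot_def q_def by simp
  qed
  finally show ?thesis .
qed

lemma trace_step_bounds:
  "p * mom I A v (p - 1) \<le> trace_pow I A' p - trace_pow I A p"
  "trace_pow I A' p - trace_pow I A p \<le> p * mom I A' v (p - 1)"
proof -
  have e: "j + (p - Suc j) = p - 1" if "j < p" for j using that by simp
  have "p * mom I A v (p - 1) = (\<Sum>j<p. mom I A v (p - 1))" by simp
  also have "\<dots> \<le> (\<Sum>j<p. Re (dot I ((A' ^^ j) v) ((A ^^ (p - Suc j)) v)))"
    using mixed_bounds(1) e by (intro sum_mono) (metis lessThan_iff)
  finally show "p * mom I A v (p - 1) \<le> trace_pow I A' p - trace_pow I A p"
    unfolding trace_step_eq .
  have "(\<Sum>j<p. Re (dot I ((A' ^^ j) v) ((A ^^ (p - Suc j)) v))) \<le> (\<Sum>j<p. mom I A' v (p - 1))"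
    using mixed_bounds(2) e by (intro sum_mono) (metis lessThan_iff)
  then show "trace_pow I A' p - trace_pow I A p \<le> p * mom I A' v (p - 1)"
    unfolding trace_step_eq by simp
qed

end

section \<open>Independent rank-one sums\<close>

text \<open>The shifted sum of the rank-one operators of the first k samples. The sign s is 1 for
  the upper and -1 for the lower estimate.\<close>

definition frame_op ::
  "'i set \<Rightarrow> real \<Rightarrow> real \<Rightarrow> (nat \<Rightarrow> 'i \<Rightarrow> complex) \<Rightarrow> nat \<Rightarrow> ('i \<Rightarrow> complex) \<Rightarrow> 'i \<Rightarrow> complex" where
  "frame_op I c s V k x = (\<lambda>i. of_real c * x i + of_real s * (\<Sum>j<k. dot I x (V j) * V j i))"

lemma frame_op_Suc: "frame_op I c s V (Suc k) x = frame_op I c s V k x + cscale (of_real s * dot I x (V k)) (V k)"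
  by (simp add: frame_op_def fun_eq_iff plus_fun_apply cscale_def algebra_simps)

lemma dot_frame_op:
  "dot I (frame_op I c s V k x) y = of_real c * dot I x y + of_real s * (\<Sum>j<k. dot I x (V j) * dot I (V j) y)"
proof (induction k)
  case 0
  have "frame_op I c s V 0 x = cscale (of_real c) x" by (simp add: frame_op_def cscale_def)
  then show ?case by (simp add: dot_scale)
next
  case (Suc k)
  then show ?case by (simp add: frame_op_Suc dot_add dot_scale algebra_simps)
qed

lemma frame_op_sa: "dot I (frame_op I c s V k x) y = dot I x (frame_op I c s V k y)"
proof -
  have e: "dot I x (V j) * dot I (V j) y = cnj (dot I y (V j) * dot I (V j) x)" for j
    by (simp add: dot_sym[of I "V j" y] dot_sym[of I x "V j"] mult.commute)
  have "dot I x (frame_op I c s V k y) = cnj (dot I (frame_op I c s V k y) x)" by (rule dot_sym)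
  also have "\<dots> = of_real c * cnj (dot I y x) + of_real s * (\<Sum>j<k. cnj (dot I y (V j) * dot I (V j) x))"
    unfolding dot_frame_op by simp
  also have "\<dots> = dot I (frame_op I c s V k x) y"
    unfolding dot_frame_op e[symmetric] dot_sym[of I x y, symmetric] ..
  finally show ?thesis by simp
qed

lemma frame_op_add: "frame_op I c s V k (x + y) = frame_op I c s V k x + frame_op I c s V k y"
  by (simp add: frame_op_def fun_eq_iff plus_fun_apply dot_add algebra_simps sum.distrib)

lemma frame_op_scale: "frame_op I c s V k (cscale b x) = cscale b (frame_op I c s V k x)"
  unfolding frame_op_def fun_eq_iff dot_scale unfolding cscale_def
  by (simp add: sum_distrib_left mult_ac distrib_left)

lemma sa_op_frame_op: "finite I \<Longrightarrow> sa_op I (frame_op I c s V k)"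
  by unfold_locales (simp_all only: frame_op_add frame_op_scale frame_op_sa)

lemma frame_op_form:
  "Re (dot I (frame_op I c s V k x) x) = c * Re (dot I x x) + s * (\<Sum>j<k. (cmod (dot I x (V j)))\<^sup>2)"
proof -
  have "dot I x (V j) * dot I (V j) x = of_real ((cmod (dot I x (V j)))\<^sup>2)" for j
    by (simp add: dot_sym[of I x "V j"] complex_norm_square del: of_real_power)
  then show ?thesis unfolding dot_frame_op by (simp del: of_real_power of_real_mult)
qed

text \<open>The coefficients on the right do not involve u. For a random u the expectation therefore
  acts on the products of entries only, that is, on the covariance.\<close>

lemma (in sa_op) pow_form_expand:
  "dot I ((A ^^ N) u) u = (\<Sum>i\<in>I. \<Sum>j\<in>I. u i * cnj (u j) * dot I ((A ^^ N) (unit_vec_fun i)) (unit_vec_fun j))"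
proof -
  have "(A ^^ N) u i = (\<Sum>j\<in>I. u j * cnj (dot I ((A ^^ N) (unit_vec_fun i)) (unit_vec_fun j)))" if "i \<in> I" for i
  proof -
    have "(A ^^ N) u i = dot I u ((A ^^ N) (unit_vec_fun i))"
      unfolding pow_sa[symmetric] dot_unit[OF fin that] ..
    then show ?thesis by (simp add: dot_def[of I u] dot_unit[OF fin])
  qed
  then have "(\<Sum>i\<in>I. u i * cnj ((A ^^ N) u i))
      = (\<Sum>i\<in>I. \<Sum>j\<in>I. u i * cnj (u j) * dot I ((A ^^ N) (unit_vec_fun i)) (unit_vec_fun j))"
    by (intro sum.cong refl) (simp add: sum_distrib_left mult.assoc)
  then show ?thesis by (simp add: pow_sa dot_def[of I u])
qed

lemma frame_op_upd: "frame_op I c s (V(k := y)) k = frame_op I c s V k"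
  by (rule ext) (simp add: frame_op_def)

lemma dot_restrict_support:
  "dot I (\<lambda>i. if i \<in> I then z i else 0) y = dot I z y"
  "dot I y (\<lambda>i. if i \<in> I then z i else 0) = dot I y z"
  by (simp_all add: dot_def)

text \<open>Markov's inequality for the complementary event, starting from a bound on the
  nonnegative integral, the form in which the sample-by-sample estimates arrive.\<close>

lemma (in prob_space) markov_good_set:
  assumes [measurable]: "f \<in> borel_measurable M" and "\<tau> > 0" "(\<integral>\<^sup>+x. ennreal (f x) \<partial>M) \<le> ennreal b" "b / \<tau> \<le> \<delta>"
    "0 \<le> b"
  shows "{x \<in> space M. f x < \<tau>} \<in> events" "prob {x \<in> space M. f x < \<tau>} \<ge> 1 - \<delta>"
proof -
  have "ennreal \<tau> * emeasure M {x \<in> space M. \<tau> \<le> f x} = (\<integral>\<^sup>+x. ennreal \<tau> * indicator {x \<in> space M. \<tau> \<le> f x} x \<partial>M)"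
    by (simp add: nn_integral_cmult_indicator)
  also have "\<dots> \<le> (\<integral>\<^sup>+x. ennreal (f x) \<partial>M)"
    using assms(2) by (intro nn_integral_mono) (auto simp: indicator_def intro: ennreal_leI)
  also have "\<dots> \<le> ennreal b" by fact
  finally have "ennreal (\<tau> * prob {x \<in> space M. \<tau> \<le> f x}) \<le> ennreal b"
    using assms(2) by (simp add: emeasure_eq_measure ennreal_mult)
  then have "\<tau> * prob {x \<in> space M. \<tau> \<le> f x} \<le> b"
    using assms(5) by (simp add: ennreal_le_iff)
  then have "prob {x \<in> space M. \<tau> \<le> f x} \<le> b / \<tau>"
    using assms(2) by (simp add: field_simps)
  moreover have "{x \<in> space M. f x < \<tau>} = space M - {x \<in> space M. \<tau> \<le> f x}" by auto
  moreover have "prob (space M - {x \<in> space M. \<tau> \<le> f x}) = 1 - prob {x \<in> space M. \<tau> \<le> f x}"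
    by (intro prob_compl) measurable
  ultimately show "prob {x \<in> space M. f x < \<tau>} \<ge> 1 - \<delta>" using assms(4) by simp
qed measurable

lemma borel_measurable_cnj:
  assumes "f \<in> borel_measurable M" shows "(\<lambda>x. cnj (f x)) \<in> borel_measurable M"
proof -
  have "cnj \<in> borel_measurable borel"
    by (intro borel_measurable_continuous_onI continuous_on_cnj continuous_on_id)
  from measurable_compose[OF assms this] show ?thesis .
qed

section \<open>Independent vectors with diagonal covariance\<close>

text \<open>The common setting of both sampling matrices: \<open>v x\<close> is the conjugated row
  belonging to the node x, and orthogonality of the underlying functions in L_2 makes the covariance
  diagonal. The weights w are 1 for the normalized functions and the eigenvalues for the
  e_k.\<close>

locale iid_frame = prob_space M for M :: "'a measure" +
  fixes I :: "'i set" and v :: "'a \<Rightarrow> 'i \<Rightarrow> complex" and R :: real and w :: "'i \<Rightarrow> real"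
  assumes finI: "finite I"
    and meas: "i \<in> I \<Longrightarrow> (\<lambda>x. v x i) \<in> borel_measurable M"
    and bound: "x \<in> space M \<Longrightarrow> Re (dot I (v x) (v x)) \<le> R"
    and cov: "i \<in> I \<Longrightarrow> j \<in> I \<Longrightarrow> (\<integral>x. v x i * cnj (v x j) \<partial>M) = (if i = j then of_real (w i) else 0)"
begin

abbreviation P :: "nat \<Rightarrow> (nat \<Rightarrow> 'a) measure" where
  "P k \<equiv> Pi\<^sub>M {..<k} (\<lambda>_. M)"

lemma prob_space_P: "prob_space (P k)"
  by (intro prob_space_PiM prob_space_axioms)

lemma R_nonneg: "0 \<le> R"
proof -
  obtain x where "x \<in> space M" using not_empty by blast
  then show ?thesis using bound[of x] dot_self_nonneg[of I "v x"] by simp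
qed

lemma entry_bound:
  assumes "x \<in> space M" "i \<in> I" shows "cmod (v x i) \<le> sqrt R"
proof -
  have "(cmod (v x i))\<^sup>2 \<le> (\<Sum>i\<in>I. (cmod (v x i))\<^sup>2)"
    using assms finI by (intro member_le_sum) auto
  also have "\<dots> \<le> R" using bound[OF assms(1)] by (simp add: dot_self)
  finally show ?thesis by (rule real_le_rsqrt)
qed

lemma integrable_entries: "i \<in> I \<Longrightarrow> j \<in> I \<Longrightarrow> integrable M (\<lambda>x. v x i * cnj (v x j))"
proof (rule integrable_const_bound[where B = "sqrt R * sqrt R"])
  assume ij: "i \<in> I" "j \<in> I"
  show "AE x in M. norm (v x i * cnj (v x j)) \<le> sqrt R * sqrt R"
  proof (rule AE_I2)
    fix x assume "x \<in> space M"
    then have "cmod (v x i) * cmod (v x j) \<le> sqrt R * sqrt R"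
      using entry_bound ij R_nonneg by (intro mult_mono) auto
    then show "norm (v x i * cnj (v x j)) \<le> sqrt R * sqrt R" by (simp only: norm_mult complex_mod_cnj)
  qed
  show "(\<lambda>x. v x i * cnj (v x j)) \<in> borel_measurable M"
    using meas ij by (intro borel_measurable_times borel_measurable_cnj)
qed

text \<open>The right side is the trace of A^N times the covariance. A is fixed here; in the
  application it depends on earlier samples, which are independent of x.\<close>

lemma expectation_mom:
  assumes "sa_op I A"
  shows "integrable M (\<lambda>x. mom I A (v x) N)"
    "(\<integral>x. mom I A (v x) N \<partial>M) = (\<Sum>i\<in>I. w i * mom I A (unit_vec_fun i) N)"
proof -
  interpret A: sa_op I A by fact
  let ?c = "\<lambda>i j. dot I ((A ^^ N) (unit_vec_fun i)) (unit_vec_fun j)"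
  have int: "integrable M (\<lambda>x. \<Sum>i\<in>I. \<Sum>j\<in>I. v x i * cnj (v x j) * ?c i j)"
    using integrable_entries by (intro Bochner_Integration.integrable_sum integrable_mult_left) auto
  show "integrable M (\<lambda>x. mom I A (v x) N)"
    unfolding mom_def A.pow_form_expand by (rule integrable_Re[OF int])
  have "(\<integral>x. mom I A (v x) N \<partial>M) = Re (\<integral>x. (\<Sum>i\<in>I. \<Sum>j\<in>I. v x i * cnj (v x j) * ?c i j) \<partial>M)"
    unfolding mom_def A.pow_form_expand[of N "v _"] by (rule integral_Re[OF int])
  also have "(\<integral>x. (\<Sum>i\<in>I. \<Sum>j\<in>I. v x i * cnj (v x j) * ?c i j) \<partial>M)
      = (\<Sum>i\<in>I. \<Sum>j\<in>I. (\<integral>x. v x i * cnj (v x j) \<partial>M) * ?c i j)"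
  proof -
    have "(\<integral>x. (\<Sum>i\<in>I. \<Sum>j\<in>I. v x i * cnj (v x j) * ?c i j) \<partial>M)
        = (\<Sum>i\<in>I. (\<integral>x. (\<Sum>j\<in>I. v x i * cnj (v x j) * ?c i j) \<partial>M))"
      using integrable_entries
      by (intro Bochner_Integration.integral_sum Bochner_Integration.integrable_sum integrable_mult_left) auto
    also have "\<dots> = (\<Sum>i\<in>I. \<Sum>j\<in>I. (\<integral>x. v x i * cnj (v x j) * ?c i j \<partial>M))"
      using integrable_entries
      by (intro sum.cong refl Bochner_Integration.integral_sum integrable_mult_left) auto
    finally show ?thesis by simp
  qed
  also have "\<dots> = (\<Sum>i\<in>I. \<Sum>j\<in>I. if i = j then of_real (w i) * ?c i j else 0)"
    by (intro sum.cong refl) (simp add: cov)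
  also have "\<dots> = (\<Sum>i\<in>I. of_real (w i) * ?c i i)" using finI by simp
  finally show "(\<integral>x. mom I A (v x) N \<partial>M) = (\<Sum>i\<in>I. w i * mom I A (unit_vec_fun i) N)"
    unfolding mom_def by simp
qed

lemma measurable_frame_pow:
  assumes "k \<le> n" "l \<in> I"
  shows "(\<lambda>X. (frame_op I c s (\<lambda>j. v (X j)) k ^^ N) u l) \<in> borel_measurable (P n)"
  using assms(2)
proof (induction N arbitrary: l)
  case (Suc N)
  have v[measurable]: "(\<lambda>X. v (X j) i) \<in> borel_measurable (P n)" if "j < k" "i \<in> I" for i j
  proof (rule measurable_compose[where f = "\<lambda>X. X j" and g = "\<lambda>x. v x i"])
    show "(\<lambda>X. X j) \<in> P n \<rightarrow>\<^sub>M M" using that assms by (intro measurable_component_singleton) auto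
  qed (use meas that in simp)
  have "(\<lambda>X. dot I ((frame_op I c s (\<lambda>j. v (X j)) k ^^ N) u) (v (X j))) \<in> borel_measurable (P n)" if "j < k" for j
    unfolding dot_def using that Suc.IH v
    by (intro borel_measurable_sum borel_measurable_times borel_measurable_cnj) auto
  then have "(\<lambda>X. of_real c * (frame_op I c s (\<lambda>j. v (X j)) k ^^ N) u l + of_real s *
      (\<Sum>j<k. dot I ((frame_op I c s (\<lambda>j. v (X j)) k ^^ N) u) (v (X j)) * v (X j) l)) \<in> borel_measurable (P n)"
    using Suc v by (intro borel_measurable_add borel_measurable_times borel_measurable_sum) auto
  then show ?case by (simp add: frame_op_def[of I c s _ k "(_ ^^ N) u"])
qed simp

lemma measurable_trace:
  "k \<le> n \<Longrightarrow> (\<lambda>X. trace_pow I (frame_op I c s (\<lambda>j. v (X j)) k) N) \<in> borel_measurable (P n)"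
  unfolding trace_pow_def mom_def
  using measurable_frame_pow[of k n _ N c s] finI
  by (intro borel_measurable_sum measurable_compose[OF _ borel_measurable_Re]) (simp add: dot_unit)

text \<open>Fubini with the newest sample innermost: the inner integral is the conditional
  expectation given the first k nodes.\<close>

lemma nn_integral_P_Suc:
  assumes "f \<in> borel_measurable (P (Suc k))"
  shows "(\<integral>\<^sup>+X. f X \<partial>P (Suc k)) = (\<integral>\<^sup>+X. (\<integral>\<^sup>+x. f (X(k := x)) \<partial>M) \<partial>P k)"
proof -
  interpret product_sigma_finite "\<lambda>_::nat. M" by unfold_locales
  show ?thesis
    using product_nn_integral_insert[of "{..<k}" k f] assms by (simp add: lessThan_Suc)
qed

end

lemma mom_frame_zero:
  assumes "finite I" "i \<in> I"
  shows "mom I (frame_op I c s V 0) (unit_vec_fun i) p = c ^ p"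
proof -
  have e: "frame_op I c s V 0 u = cscale (of_real c) u" for u
    by (simp add: frame_op_def cscale_def)
  have "(frame_op I c s V 0 ^^ N) u = cscale (of_real (c ^ N)) u" for N u
    by (induction N) (simp_all add: e cscale_def mult.assoc)
  then show ?thesis
    using dot_unit[OF assms, of "unit_vec_fun i"]
    by (simp add: mom_def dot_scale unit_vec_fun_def del: of_real_power)
qed

context iid_frame begin

section \<open>The upper frame bound\<close>

definition Phi :: "nat \<Rightarrow> real \<Rightarrow> (nat \<Rightarrow> 'a) \<Rightarrow> nat \<Rightarrow> real" where
  "Phi p c X k = trace_pow I (frame_op I c 1 (\<lambda>j. v (X j)) k) p - c ^ p * card I"

text \<open>The trace of the covariance is the expected squared norm.\<close>

lemma sum_w_le: "(\<Sum>i\<in>I. w i) \<le> R"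
proof -
  \<comment> \<open>A moment of degree 0 is the squared norm for any operator; the identity serves
    as the operator here.\<close>
  let ?A = "frame_op I 1 0 (\<lambda>_ _. 0) 0"
  have A: "sa_op I ?A" by (rule sa_op_frame_op[OF finI])
  have "(\<Sum>i\<in>I. w i) = (\<Sum>i\<in>I. w i * mom I ?A (unit_vec_fun i) 0)"
    by (intro sum.cong refl) (simp add: mom_def dot_unit[OF finI], simp add: unit_vec_fun_def)
  also have "\<dots> = (\<integral>x. mom I ?A (v x) 0 \<partial>M)" using expectation_mom(2)[OF A] by simp
  also have "\<dots> \<le> (\<integral>x. R \<partial>M)"
    by (rule integral_mono[OF expectation_mom(1)[OF A]]) (use bound in \<open>auto simp: mom_def\<close>)
  finally show ?thesis by (simp add: prob_space)
qed

lemma frame_upd: "(\<lambda>j. v ((X(k := x)) j)) = (\<lambda>j. v (X j))(k := v x)"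
  by auto

lemma mom_unit_0: "i \<in> I \<Longrightarrow> mom I A (unit_vec_fun i) 0 = 1"
  by (simp add: mom_def dot_unit[OF finI]) (simp add: unit_vec_fun_def)

context
  fixes p :: nat and c s :: real
  assumes p: "p \<ge> 1" and c: "c > 0" "2 * real p * R \<le> c" and s: "\<And>i. i \<in> I \<Longrightarrow> w i \<le> s" "0 \<le> s"
begin

lemma pos_op_upper: "pos_op I (frame_op I c 1 V k) c"
proof -
  interpret sa_op I "frame_op I c 1 V k" by (rule sa_op_frame_op[OF finI])
  show ?thesis by unfold_locales (auto simp: c frame_op_form sum_nonneg)
qed

lemma Phi_nonneg: "0 \<le> Phi p c X k"
proof -
  interpret pos_op I "frame_op I c 1 (\<lambda>j. v (X j)) k" c by (rule pos_op_upper)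
  have "(\<Sum>i\<in>I. c ^ p) \<le> trace_pow I (frame_op I c 1 (\<lambda>j. v (X j)) k) p"
    unfolding trace_pow_def using mom_growth_mu(2)[of p] mom_unit_0 by (intro sum_mono) (metis mult.right_neutral)
  then show ?thesis by (simp add: Phi_def mult.commute)
qed

text \<open>The increment is at most 2 p times a moment of degree p - 1 of the old operator at the
  new sample, whose expectation is a weighted sum of diagonal moments. Their excess over c^(p - 1)
  is controlled through the largest weight s by \<open>Phi\<close> itself, the constant part through
  the sum of the weights. Using s for the constant part as well would bring in
  \<open>card I\<close>.\<close>

lemma Phi_step:
  "(\<integral>\<^sup>+x. ennreal (Phi p c (X(k := x)) (Suc k)) \<partial>M) \<le> ennreal ((1 + 2 * real p * s / c) * Phi p c X k + 2 * real p * c ^ (p - 1) * R)"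
proof -
  let ?A = "frame_op I c 1 (\<lambda>j. v (X j)) k"
  interpret A: pos_op I ?A c by (rule pos_op_upper)
  have pt: "Phi p c (X(k := x)) (Suc k) \<le> Phi p c X k + 2 * real p * mom I ?A (v x) (p - 1)" if x: "x \<in> space M" for x
  proof -
    let ?A' = "frame_op I c 1 (\<lambda>j. v ((X(k := x)) j)) (Suc k)"
    interpret step: rank_one_step I ?A c ?A' "v x" R
      by unfold_locales (simp_all add: frame_op_Suc frame_upd frame_op_upd bound[OF x] del: fun_upd_apply, simp)
    let ?h = "mom I ?A' (v x) (p - 1)"
    \<comment> \<open>The loss in \<open>mom_step_le\<close> is at most one half, since the shift c
      is at least 2 p R; this is the factor 2 in the increment.\<close>
    have "real (p - 1) * R / c \<le> real p * R / c"
      using R_nonneg c by (intro divide_right_mono mult_right_mono) auto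
    also have "\<dots> \<le> 1 / 2" using c by (simp add: field_simps)
    finally have "?h * (1 / 2) \<le> ?h * (1 - real (p - 1) * R / c)"
      by (intro mult_left_mono step.up.mom_nonneg) simp
    also have "\<dots> \<le> mom I ?A (v x) (p - 1)" by (rule step.mom_step_le)
    finally have "p * ?h \<le> p * (2 * mom I ?A (v x) (p - 1))" by (intro mult_left_mono) auto
    then show ?thesis using step.trace_step_bounds(2)[of p] by (simp add: Phi_def)
  qed
  have unit1: "mom I ?A (unit_vec_fun i) (p - 1) - c ^ (p - 1) \<le> (mom I ?A (unit_vec_fun i) p - c ^ p) / c"
    and unit0: "0 \<le> mom I ?A (unit_vec_fun i) (p - 1) - c ^ (p - 1)" if "i \<in> I" for i
  proof -
    have "c * mom I ?A (unit_vec_fun i) (p - 1) \<le> mom I ?A (unit_vec_fun i) p"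
      using A.mom_growth_mu(1)[of _ "p - 1"] p by simp
    moreover have "c ^ p = c * c ^ (p - 1)" using p by (cases p) auto
    ultimately show "mom I ?A (unit_vec_fun i) (p - 1) - c ^ (p - 1) \<le> (mom I ?A (unit_vec_fun i) p - c ^ p) / c"
      using c by (simp add: field_simps)
    show "0 \<le> mom I ?A (unit_vec_fun i) (p - 1) - c ^ (p - 1)"
      using A.mom_growth_mu(2)[of "p - 1" "unit_vec_fun i"] mom_unit_0[OF that] by simp
  qed
  have "(\<Sum>i\<in>I. w i * mom I ?A (unit_vec_fun i) (p - 1))
      = (\<Sum>i\<in>I. w i * (mom I ?A (unit_vec_fun i) (p - 1) - c ^ (p - 1))) + c ^ (p - 1) * (\<Sum>i\<in>I. w i)"
    unfolding right_diff_distrib sum_subtractf by (simp add: sum_distrib_right[symmetric] mult.commute)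
  also have "\<dots> \<le> (\<Sum>i\<in>I. s * ((mom I ?A (unit_vec_fun i) p - c ^ p) / c)) + c ^ (p - 1) * R"
    using s unit0 unit1 c sum_w_le by (intro add_mono sum_mono mult_mono[of "w _"] mult_left_mono[of "sum w I"]) auto
  also have "(\<Sum>i\<in>I. s * ((mom I ?A (unit_vec_fun i) p - c ^ p) / c)) = s / c * Phi p c X k"
    by (simp add: Phi_def trace_pow_def sum_distrib_left[symmetric] sum_divide_distrib[symmetric] sum_subtractf mult.commute)
  finally have ea: "(\<integral>x. mom I ?A (v x) (p - 1) \<partial>M) \<le> s / c * Phi p c X k + c ^ (p - 1) * R"
    unfolding expectation_mom(2)[OF A.sa_op_axioms] .
  have int: "integrable M (\<lambda>x. Phi p c X k + 2 * real p * mom I ?A (v x) (p - 1))"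
    using expectation_mom(1)[OF A.sa_op_axioms] by auto
  have "(\<integral>\<^sup>+x. ennreal (Phi p c (X(k := x)) (Suc k)) \<partial>M)
      \<le> (\<integral>\<^sup>+x. ennreal (Phi p c X k + 2 * real p * mom I ?A (v x) (p - 1)) \<partial>M)"
    using pt by (intro nn_integral_mono ennreal_leI)
  also have "\<dots> = ennreal (\<integral>x. Phi p c X k + 2 * real p * mom I ?A (v x) (p - 1) \<partial>M)"
    using Phi_nonneg A.mom_nonneg by (intro nn_integral_eq_integral int AE_I2) auto
  also have "(\<integral>x. Phi p c X k + 2 * real p * mom I ?A (v x) (p - 1) \<partial>M) = Phi p c X k + 2 * real p * (\<integral>x. mom I ?A (v x) (p - 1) \<partial>M)"
    using expectation_mom(1)[OF A.sa_op_axioms] by (simp add: prob_space)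
  also have "ennreal \<dots> \<le> ennreal (Phi p c X k + 2 * real p * (s / c * Phi p c X k + c ^ (p - 1) * R))"
    using ea by (intro ennreal_leI add_left_mono mult_left_mono) auto
  finally show ?thesis by (simp add: algebra_simps del: fun_upd_apply)
qed

text \<open>A rough solution of the linear recursion of \<open>Phi_step\<close>. It starts at 0
  because the shifted identity alone has trace exactly c^p \<open>card I\<close>, and the growth
  factor is at least 1.\<close>

lemma Phi_expectation:
  "(\<integral>\<^sup>+X. ennreal (Phi p c X k) \<partial>P k) \<le> ennreal (k * (1 + 2 * real p * s / c) ^ k * (2 * real p * c ^ (p - 1) * R))"
proof (induction k)
  case 0
  have "Phi p c X 0 = 0" for X
    by (simp add: Phi_def trace_pow_def mom_frame_zero[OF finI])
  then show ?case by simp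
next
  case (Suc k)
  let ?q = "1 + 2 * real p * s / c" and ?b = "2 * real p * c ^ (p - 1) * R"
  interpret Pk: prob_space "P k" by (rule prob_space_P)
  have q: "1 \<le> ?q" using c s by simp
  have b: "0 \<le> ?b" using c R_nonneg by simp
  have [measurable]: "(\<lambda>X. Phi p c X k) \<in> borel_measurable (P n)" if "k \<le> n" for k n
    unfolding Phi_def by (intro borel_measurable_diff measurable_trace[OF that] borel_measurable_const)
  have "(\<integral>\<^sup>+X. ennreal (Phi p c X (Suc k)) \<partial>P (Suc k)) = (\<integral>\<^sup>+X. (\<integral>\<^sup>+x. ennreal (Phi p c (X(k := x)) (Suc k)) \<partial>M) \<partial>P k)"
    by (rule nn_integral_P_Suc) measurable
  also have "\<dots> \<le> (\<integral>\<^sup>+X. ennreal ?q * ennreal (Phi p c X k) + ennreal ?b \<partial>P k)"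
  proof (rule nn_integral_mono)
    fix X
    have "ennreal (?q * Phi p c X k + ?b) = ennreal ?q * ennreal (Phi p c X k) + ennreal ?b"
      using q b Phi_nonneg by (simp add: ennreal_plus ennreal_mult)
    then show "(\<integral>\<^sup>+x. ennreal (Phi p c (X(k := x)) (Suc k)) \<partial>M) \<le> ennreal ?q * ennreal (Phi p c X k) + ennreal ?b"
      using Phi_step[of X k] by simp
  qed
  also have "\<dots> = ennreal ?q * (\<integral>\<^sup>+X. ennreal (Phi p c X k) \<partial>P k) + ennreal ?b"
    by (simp add: nn_integral_add nn_integral_cmult Pk.emeasure_space_1)
  also have "\<dots> \<le> ennreal ?q * ennreal (k * ?q ^ k * ?b) + ennreal ?b"
    by (intro add_right_mono mult_left_mono Suc) simp
  also have "\<dots> = ennreal (?q * (k * ?q ^ k * ?b) + ?b)"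
    using q b by (simp add: ennreal_plus ennreal_mult)
  also have "\<dots> \<le> ennreal (Suc k * ?q ^ Suc k * ?b)"
  proof (rule ennreal_leI)
    have gen: "q * (k * Q * b) + b \<le> Suc k * (q * Q) * b" if "1 * b \<le> q * Q * b" for q Q b :: real
      using that by (simp add: algebra_simps)
    have "1 * ?b \<le> ?q ^ Suc k * ?b" using q b by (intro mult_right_mono one_le_power) auto
    then show "?q * (k * ?q ^ k * ?b) + ?b \<le> Suc k * ?q ^ Suc k * ?b"
      unfolding power_Suc by (rule gen)
  qed
  finally show ?case .
qed

end

text \<open>A violating z has Rayleigh quotient above 2 c for the shifted operator, so the potential
  exceeds (2^p - 1) c^p. Its expectation is at most n e^(p/4) c^p, and Markov's inequality compares
  e^(p/4) with 2^p.\<close>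

theorem upper_frame_bound:
  fixes p n :: nat and c s :: real
  assumes p: "p \<ge> 1" and c: "c > 0" "2 * real p * R \<le> c" "8 * real n * s \<le> c"
    and s: "\<And>i. i \<in> I \<Longrightarrow> w i \<le> s" "0 \<le> s"
  obtains G where "G \<in> sets (P n)" "measure (P n) G \<ge> 1 - 2 * real n * exp (- real p / 3)"
    "\<And>X z. X \<in> G \<Longrightarrow> (\<Sum>j<n. (cmod (dot I z (v (X j))))\<^sup>2) \<le> c * Re (dot I z z)"
proof -
  interpret Pn: prob_space "P n" by (rule prob_space_P)
  note facts = p c(1,2) s
  define \<tau> where "\<tau> = (2 ^ p - 1) * c ^ p"
  define G where "G = {X \<in> space (P n). Phi p c X n < \<tau>}"
  have two: "(2::real) ^ p \<ge> 2" using p by (cases p) auto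
  then have \<tau>: "\<tau> > 0" unfolding \<tau>_def using c by simp
  let ?q = "1 + 2 * real p * s / c" and ?b = "2 * real p * c ^ (p - 1) * R"
  have meas: "(\<lambda>X. Phi p c X n) \<in> borel_measurable (P n)"
    unfolding Phi_def by (intro borel_measurable_diff measurable_trace[OF order_refl] borel_measurable_const)
  have b0: "0 \<le> n * ?q ^ n * ?b" using c s R_nonneg by (intro mult_nonneg_nonneg zero_le_power) auto
  have le: "n * ?q ^ n * ?b / \<tau> \<le> 2 * real n * exp (- real p / 3)"
  proof -
    have "?q ^ n \<le> exp (2 * real p * s / c) ^ n" using c s by (intro power_mono exp_ge_add_one_self) auto
    also have "\<dots> = exp (n * (2 * real p * s / c))" by (rule exp_of_nat_mult[symmetric])
    \<comment> \<open>The requirement 8 n s \<le> c enters here: it limits the accumulated growth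
      over n samples to e^(p/4).\<close>
    also have "n * (2 * real p * s / c) = p / 4 * (8 * real n * s / c)" by simp
    also have "exp \<dots> \<le> exp (p / 4 * 1)" using c by (intro exp_le_cancel_iff[THEN iffD2] mult_left_mono) auto
    finally have 1: "?q ^ n \<le> exp (p / 4)" by simp
    have cp: "c ^ p = c * c ^ (p - 1)" using p by (cases p) auto
    have 2: "?b \<le> c ^ p" unfolding cp using c mult_right_mono[OF c(2), of "c ^ (p - 1)"] by (simp add: mult_ac)
    have 3: "2 ^ p * c ^ p / 2 \<le> \<tau>" unfolding \<tau>_def using two c mult_right_mono[of "2 ^ p / 2" "2 ^ p - 1" "c ^ p"] by simp
    have "n * ?q ^ n * ?b / \<tau> \<le> n * exp (p / 4) * c ^ p / (2 ^ p * c ^ p / 2)"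
      using 1 2 3 c R_nonneg s(2) by (intro frac_le mult_mono mult_nonneg_nonneg zero_le_power) auto
    also have "\<dots> = 2 * real n * (exp (p / 4) / 2 ^ p)" using c by simp
    also have "(2::real) ^ p = exp (p * ln 2)" by (simp add: exp_of_nat_mult)
    also have "exp (p / 4) / exp (p * ln 2) = exp (p / 4 - p * ln 2)" by (rule exp_diff[symmetric])
    also have "2 * real n * \<dots> \<le> 2 * real n * exp (- real p / 3)"
    proof -
      \<comment> \<open>The exponent 1/4 - ln 2 is at most 1/4 - 2/3 = -5/12, which is below
        -1/3.\<close>
      have "real p * (2 / 3) \<le> p * ln 2" using ln2_ge_two_thirds by (intro mult_left_mono) auto
      then have "p / 4 - p * ln 2 \<le> - real p / 3" by simp
      then have "exp (p / 4 - p * ln 2) \<le> exp (- real p / 3)" by simp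
      then show ?thesis by (rule mult_left_mono) simp
    qed
    finally show ?thesis .
  qed
  have prob: "G \<in> sets (P n)" "measure (P n) G \<ge> 1 - 2 * real n * exp (- real p / 3)"
    unfolding G_def using Pn.markov_good_set[OF meas \<tau> Phi_expectation[OF facts] le b0] by auto
  have "(\<Sum>j<n. (cmod (dot I z (v (X j))))\<^sup>2) \<le> c * Re (dot I z z)" if X: "X \<in> G" for X z
  proof (rule ccontr)
    let ?A = "frame_op I c 1 (\<lambda>j. v (X j)) n"
    interpret A: pos_op I ?A c by (rule pos_op_upper[OF facts])
    \<comment> \<open>Entries outside I do not affect \<open>dot I\<close>, but
      \<open>mom_le_trace_pow\<close> wants them to be 0.\<close>
    define y where "y i = (if i \<in> I then z i else 0)" for i
    have yz: "dot I y u = dot I z u" "dot I u y = dot I u z" for u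
      unfolding y_def by (rule dot_restrict_support)+
    assume "\<not> (\<Sum>j<n. (cmod (dot I z (v (X j))))\<^sup>2) \<le> c * Re (dot I z z)"
    then have 1: "(2 * c) * mom I ?A y 0 < mom I ?A y 1"
      by (simp add: mom_def frame_op_form) (simp add: yz)
    have y0: "mom I ?A y 0 > 0"
    proof (rule ccontr)
      assume "\<not> ?thesis"
      then have "mom I ?A y 0 = 0" using A.mom_nonneg by (metis less_le)
      with A.mom_chebyshev[of y 1 1] 1 show False by (simp add: mult_le_0_iff)
    qed
    have "(2 * c) ^ p * mom I ?A y 0 \<le> mom I ?A y p"
      using 1 c by (intro A.mom_growth(2)) auto
    moreover have "mom I ?A y p - c ^ p * mom I ?A y 0 \<le> Phi p c X n * mom I ?A y 0"
      unfolding Phi_def using A.mom_growth_mu(2) by (intro A.mom_le_trace_pow) (auto simp: y_def)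
    moreover have "Phi p c X n * mom I ?A y 0 < \<tau> * mom I ?A y 0"
      using X y0 unfolding G_def by simp
    ultimately show False unfolding \<tau>_def by (simp add: power_mult_distrib algebra_simps)
  qed
  with prob that show ?thesis by blast
qed

section \<open>The lower frame bound\<close>

text \<open>Each subtracted sample lowers the operator by at most R, so at most n samples leave n R
  of the initial 2 n R.\<close>

lemma pos_op_lower:
  assumes n: "n \<ge> 1" and k: "k \<le> n" and R: "R > 0" and V: "\<And>j. j < k \<Longrightarrow> Re (dot I (V j) (V j)) \<le> R"
  shows "pos_op I (frame_op I (2 * real n * R) (- 1) V k) (n * R)"
proof -
  interpret sa_op I "frame_op I (2 * real n * R) (- 1) V k" by (rule sa_op_frame_op[OF finI])
  show ?thesis
  proof unfold_locales
    show "0 < n * R" using n R by simp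
    fix x
    have "(\<Sum>j<k. (cmod (dot I x (V j)))\<^sup>2) \<le> (\<Sum>j<k. Re (dot I x x) * R)"
    proof (rule sum_mono)
      fix j assume "j \<in> {..<k}"
      then have "Re (dot I x x) * Re (dot I (V j) (V j)) \<le> Re (dot I x x) * R"
        using V by (intro mult_left_mono dot_self_nonneg) auto
      with dot_cauchy_schwarz[of I x "V j"] show "(cmod (dot I x (V j)))\<^sup>2 \<le> Re (dot I x x) * R" by linarith
    qed
    also have "\<dots> \<le> n * (R * Re (dot I x x))"
      using k R dot_self_nonneg[of I x] by (simp add: mult_ac mult_right_mono)
    finally show "n * R * Re (dot I x x) \<le> Re (dot I (frame_op I (2 * real n * R) (- 1) V k x) x)"
      by (simp add: frame_op_form algebra_simps)
  qed
qed

definition Psi :: "nat \<Rightarrow> nat \<Rightarrow> (nat \<Rightarrow> 'a) \<Rightarrow> nat \<Rightarrow> real" where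
  "Psi n p X k = trace_pow I (frame_op I (2 * real n * R) (- 1) (\<lambda>j. v (X j)) k) p"

text \<open>A sample lowers the trace by at least 7/8 p times the moment of degree p - 1 of the old
  operator. Since all weights are 1, the expectation of this moment is the full trace of the (p -
  1)-st power, which is at least the trace of the p-th power divided by 2 n R. The decrease is
  therefore proportional to the potential itself.\<close>

lemma Psi_step:
  assumes n: "n \<ge> 1" and k: "k < n" and R: "R > 0" and w1: "\<And>i. i \<in> I \<Longrightarrow> w i = 1"
    and p: "p = 2 * q + 1" "8 * (2 * q) \<le> n"
    and X: "X \<in> space (P k)"
  shows "(\<integral>\<^sup>+x. ennreal (Psi n p (X(k := x)) (Suc k)) \<partial>M) \<le> ennreal ((1 - 7 * real p / (16 * real n * R)) * Psi n p X k)"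
proof -
  let ?c = "2 * real n * R" and ?A' = "frame_op I (2 * real n * R) (- 1) (\<lambda>j. v (X j)) k"
  have Xj: "X j \<in> space M" if "j < k" for j using X that by (auto simp: space_PiM)
  interpret A': pos_op I ?A' "n * R"
    using n k R bound Xj by (intro pos_op_lower) auto
  have pt: "Psi n p (X(k := x)) (Suc k) \<le> Psi n p X k - 7 / 8 * p * mom I ?A' (v x) (p - 1)"
    and pos: "0 \<le> Psi n p (X(k := x)) (Suc k)" if x: "x \<in> space M" for x
  proof -
    let ?A = "frame_op I ?c (- 1) (\<lambda>j. v ((X(k := x)) j)) (Suc k)"
    interpret A: pos_op I ?A "n * R"
      using n k R bound Xj x by (intro pos_op_lower) (auto simp: less_Suc_eq)
    \<comment> \<open>The roles are reversed: the operator before the sample is the new one plus the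
      rank-one part.\<close>
    interpret step: rank_one_step I ?A "n * R" ?A' "v x" R
    proof unfold_locales
      fix y
      have "cscale (- 1 * dot I y (v x)) (v x) + cscale (dot I y (v x)) (v x) = 0"
        by (simp add: cscale_def fun_eq_iff plus_fun_apply)
      then show "?A' y = ?A y + cscale (dot I y (v x)) (v x)"
        unfolding frame_op_Suc frame_upd frame_op_upd by (simp add: add.assoc)
    qed (rule bound[OF x])
    \<comment> \<open>Here p - 1 = 2 q \<le> n / 8, so the comparison of moments loses at most
      1/8.\<close>
    have "real (p - 1) * R / (n * R) \<le> 1 / 8" using p R n by (simp add: field_simps)
    then have "mom I ?A' (v x) (p - 1) * (7 / 8) \<le> mom I ?A' (v x) (p - 1) * (1 - real (p - 1) * R / (n * R))"
      by (intro mult_left_mono A'.mom_nonneg) simp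
    also have "\<dots> \<le> mom I ?A (v x) (p - 1)" by (rule step.mom_step_le)
    finally have "p * (mom I ?A' (v x) (p - 1) * (7 / 8)) \<le> p * mom I ?A (v x) (p - 1)"
      by (intro mult_left_mono) auto
    then show "Psi n p (X(k := x)) (Suc k) \<le> Psi n p X k - 7 / 8 * p * mom I ?A' (v x) (p - 1)"
      using step.trace_step_bounds(1)[of p] by (simp add: Psi_def)
    show "0 \<le> Psi n p (X(k := x)) (Suc k)" unfolding Psi_def by (rule A.trace_pow_nonneg)
  qed
  \<comment> \<open>An odd p makes p - 1 even, so both moments are forms at the same vector A'^q
    e_i; the operator is at most 2 n R, because the samples are subtracted.\<close>
  have unit: "mom I ?A' (unit_vec_fun i) p \<le> ?c * mom I ?A' (unit_vec_fun i) (p - 1)" for i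
  proof -
    let ?y = "(?A' ^^ q) (unit_vec_fun i)"
    have 1: "mom I ?A' (unit_vec_fun i) p = Re (dot I (?A' ?y) ?y)"
      unfolding A'.mom_even_odd(2)[symmetric] p(1) by simp
    have 2: "mom I ?A' (unit_vec_fun i) (p - 1) = Re (dot I ?y ?y)"
      unfolding A'.mom_even_odd(1)[symmetric] p(1) by simp
    show ?thesis unfolding 1 2 frame_op_form by (simp add: sum_nonneg)
  qed
  have "Psi n p X k \<le> ?c * (\<Sum>i\<in>I. mom I ?A' (unit_vec_fun i) (p - 1))"
    unfolding Psi_def trace_pow_def sum_distrib_left using unit by (intro sum_mono)
  also have "(\<Sum>i\<in>I. mom I ?A' (unit_vec_fun i) (p - 1)) = (\<integral>x. mom I ?A' (v x) (p - 1) \<partial>M)"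
    unfolding expectation_mom(2)[OF A'.sa_op_axioms] using w1 by simp
  finally have E: "Psi n p X k / ?c \<le> (\<integral>x. mom I ?A' (v x) (p - 1) \<partial>M)"
    using n R by (simp add: field_simps)
  have int: "integrable M (\<lambda>x. Psi n p X k - 7 / 8 * p * mom I ?A' (v x) (p - 1))"
    using expectation_mom(1)[OF A'.sa_op_axioms] by auto
  have "(\<integral>\<^sup>+x. ennreal (Psi n p (X(k := x)) (Suc k)) \<partial>M)
      \<le> (\<integral>\<^sup>+x. ennreal (Psi n p X k - 7 / 8 * p * mom I ?A' (v x) (p - 1)) \<partial>M)"
    using pt by (intro nn_integral_mono ennreal_leI)
  also have "\<dots> = ennreal (\<integral>x. Psi n p X k - 7 / 8 * p * mom I ?A' (v x) (p - 1) \<partial>M)"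
    using pt pos by (intro nn_integral_eq_integral int AE_I2) (meson order_trans)
  also have "(\<integral>x. Psi n p X k - 7 / 8 * p * mom I ?A' (v x) (p - 1) \<partial>M)
      = Psi n p X k - 7 / 8 * p * (\<integral>x. mom I ?A' (v x) (p - 1) \<partial>M)"
    using expectation_mom(1)[OF A'.sa_op_axioms] by (simp add: prob_space)
  also have "ennreal \<dots> \<le> ennreal (Psi n p X k - 7 / 8 * p * (Psi n p X k / ?c))"
    using E by (intro ennreal_leI diff_left_mono mult_left_mono) auto
  also have "Psi n p X k - 7 / 8 * p * (Psi n p X k / ?c) = (1 - 7 * real p / (16 * real n * R)) * Psi n p X k"
    by (simp add: algebra_simps)
  finally show ?thesis .
qed

lemma Psi_expectation:
  assumes n: "n \<ge> 1" and k: "k \<le> n" and R: "R \<ge> 1" and w1: "\<And>i. i \<in> I \<Longrightarrow> w i = 1"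
    and p: "p = 2 * q + 1" "8 * (2 * q) \<le> n"
  shows "(\<integral>\<^sup>+X. ennreal (Psi n p X k) \<partial>P k) \<le> ennreal ((1 - 7 * real p / (16 * real n * R)) ^ k * (card I * (2 * real n * R) ^ p))"
  using k
proof (induction k)
  case 0
  have "Psi n p X 0 = card I * (2 * real n * R) ^ p" for X
    by (simp add: Psi_def trace_pow_def mom_frame_zero[OF finI])
  moreover have "prob_space (P 0)" by (rule prob_space_P)
  ultimately show ?case by (simp add: prob_space.emeasure_space_1)
next
  case (Suc k)
  let ?q = "1 - 7 * real p / (16 * real n * R)" and ?b = "card I * (2 * real n * R) ^ p"
  have "7 * real p \<le> 16 * real n" using p n by simp
  also have "16 * real n * 1 \<le> 16 * real n * R" using R by (intro mult_left_mono) auto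
  finally have q: "0 \<le> ?q" using n R by (simp add: field_simps)
  have meas[measurable]: "(\<lambda>X. Psi n p X k) \<in> borel_measurable (P l)" if "k \<le> l" for k l
    unfolding Psi_def by (rule measurable_trace[OF that])
  have "(\<integral>\<^sup>+X. ennreal (Psi n p X (Suc k)) \<partial>P (Suc k)) = (\<integral>\<^sup>+X. (\<integral>\<^sup>+x. ennreal (Psi n p (X(k := x)) (Suc k)) \<partial>M) \<partial>P k)"
    by (rule nn_integral_P_Suc) measurable
  also have "\<dots> \<le> (\<integral>\<^sup>+X. ennreal ?q * ennreal (Psi n p X k) \<partial>P k)"
  proof (rule nn_integral_mono)
    fix X assume "X \<in> space (P k)"
    then have "(\<integral>\<^sup>+x. ennreal (Psi n p (X(k := x)) (Suc k)) \<partial>M) \<le> ennreal (?q * Psi n p X k)"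
      using Suc.prems R by (intro Psi_step[OF n _ _ w1 p]) auto
    also have "\<dots> = ennreal ?q * ennreal (Psi n p X k)" by (rule ennreal_mult'[OF q])
    finally show "(\<integral>\<^sup>+x. ennreal (Psi n p (X(k := x)) (Suc k)) \<partial>M) \<le> ennreal ?q * ennreal (Psi n p X k)" .
  qed
  also have "\<dots> = ennreal ?q * (\<integral>\<^sup>+X. ennreal (Psi n p X k) \<partial>P k)"
    by (simp add: nn_integral_cmult)
  also have "\<dots> \<le> ennreal ?q * ennreal (?q ^ k * ?b)"
    using Suc by (intro mult_left_mono) auto
  also have "\<dots> = ennreal (?q ^ Suc k * ?b)"
    using q R by (simp add: ennreal_mult[symmetric] mult.assoc)
  finally show ?case .
qed

text \<open>Over n samples the potential shrinks in expectation by exp (-7 p / (16 R)). A violating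
  z has Rayleigh quotient above 2 n R - n / 4, which costs a factor of at least exp (-p / (4 R))
  only. The margin 7/16 - 4/16 = 3/16 and n \<le> 16 p give the exponent 3 n / (256 R).\<close>

theorem lower_frame_bound:
  fixes n :: nat
  assumes n: "n \<ge> 16" and R: "R \<ge> 1" and w1: "\<And>i. i \<in> I \<Longrightarrow> w i = 1"
  obtains G where "G \<in> sets (P n)" "measure (P n) G \<ge> 1 - card I * exp (- 3 * real n / (256 * R))"
    "\<And>X z. X \<in> G \<Longrightarrow> n / 4 * Re (dot I z z) \<le> (\<Sum>j<n. (cmod (dot I z (v (X j))))\<^sup>2)"
proof -
  interpret Pn: prob_space "P n" by (rule prob_space_P)
  \<comment> \<open>Proportional to n, but small enough that 16 q \<le> n; the summand 1 in p
    compensates the rounding, so that n \<le> 16 p.\<close>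
  define q where "q = n div 16"
  define p where "p = 2 * q + 1"
  have "n = 16 * q + n mod 16" "n mod 16 < 16" by (simp_all add: q_def)
  then have p: "p = 2 * q + 1" "8 * (2 * q) \<le> n" and pn: "n \<le> 16 * p"
    unfolding p_def by simp_all
  have n1: "1 \<le> n" using n by simp
  have R0: "R > 0" using R by simp
  define c where "c = 2 * real n * R"
  have c0: "c > 0" unfolding c_def using n R by simp
  define \<tau> where "\<tau> = (c - n / 4) ^ p"
  define G where "G = {X \<in> space (P n). Psi n p X n < \<tau>}"
  have cn: "c - n / 4 = c * (1 - 1 / (8 * R))" unfolding c_def using R by (simp add: field_simps)
  have R8: "1 / (8 * R) \<le> 1 / 8" using R by (simp add: field_simps)
  have cn0: "c - n / 4 > 0" unfolding cn using c0 R8 by simp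
  then have \<tau>: "\<tau> > 0" unfolding \<tau>_def by simp
  have le: "(1 - 7 * real p / (16 * real n * R)) ^ n * (card I * (2 * real n * R) ^ p) / \<tau> \<le> card I * exp (- 3 * real n / (256 * R))"
    and b0: "0 \<le> (1 - 7 * real p / (16 * real n * R)) ^ n * (card I * (2 * real n * R) ^ p)"
  proof -
    have "7 * real p \<le> 16 * real n" using p n by simp
    also have "16 * real n * 1 \<le> 16 * real n * R" using R by (intro mult_left_mono) auto
    finally have q0: "0 \<le> 1 - 7 * real p / (16 * real n * R)" using n R by (simp add: field_simps)
    then show "0 \<le> (1 - 7 * real p / (16 * real n * R)) ^ n * (card I * (2 * real n * R) ^ p)" using R by simp
    have "(1 - 7 * real p / (16 * real n * R)) ^ n \<le> exp (- (7 * real p / (16 * real n * R))) ^ n"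
      using q0 exp_ge_add_one_self[of "- (7 * real p / (16 * real n * R))"] by (intro power_mono) auto
    also have "\<dots> = exp (n * (- (7 * real p / (16 * real n * R))))" by (rule exp_of_nat_mult[symmetric])
    also have "n * (- (7 * real p / (16 * real n * R))) = - (7 * real p / (16 * R))" using n R by simp
    finally have 1: "(1 - 7 * real p / (16 * real n * R)) ^ n \<le> exp (- (7 * real p / (16 * R)))" .
    define y where "y = 1 / (8 * R)"
    have y: "0 < y" "y \<le> 1 / 8" unfolding y_def using R R8 by auto
    \<comment> \<open>For 0 < y \<le> 1/2 one has (1 - y) (1 + 2 y) \<ge> 1, hence 1 - y \<ge> exp
      (-2 y).\<close>
    have "y * (2 * y) \<le> y * 1" using y by (intro mult_left_mono) auto
    then have "1 \<le> (1 - y) * (1 + 2 * y)" by (simp add: algebra_simps)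
    also have "\<dots> \<le> (1 - y) * exp (2 * y)" using y by (intro mult_left_mono exp_ge_add_one_self) auto
    finally have "exp (- (2 * y)) \<le> 1 - y" by (simp add: exp_minus field_simps)
    then have "exp (- (2 * y)) ^ p \<le> (1 - y) ^ p" by (intro power_mono) auto
    then have 2: "exp (- (p / (4 * R))) \<le> (1 - y) ^ p"
      by (simp add: exp_of_nat_mult[symmetric] y_def)
    have \<tau>2: "\<tau> = c ^ p * (1 - y) ^ p" unfolding \<tau>_def cn y_def by (rule power_mult_distrib)
    have "(1 - 7 * real p / (16 * real n * R)) ^ n * (card I * (2 * real n * R) ^ p) / \<tau>
        = card I * (1 - 7 * real p / (16 * real n * R)) ^ n / (1 - y) ^ p"
      unfolding \<tau>2 c_def[symmetric] using c0 by simp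
    also have "\<dots> \<le> card I * exp (- (7 * real p / (16 * R))) / exp (- (p / (4 * R)))"
      using 1 2 by (intro frac_le mult_left_mono) auto
    also have "\<dots> = card I * exp (- (3 * real p / (16 * R)))"
      unfolding times_divide_eq_right[symmetric] exp_diff[symmetric] by simp
    also have "\<dots> \<le> card I * exp (- 3 * real n / (256 * R))"
    proof (intro mult_left_mono exp_le_cancel_iff[THEN iffD2])
      have "n \<le> 16 * real p" using pn by linarith
      then show "- (3 * real p / (16 * R)) \<le> - 3 * real n / (256 * R)" using R by (simp add: field_simps)
    qed simp
    finally show "(1 - 7 * real p / (16 * real n * R)) ^ n * (card I * (2 * real n * R) ^ p) / \<tau> \<le> card I * exp (- 3 * real n / (256 * R))" .
  qed
  have meas: "(\<lambda>X. Psi n p X n) \<in> borel_measurable (P n)"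
    unfolding Psi_def by (rule measurable_trace[OF order_refl])
  have prob: "G \<in> sets (P n)" "measure (P n) G \<ge> 1 - card I * exp (- 3 * real n / (256 * R))"
    unfolding G_def using Pn.markov_good_set[OF meas \<tau> Psi_expectation[OF n1 order_refl R w1 p] le b0] by auto
  have "n / 4 * Re (dot I z z) \<le> (\<Sum>j<n. (cmod (dot I z (v (X j))))\<^sup>2)" if X: "X \<in> G" for X z
  proof (rule ccontr)
    let ?A = "frame_op I (2 * real n * R) (- 1) (\<lambda>j. v (X j)) n"
    have "X j \<in> space M" if "j < n" for j using X that unfolding G_def by (auto simp: space_PiM)
    then interpret A: pos_op I ?A "n * R" using n1 R0 bound by (intro pos_op_lower) auto
    define y where "y i = (if i \<in> I then z i else 0)" for i
    have yz: "dot I y u = dot I z u" "dot I u y = dot I u z" for u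
      unfolding y_def by (rule dot_restrict_support)+
    assume "\<not> n / 4 * Re (dot I z z) \<le> (\<Sum>j<n. (cmod (dot I z (v (X j))))\<^sup>2)"
    then have s: "(\<Sum>j<n. (cmod (dot I z (v (X j))))\<^sup>2) < n / 4 * mom I ?A y 0"
      by (simp add: mom_def yz)
    then have y0: "mom I ?A y 0 > 0"
      using sum_nonneg[of "{..<n}" "\<lambda>j. (cmod (dot I z (v (X j))))\<^sup>2"] n1
      by (smt (verit) mult_nonneg_nonpos divide_nonneg_nonneg of_nat_0_le_iff zero_le_power2)
    have "(c - n / 4) * mom I ?A y 0 \<le> mom I ?A y 1"
      using s by (simp add: mom_def frame_op_form) (simp add: yz c_def algebra_simps)
    then have "(c - n / 4) ^ p * mom I ?A y 0 \<le> mom I ?A y p"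
      using cn0 by (intro A.mom_growth(2)) auto
    moreover have "mom I ?A y p - 0 * mom I ?A y 0 \<le> (trace_pow I ?A p - 0 * real (card I)) * mom I ?A y 0"
      using A.mom_nonneg by (intro A.mom_le_trace_pow) (auto simp: y_def)
    moreover have "Psi n p X n * mom I ?A y 0 < \<tau> * mom I ?A y 0"
      using X y0 unfolding G_def by simp
    ultimately show False unfolding \<tau>_def Psi_def by simp
  qed
  with prob that show ?thesis by blast
qed

end

section \<open>Reproducing kernel Hilbert spaces on a compact domain\<close>

locale continuous_rkhs = rkhs D K H ip
  for D :: "'a::{metric_space, second_countable_topology} set" and K H ip +
  fixes \<rho> :: "'a measure" and lam :: "nat \<Rightarrow> real" and e :: "nat \<Rightarrow> 'a \<Rightarrow> complex" and B :: real
  assumes K_cont: "continuous_on (D \<times> D) (\<lambda>(x, y). K x y)"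
    and K_bound: "x \<in> D \<Longrightarrow> Re (K x x) \<le> B"
    and full_support: "finite_borel_full_support D \<rho>"
    and spectral: "spectral_system \<rho> H ip lam e"
begin

lemma psd_ip: "psd_form H ip"
proof unfold_locales
  fix f assume f: "f \<in> H"
  have "ip 0 0 = 0"
    using ip_scale[of 0 0 0] cfun.subspace_0[OF subspace] by (simp add: cscale_def zero_fun_def)
  then show "0 \<le> Re (ip f f)" using ip_pos[OF f] by (cases "f = 0") (auto intro: less_imp_le)
qed (blast intro: subspace ip_add ip_scale ip_cnj)+

sublocale form: psd_form H ip by (rule psd_ip)

lemma hnorm_nonneg: "f \<in> H \<Longrightarrow> 0 \<le> hnorm ip f"
  by (simp add: hnorm_def form.nonneg)

lemma hnorm_sq: "f \<in> H \<Longrightarrow> (hnorm ip f)\<^sup>2 = Re (ip f f)"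
  by (simp add: hnorm_def form.nonneg)

lemma ip_le_hnorm: "f \<in> H \<Longrightarrow> g \<in> H \<Longrightarrow> cmod (ip f g) \<le> hnorm ip f * hnorm ip g"
  using form.cauchy_schwarz[of f g] by (simp add: hnorm_def real_sqrt_mult[symmetric] real_le_rsqrt)

lemma hnorm_minus_commute: "f \<in> H \<Longrightarrow> g \<in> H \<Longrightarrow> hnorm ip (f - g) = hnorm ip (g - f)"
  by (simp add: hnorm_def form.self_diff form.Re_sym[of f g])

lemma ksection_ip: "x \<in> D \<Longrightarrow> y \<in> D \<Longrightarrow> ip (ksection D K y) (ksection D K x) = K x y"
  using reproducing[OF ksection_mem, of y x] by (simp add: ksection_def)

lemma eval_bound: "f \<in> H \<Longrightarrow> x \<in> D \<Longrightarrow> (cmod (f x))\<^sup>2 \<le> Re (ip f f) * Re (K x x)"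
  using form.cauchy_schwarz[of f "ksection D K x"] ksection_mem[of x] reproducing[of f x] ksection_ip[of x x]
  by simp

lemma eval_bound_hnorm: "f \<in> H \<Longrightarrow> x \<in> D \<Longrightarrow> cmod (f x) \<le> hnorm ip f * sqrt B"
proof -
  assume f: "f \<in> H" and x: "x \<in> D"
  have "(cmod (f x))\<^sup>2 \<le> Re (ip f f) * B"
    using eval_bound[OF f x] mult_left_mono[OF K_bound[OF x] form.nonneg[OF f]] by linarith
  then show ?thesis by (simp add: hnorm_def real_sqrt_mult[symmetric] real_le_rsqrt)
qed

text \<open>The squared distance in H of the kernel sections at x and y. It controls the oscillation
  of the whole unit ball at once.\<close>

definition kdist :: "'a \<Rightarrow> 'a \<Rightarrow> real" where
  "kdist x y = Re (K x x) - 2 * Re (K x y) + Re (K y y)"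

lemma eval_diff_bound:
  assumes f: "f \<in> H" and x: "x \<in> D" and y: "y \<in> D"
  shows "(cmod (f x - f y))\<^sup>2 \<le> Re (ip f f) * kdist x y" "0 \<le> kdist x y"
proof -
  let ?k = "ksection D K x - ksection D K y"
  have k: "?k \<in> H" using ksection_mem x y form.diff_mem by blast
  have "Re (ip ?k ?k) = kdist x y"
    using x y by (simp add: form.self_diff ksection_mem ksection_ip kdist_def)
      (metis form.Re_sym ksection_ip ksection_mem)
  moreover have "ip f ?k = f x - f y"
    using f x y by (simp add: form.diff_right ksection_mem reproducing[symmetric])
  ultimately show "(cmod (f x - f y))\<^sup>2 \<le> Re (ip f f) * kdist x y" "0 \<le> kdist x y"
    using form.cauchy_schwarz[OF f k] form.nonneg[OF k] by simp_all
qed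

lemma kdist_tendsto:
  assumes x: "x \<in> D"
  shows "((\<lambda>y. kdist y x) \<longlongrightarrow> 0) (at x within D)"
proof -
  have K2: "((\<lambda>y. K (g y) (h y)) \<longlongrightarrow> K x x) (at x within D)"
    if "continuous_on D g" "continuous_on D h" "g ` D \<subseteq> D" "h ` D \<subseteq> D" "g x = x" "h x = x" for g h
  proof -
    have "continuous_on D (\<lambda>y. (\<lambda>(x, y). K x y) (g y, h y))"
      using that by (intro continuous_on_compose2[OF K_cont] continuous_on_Pair) auto
    then show ?thesis using x that by (force simp: continuous_on_def)
  qed
  have "((\<lambda>y. kdist y x) \<longlongrightarrow> Re (K x x) - 2 * Re (K x x) + Re (K x x)) (at x within D)"
    unfolding kdist_def using x
    by (intro tendsto_intros K2[of "\<lambda>y. y" "\<lambda>y. y"] K2[of "\<lambda>y. y" "\<lambda>_. x"]) (auto intro: continuous_intros)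
  then show ?thesis by simp
qed

lemma H_continuous:
  assumes f: "f \<in> H" shows "continuous_on D f"
  unfolding continuous_on_def
proof
  fix x assume x: "x \<in> D"
  have "((\<lambda>y. sqrt (Re (ip f f) * kdist y x)) \<longlongrightarrow> sqrt (Re (ip f f) * 0)) (at x within D)"
    by (intro tendsto_intros kdist_tendsto x)
  then have lim: "((\<lambda>y. sqrt (Re (ip f f) * kdist y x)) \<longlongrightarrow> 0) (at x within D)" by simp
  have "\<forall>\<^sub>F y in at x within D. norm (f y - f x) \<le> sqrt (Re (ip f f) * kdist y x)"
    unfolding eventually_at_filter
    using eval_diff_bound(1)[OF f _ x] by (auto intro!: always_eventually real_le_rsqrt)
  then have "((\<lambda>y. f y - f x) \<longlongrightarrow> 0) (at x within D)"
    by (rule Lim_null_comparison[OF _ lim])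
  then show "(f \<longlongrightarrow> f x) (at x within D)" by (rule Lim_null[THEN iffD2])
qed

lemma rho_sets: "sets \<rho> = sets (restrict_space borel D)"
  using full_support by (simp add: finite_borel_full_support_def)

lemma rho_space: "space \<rho> = D"
  using sets_eq_imp_space_eq[OF rho_sets] by (simp add: space_restrict_space)

lemma rho_finite: "finite_measure \<rho>"
  using full_support by (simp add: finite_borel_full_support_def)

lemma continuous_measurable: "continuous_on D f \<Longrightarrow> f \<in> borel_measurable \<rho>"
  for f :: "'a \<Rightarrow> 'c::topological_space"
  using borel_measurable_continuous_on_restrict measurable_cong_sets[OF rho_sets refl] by blast

lemma H_measurable: "f \<in> H \<Longrightarrow> f \<in> borel_measurable \<rho>"
  by (intro continuous_measurable H_continuous)

lemma integrable_bounded: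
  fixes f :: "'a \<Rightarrow> 'c::{banach, second_countable_topology}"
  assumes "f \<in> borel_measurable \<rho>" "\<And>x. x \<in> D \<Longrightarrow> norm (f x) \<le> C"
  shows "integrable \<rho> f"
  using assms by (intro finite_measure.integrable_const_bound[OF rho_finite, where B = C] AE_I2) (auto simp: rho_space)

lemma H_integrable: "f \<in> H \<Longrightarrow> g \<in> H \<Longrightarrow> integrable \<rho> (\<lambda>x. f x * cnj (g x))"
proof (rule integrable_bounded)
  assume f: "f \<in> H" and g: "g \<in> H"
  show "(\<lambda>x. f x * cnj (g x)) \<in> borel_measurable \<rho>"
    using f g by (intro continuous_measurable continuous_intros H_continuous)
  show "norm (f x * cnj (g x)) \<le> (hnorm ip f * sqrt B) * (hnorm ip g * sqrt B)" if "x \<in> D" for x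
    unfolding norm_mult complex_mod_cnj using eval_bound_hnorm[OF f that] eval_bound_hnorm[OF g that]
    by (intro mult_mono) (auto intro: order_trans[OF norm_ge_zero])
qed

section \<open>The L_2 form on H(K)\<close>

abbreviation "l2 \<equiv> l2_inner \<rho>"

lemma l2_self: "f \<in> H \<Longrightarrow> Re (l2 f f) = (\<integral>x. (cmod (f x))\<^sup>2 \<partial>\<rho>)"
  unfolding l2_inner_def using integral_Re[OF H_integrable[of f f]]
  by (simp add: complex_norm_square[symmetric] del: of_real_power)

lemma H_integrable_sq: "f \<in> H \<Longrightarrow> integrable \<rho> (\<lambda>x. (cmod (f x))\<^sup>2)"
  using integrable_norm[OF H_integrable[of f f]] by (simp add: norm_mult power2_eq_square)

lemma psd_l2: "psd_form H l2"
proof unfold_locales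
  show "cfun.subspace H" by (rule subspace)
  fix f g h c assume f: "f \<in> H" and g: "g \<in> H"
  show "l2 (cscale c f) g = c * l2 f g"
    unfolding l2_inner_def cscale_def by (simp add: mult.assoc)
  show "l2 g f = cnj (l2 f g)"
    unfolding l2_inner_def Bochner_Integration.integral_cnj[symmetric] by (simp add: mult.commute)
  show "0 \<le> Re (l2 f f)" using l2_self[OF f] by simp
  assume h: "h \<in> H"
  show "l2 (f + g) h = l2 f h + l2 g h"
    unfolding l2_inner_def plus_fun_apply distrib_right
    using f g h by (intro Bochner_Integration.integral_add H_integrable)
qed

sublocale l2: psd_form H l2 by (rule psd_l2)

lemma l2_le_hnorm: "f \<in> H \<Longrightarrow> Re (l2 f f) \<le> B * measure \<rho> D * Re (ip f f)"
proof -
  assume f: "f \<in> H"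
  interpret finite_measure \<rho> by (rule rho_finite)
  have "(\<integral>x. (cmod (f x))\<^sup>2 \<partial>\<rho>) \<le> (\<integral>x. Re (ip f f) * B \<partial>\<rho>)"
  proof (rule integral_mono[OF H_integrable_sq[OF f]])
    fix x assume "x \<in> space \<rho>"
    then have x: "x \<in> D" by (simp add: rho_space)
    show "(cmod (f x))\<^sup>2 \<le> Re (ip f f) * B"
      using eval_bound[OF f x] mult_left_mono[OF K_bound[OF x] form.nonneg[OF f]] by linarith
  qed simp
  then show ?thesis using l2_self[OF f] by (simp add: rho_space mult_ac)
qed

text \<open>A nonzero f in H is continuous, so it is nonzero on a relatively open set, which has
  positive measure by full support. The embedding is thus injective.\<close>

lemma l2_zero_imp:
  assumes f: "f \<in> H" and z: "Re (l2 f f) = 0" shows "f = 0"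
proof (rule ccontr)
  assume "f \<noteq> 0"
  then obtain x0 where x0: "f x0 \<noteq> 0" by (auto simp: fun_eq_iff)
  then have "x0 \<in> D" using zero_outside[OF f] by blast
  obtain U where U: "open U" "U \<inter> D = f -` (- {0}) \<inter> D"
    using H_continuous[OF f] by (metis continuous_on_open_invariant open_Compl closed_singleton)
  have "emeasure \<rho> (U \<inter> D) > 0"
  proof -
    have "U \<inter> D \<noteq> {}" using U x0 \<open>x0 \<in> D\<close> by auto
    then show ?thesis using full_support U(1) by (simp add: finite_borel_full_support_def)
  qed
  moreover have "AE x in \<rho>. (cmod (f x))\<^sup>2 = 0"
    using integral_nonneg_eq_0_iff_AE[OF H_integrable_sq[OF f]] z l2_self[OF f] by simp
  then have "AE x in \<rho>. x \<notin> U \<inter> D"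
  proof (rule AE_mp, intro AE_I2 impI)
    fix x assume "(cmod (f x))\<^sup>2 = 0"
    then show "x \<notin> U \<inter> D" unfolding U by simp
  qed
  moreover have "U \<inter> D \<in> sets \<rho>"
    unfolding rho_sets using U(1) by (auto simp: sets_restrict_space Int_commute intro!: image_eqI[of _ _ U])
  ultimately show False
    using AE_iff_null_sets[of "U \<inter> D" \<rho>] by (metis null_setsD1 less_irrefl)
qed

section \<open>Eigenfunctions and convergence in H(K)\<close>

lemma lam_pos: "k \<ge> 1 \<Longrightarrow> 0 < lam k"
  using spectral by (simp add: spectral_system_def)
lemma lam_antimono: "1 \<le> j \<Longrightarrow> j \<le> k \<Longrightarrow> lam k \<le> lam j"
proof (induction k)
  case (Suc k)
  show ?case
  proof (cases "j = Suc k")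
    case False
    then have "lam k \<le> lam j" "1 \<le> k" using Suc by auto
    then show ?thesis using spectral unfolding spectral_system_def by (meson order_trans)
  qed simp
qed simp
lemma e_mem: "k \<ge> 1 \<Longrightarrow> e k \<in> H"
  using spectral by (simp add: spectral_system_def is_eigenpair_def)
lemma e_ortho: "j \<ge> 1 \<Longrightarrow> k \<ge> 1 \<Longrightarrow> ip (e j) (e k) = (if j = k then 1 else 0)"
  using spectral by (simp add: spectral_system_def)
text \<open>Both inner products are therefore diagonal on the e_k.\<close>

lemma e_eigen: "k \<ge> 1 \<Longrightarrow> h \<in> H \<Longrightarrow> l2 (e k) h = lam k * ip (e k) h"
  using spectral e_mem[of k] unfolding spectral_system_def is_eigenpair_def is_adjoint_image_def
  by (metis ip_scale)
lemma e_l2: "j \<ge> 1 \<Longrightarrow> k \<ge> 1 \<Longrightarrow> l2 (e j) (e k) = (if j = k then lam k else 0)"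
  by (simp add: e_eigen e_mem e_ortho)

definition hlim :: "(nat \<Rightarrow> 'a \<Rightarrow> complex) \<Rightarrow> ('a \<Rightarrow> complex) \<Rightarrow> bool" where
  "hlim F g \<longleftrightarrow> (\<forall>n. F n \<in> H) \<and> g \<in> H \<and> (\<lambda>n. hnorm ip (F n - g)) \<longlonglongrightarrow> 0"

lemma hlim_ip: "hlim F g \<Longrightarrow> h \<in> H \<Longrightarrow> (\<lambda>n. ip (F n) h) \<longlonglongrightarrow> ip g h"
proof -
  assume F: "hlim F g" and h: "h \<in> H"
  then have lim: "(\<lambda>n. hnorm ip (F n - g) * hnorm ip h) \<longlonglongrightarrow> 0"
    unfolding hlim_def by (auto intro: tendsto_mult_left_zero)
  have "(\<lambda>n. ip (F n) h - ip g h) \<longlonglongrightarrow> 0"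
    by (rule Lim_null_comparison[OF _ lim])
      (use F h in \<open>auto simp: hlim_def form.diff[symmetric] form.diff_mem ip_le_hnorm\<close>)
  then show ?thesis by (rule Lim_null[THEN iffD2])
qed

lemma hlim_ip_right: "hlim F g \<Longrightarrow> h \<in> H \<Longrightarrow> (\<lambda>n. ip h (F n)) \<longlonglongrightarrow> ip h g"
proof -
  assume F: "hlim F g" and h: "h \<in> H"
  have "(\<lambda>n. cnj (ip (F n) h)) \<longlonglongrightarrow> cnj (ip g h)" by (intro tendsto_cnj hlim_ip F h)
  moreover have "cnj (ip (F n) h) = ip h (F n)" for n using ip_cnj[of "F n" h] F h by (simp add: hlim_def)
  moreover have "cnj (ip g h) = ip h g" using ip_cnj[of g h] F h by (simp add: hlim_def)
  ultimately show ?thesis by simp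
qed

lemma hlim_eval: "hlim F g \<Longrightarrow> x \<in> D \<Longrightarrow> (\<lambda>n. F n x) \<longlonglongrightarrow> g x"
  using hlim_ip[of F g "ksection D K x"] ksection_mem[of x] reproducing[of _ x]
  by (simp add: hlim_def)

lemma hlim_norm: 
  assumes F: "hlim F g" shows "(\<lambda>n. Re (ip (F n) (F n))) \<longlonglongrightarrow> Re (ip g g)"
proof -
  have "Re (ip (F n) (F n)) = (hnorm ip (F n - g))\<^sup>2 + 2 * Re (ip (F n) g) - Re (ip g g)" for n
    using F by (simp add: hlim_def hnorm_sq form.self_diff form.diff_mem)
  moreover have "(\<lambda>n. (hnorm ip (F n - g))\<^sup>2 + 2 * Re (ip (F n) g) - Re (ip g g)) \<longlonglongrightarrow> 0\<^sup>2 + 2 * Re (ip g g) - Re (ip g g)"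
    using F by (intro tendsto_intros hlim_ip) (auto simp: hlim_def)
  ultimately show ?thesis by simp
qed

lemma hlim_l2_norm_diff:
  assumes F: "hlim F g" shows "(\<lambda>n. Re (l2 (F n - g) (F n - g))) \<longlonglongrightarrow> 0"
proof -
  have "(\<lambda>n. B * measure \<rho> D * (hnorm ip (F n - g))\<^sup>2) \<longlonglongrightarrow> B * measure \<rho> D * 0\<^sup>2"
    using F by (intro tendsto_intros) (auto simp: hlim_def)
  then have lim: "(\<lambda>n. B * measure \<rho> D * (hnorm ip (F n - g))\<^sup>2) \<longlonglongrightarrow> 0" by simp
  show ?thesis
    by (rule Lim_null_comparison[OF _ lim])
      (use F in \<open>auto simp: hlim_def hnorm_sq form.diff_mem l2.nonneg l2_le_hnorm\<close>)
qed

lemma hlim_l2_right: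
  assumes F: "hlim F g" and h: "h \<in> H"
  shows "(\<lambda>n. l2 h (F n)) \<longlonglongrightarrow> l2 h g"
proof -
  have "(\<lambda>n. sqrt (Re (l2 h h) * Re (l2 (F n - g) (F n - g)))) \<longlonglongrightarrow> sqrt (Re (l2 h h) * 0)"
    by (intro tendsto_intros hlim_l2_norm_diff F)
  then have lim: "(\<lambda>n. sqrt (Re (l2 h h) * Re (l2 (F n - g) (F n - g)))) \<longlonglongrightarrow> 0" by simp
  have "(\<lambda>n. l2 h (F n) - l2 h g) \<longlonglongrightarrow> 0"
  proof (rule Lim_null_comparison[OF _ lim], intro always_eventually allI)
    fix n
    have "l2 h (F n) - l2 h g = l2 h (F n - g)" using F h by (simp add: hlim_def l2.diff_right)
    then show "norm (l2 h (F n) - l2 h g) \<le> sqrt (Re (l2 h h) * Re (l2 (F n - g) (F n - g)))"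
      using l2.cauchy_schwarz[OF h, of "F n - g"] F by (simp add: hlim_def form.diff_mem real_le_rsqrt)
  qed
  then show ?thesis by (rule Lim_null[THEN iffD2])
qed

lemma hlim_l2_norm:
  assumes F: "hlim F g" shows "(\<lambda>n. Re (l2 (F n) (F n))) \<longlonglongrightarrow> Re (l2 g g)"
proof -
  have "Re (l2 (F n) (F n)) = Re (l2 (F n - g) (F n - g)) + 2 * Re (l2 g (F n)) - Re (l2 g g)" for n
    using F l2.Re_sym[of "F n" g] by (simp add: hlim_def l2.self_diff)
  moreover have "(\<lambda>n. Re (l2 (F n - g) (F n - g)) + 2 * Re (l2 g (F n)) - Re (l2 g g)) \<longlonglongrightarrow> 0 + 2 * Re (l2 g g) - Re (l2 g g)"
    using F by (intro tendsto_intros hlim_l2_right hlim_l2_norm_diff) (auto simp: hlim_def)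
  ultimately show ?thesis by simp
qed

text \<open>With N = m - 1 this is the projection onto the span of the basis used by the least
  squares method.\<close>

definition partial :: "('a \<Rightarrow> complex) \<Rightarrow> nat \<Rightarrow> 'a \<Rightarrow> complex" where
  "partial f N = (\<Sum>k\<in>{1..N}. cscale (ip f (e k)) (e k))"

lemma partial_mem: "partial f N \<in> H"
  unfolding partial_def by (intro form.sum_mem form.scale_mem e_mem) auto

lemma partial_apply: "partial f N x = (\<Sum>k\<in>{1..N}. ip f (e k) * e k x)"
  by (simp add: partial_def sum_fun_apply cscale_def)

lemma ip_partial_left: "g \<in> H \<Longrightarrow> ip (partial f N) g = (\<Sum>k\<in>{1..N}. ip f (e k) * ip (e k) g)"
  unfolding partial_def by (subst form.sum_left) (auto simp: form.scale_mem e_mem ip_scale)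

lemma ip_partial_e: "f \<in> H \<Longrightarrow> 1 \<le> j \<Longrightarrow> ip (partial f N) (e j) = (if j \<le> N then ip f (e j) else 0)"
proof -
  assume f: "f \<in> H" and j: "1 \<le> j"
  have "ip (partial f N) (e j) = (\<Sum>k\<in>{1..N}. if k = j then ip f (e j) else 0)"
    unfolding ip_partial_left[OF e_mem[OF j]] using j by (intro sum.cong refl) (simp add: e_ortho)
  then show ?thesis using j by simp
qed

lemma ip_partial_right: "g \<in> H \<Longrightarrow> ip g (partial f N) = (\<Sum>k\<in>{1..N}. cnj (ip f (e k)) * ip g (e k))"
  unfolding partial_def by (subst form.sum_right) (auto simp: form.scale_mem e_mem form.scale_right)

lemma ip_self_partial: "f \<in> H \<Longrightarrow> ip f (partial f N) = of_real (\<Sum>k\<in>{1..N}. (cmod (ip f (e k)))\<^sup>2)"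
  by (simp add: ip_partial_right complex_norm_square mult.commute del: of_real_power)

lemma ip_partial_partial:
  "f \<in> H \<Longrightarrow> M \<le> N \<Longrightarrow> ip (partial f N) (partial f M) = of_real (\<Sum>k\<in>{1..M}. (cmod (ip f (e k)))\<^sup>2)"
  unfolding ip_partial_right[OF partial_mem] ip_self_partial[symmetric] ip_partial_right
  by (intro sum.cong refl) (auto simp: ip_partial_e)

lemma bessel: "f \<in> H \<Longrightarrow> (\<Sum>k\<in>{1..N}. (cmod (ip f (e k)))\<^sup>2) \<le> Re (ip f f)"
  using form.nonneg[OF form.diff_mem[OF _ partial_mem, of f f N]]
  by (simp add: form.self_diff partial_mem ip_self_partial ip_partial_partial)

text \<open>Bessel's inequality makes the partial sums Cauchy. The limit is only the projection onto
  the closed span of the e_k; that it equals f is completeness, which is shown later.\<close>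

lemma partial_converges:
  assumes f: "f \<in> H"
  obtains g where "hlim (partial f) g" "\<And>k. k \<ge> 1 \<Longrightarrow> ip (f - g) (e k) = 0"
proof -
  define S where "S N = (\<Sum>k\<in>{1..N}. (cmod (ip f (e k)))\<^sup>2)" for N
  have "incseq S" unfolding S_def incseq_def by (intro allI impI sum_mono2) auto
  moreover have "S N \<le> Re (ip f f)" for N unfolding S_def by (rule bessel[OF f])
  ultimately obtain L where "S \<longlonglongrightarrow> L" using incseq_convergent by blast
  then have SC: "Cauchy S" by (simp add: LIMSEQ_imp_Cauchy)
  \<comment> \<open>Pythagoras: distances of partial sums are read off from the scalar sequence
    S.\<close>
  have d: "hnorm ip (partial f i - partial f j) = sqrt \<bar>S i - S j\<bar>" for i j
  proof -
    have *: "hnorm ip (partial f i - partial f j) = sqrt (S i - S j)" if "j \<le> i" for i j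
      using that by (simp add: hnorm_def form.self_diff partial_mem ip_partial_partial f S_def)
    have mono: "S j \<le> S i" if "j \<le> i" for i j using \<open>incseq S\<close> that by (simp add: incseq_def)
    show ?thesis
    proof (cases "j \<le> i")
      case True
      then show ?thesis using *[of j i] mono[of j i] by simp
    next
      case False
      then show ?thesis using *[of i j] mono[of i j] hnorm_minus_commute[OF partial_mem partial_mem, of f i f j] by simp
    qed
  qed
  have "\<exists>g\<in>H. (\<lambda>n::nat. hnorm ip (partial f n - g)) \<longlonglongrightarrow> 0"
  proof (rule complete[OF partial_mem])
    fix \<epsilon> :: real assume "\<epsilon> > 0"
    then obtain N where N: "\<forall>i\<ge>N. \<forall>j\<ge>N. \<bar>S i - S j\<bar> < \<epsilon>\<^sup>2"
      using SC[unfolded Cauchy_def, rule_format, of "\<epsilon>\<^sup>2"] by (auto simp: dist_real_def)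
    then have "sqrt \<bar>S i - S j\<bar> < \<epsilon>" if "i \<ge> N" "j \<ge> N" for i j
      using that \<open>\<epsilon> > 0\<close> real_sqrt_less_mono[of "\<bar>S i - S j\<bar>" "\<epsilon>\<^sup>2"] by simp
    then show "\<exists>N. \<forall>i\<ge>N. \<forall>j\<ge>N. hnorm ip (partial f i - partial f j) < \<epsilon>" unfolding d by blast
  qed
  then obtain g where g: "hlim (partial f) g" unfolding hlim_def using partial_mem by blast
  have "ip (f - g) (e k) = 0" if k: "k \<ge> 1" for k
  proof -
    have "\<forall>\<^sub>F N in sequentially. ip (partial f N) (e k) = ip f (e k)"
      using eventually_ge_at_top[of k] by eventually_elim (use ip_partial_e[OF f k] in simp)
    then have "(\<lambda>N. ip (partial f N) (e k)) \<longlonglongrightarrow> ip f (e k)" by (rule tendsto_eventually)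
    with hlim_ip[OF g e_mem[OF k]] have "ip g (e k) = ip f (e k)" by (rule LIMSEQ_unique)
    then show ?thesis using g f k by (simp add: form.diff hlim_def e_mem)
  qed
  with g that show ?thesis by blast
qed

section \<open>Compactness of the embedding\<close>

text \<open>A diagonal subsequence converges on a countable dense set. The common modulus of
  continuity given by \<open>kdist\<close> carries this over to every point of D, and dominated
  convergence, with the uniform bound on the unit ball, turns it into convergence in L_2.\<close>

lemma l2_compact:
  assumes F: "\<And>n. F n \<in> H" "\<And>n. Re (ip (F n) (F n)) \<le> 1"
  obtains r :: "nat \<Rightarrow> nat" where "strict_mono r"
    "\<And>\<epsilon>. \<epsilon> > 0 \<Longrightarrow> \<exists>N. \<forall>i\<ge>N. \<forall>j\<ge>N. Re (l2 (F (r i) - F (r j)) (F (r i) - F (r j))) < \<epsilon>"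
proof -
  interpret finite_measure \<rho> by (rule rho_finite)
  have hn: "hnorm ip (F n) \<le> 1" for n using F(2)[of n] by (simp add: hnorm_def)
  have Bs: "cmod (F n x) \<le> sqrt \<bar>B\<bar>" if "x \<in> D" for n x
  proof -
    have "cmod (F n x) \<le> hnorm ip (F n) * sqrt B" by (rule eval_bound_hnorm[OF F(1) that])
    also have "\<dots> \<le> hnorm ip (F n) * sqrt \<bar>B\<bar>" using hnorm_nonneg[OF F(1)] by (intro mult_left_mono) auto
    also have "\<dots> \<le> 1 * sqrt \<bar>B\<bar>" using hn by (intro mult_right_mono) auto
    finally show ?thesis by simp
  qed
  obtain T where T: "countable T" "T \<subseteq> D" "D \<subseteq> closure T" by (rule separable)
  obtain r where r: "strict_mono (r :: nat \<Rightarrow> nat)" and rT: "\<And>x. x \<in> T \<Longrightarrow> \<exists>l. (\<lambda>n. F (r n) x) \<longlonglongrightarrow> l"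
    using function_convergent_subsequence[of T F "sqrt \<bar>B\<bar>"] T Bs by (metis subsetD)
  have "Cauchy (\<lambda>n. F (r n) x)" if x: "x \<in> D" for x
  proof (rule metric_CauchyI)
    fix \<epsilon> :: real assume \<epsilon>: "\<epsilon> > 0"
    have "\<forall>\<^sub>F y in at x within D. kdist y x < (\<epsilon> / 3)\<^sup>2"
      using order_tendstoD(2)[OF kdist_tendsto[OF x]] \<epsilon> by simp
    then obtain \<delta> where \<delta>: "\<delta> > 0" "\<And>y. y \<in> D \<Longrightarrow> y \<noteq> x \<Longrightarrow> dist y x < \<delta> \<Longrightarrow> kdist y x < (\<epsilon> / 3)\<^sup>2"
      unfolding eventually_at by auto
    obtain y where y: "y \<in> T" "dist y x < \<delta>"
      using T x \<delta>(1) by (meson closure_approachable subsetD)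
    have "kdist y x < (\<epsilon> / 3)\<^sup>2" using \<delta>(2)[of y] y T \<epsilon> by (cases "y = x") (auto simp: kdist_def)
    have near: "cmod (F n y - F n x) < \<epsilon> / 3" for n
    proof -
      have "(cmod (F n y - F n x))\<^sup>2 \<le> Re (ip (F n) (F n)) * kdist y x"
        using eval_diff_bound(1)[OF F(1) _ x] y T by blast
      also have "\<dots> \<le> 1 * kdist y x"
        using F(2) eval_diff_bound(2)[OF F(1) _ x] y T by (intro mult_right_mono) auto
      also have "\<dots> < (\<epsilon> / 3)\<^sup>2" using \<open>kdist y x < (\<epsilon> / 3)\<^sup>2\<close> by simp
      finally have "(cmod (F n y - F n x))\<^sup>2 < (\<epsilon> / 3)\<^sup>2" .
      then show ?thesis by (rule power_less_imp_less_base) (use \<epsilon> in simp)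
    qed
    have "Cauchy (\<lambda>n. F (r n) y)" using rT[OF y(1)] by (auto intro: LIMSEQ_imp_Cauchy)
    then obtain N where N: "\<forall>m\<ge>N. \<forall>n\<ge>N. dist (F (r m) y) (F (r n) y) < \<epsilon> / 3"
      using \<epsilon> unfolding Cauchy_def by (meson divide_pos_pos zero_less_numeral)
    have "dist (F (r m) x) (F (r n) x) < \<epsilon>" if "m \<ge> N" "n \<ge> N" for m n
    proof -
      have "dist (F (r m) x) (F (r n) x) \<le> dist (F (r m) x) (F (r m) y) + dist (F (r m) y) (F (r n) y) + dist (F (r n) y) (F (r n) x)"
        by (meson add_mono dist_triangle order_refl order_trans)
      moreover have "dist (F (r m) x) (F (r m) y) < \<epsilon> / 3" using near[of "r m"] by (simp add: dist_norm norm_minus_commute)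
      moreover have "dist (F (r n) y) (F (r n) x) < \<epsilon> / 3" using near[of "r n"] by (simp add: dist_norm)
      moreover have "dist (F (r m) y) (F (r n) y) < \<epsilon> / 3" using N that by blast
      ultimately show ?thesis by linarith
    qed
    then show "\<exists>M. \<forall>m\<ge>M. \<forall>n\<ge>M. dist (F (r m) x) (F (r n) x) < \<epsilon>" by blast
  qed
  then have "\<forall>x\<in>D. \<exists>l. (\<lambda>n. F (r n) x) \<longlonglongrightarrow> l"
    by (simp add: Cauchy_convergent_iff convergent_def)
  then obtain \<phi> where \<phi>: "\<And>x. x \<in> D \<Longrightarrow> (\<lambda>n. F (r n) x) \<longlonglongrightarrow> \<phi> x" by metis
  have \<phi>m[measurable]: "\<phi> \<in> borel_measurable \<rho>"
  proof (rule borel_measurable_LIMSEQ_metric[of "\<lambda>n. F (r n)"])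
    show "F (r n) \<in> borel_measurable \<rho>" for n by (rule H_measurable[OF F(1)])
    show "(\<lambda>n. F (r n) x) \<longlonglongrightarrow> \<phi> x" if "x \<in> space \<rho>" for x using \<phi> that by (simp add: rho_space)
  qed
  have Fm[measurable]: "F n \<in> borel_measurable \<rho>" for n by (rule H_measurable[OF F(1)])
  have \<phi>b: "cmod (\<phi> x) \<le> sqrt \<bar>B\<bar>" if "x \<in> D" for x
    using tendsto_norm[OF \<phi>[OF that]] Bs[OF that] by (intro LIMSEQ_le_const2) auto
  have db: "(cmod (F n x - \<phi> x))\<^sup>2 \<le> (2 * sqrt \<bar>B\<bar>)\<^sup>2" if "x \<in> D" for n x
  proof (rule power_mono)
    show "cmod (F n x - \<phi> x) \<le> 2 * sqrt \<bar>B\<bar>"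
      using norm_triangle_ineq4[of "F n x" "\<phi> x"] Bs[OF that, of n] \<phi>b[OF that] by linarith
  qed simp
  define \<delta> where "\<delta> i = (\<integral>x. (cmod (F (r i) x - \<phi> x))\<^sup>2 \<partial>\<rho>)" for i
  have \<delta>int: "integrable \<rho> (\<lambda>x. (cmod (F n x - \<phi> x))\<^sup>2)" for n
    using db by (intro integrable_bounded[where C = "(2 * sqrt \<bar>B\<bar>)\<^sup>2"]) auto
  have "(\<lambda>i. \<integral>x. (cmod (F (r i) x - \<phi> x))\<^sup>2 \<partial>\<rho>) \<longlonglongrightarrow> (\<integral>x. 0 \<partial>\<rho>)"
  proof (rule integral_dominated_convergence[where w = "\<lambda>_. (2 * sqrt \<bar>B\<bar>)\<^sup>2"])
    show "AE x in \<rho>. (\<lambda>i. (cmod (F (r i) x - \<phi> x))\<^sup>2) \<longlonglongrightarrow> 0"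
    proof (rule AE_I2)
      fix x assume "x \<in> space \<rho>"
      then have "(\<lambda>i. (cmod (F (r i) x - \<phi> x))\<^sup>2) \<longlonglongrightarrow> (cmod (\<phi> x - \<phi> x))\<^sup>2"
        by (intro tendsto_intros \<phi>) (simp add: rho_space)
      then show "(\<lambda>i. (cmod (F (r i) x - \<phi> x))\<^sup>2) \<longlonglongrightarrow> 0" by simp
    qed
    show "AE x in \<rho>. norm ((cmod (F (r i) x - \<phi> x))\<^sup>2) \<le> (2 * sqrt \<bar>B\<bar>)\<^sup>2" for i
    proof (rule AE_I2)
      fix x assume "x \<in> space \<rho>"
      then show "norm ((cmod (F (r i) x - \<phi> x))\<^sup>2) \<le> (2 * sqrt \<bar>B\<bar>)\<^sup>2"
        using db[of x "r i"] by (simp add: rho_space)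
    qed
  qed (auto intro: borel_measurable_power)
  then have \<delta>0: "\<delta> \<longlonglongrightarrow> 0" unfolding \<delta>_def by simp
  \<comment> \<open>The pointwise limit \<phi> need not lie in H, so both functions are compared
    with it by integrals instead of \<open>l2\<close>.\<close>
  have q: "Re (l2 (F (r i) - F (r j)) (F (r i) - F (r j))) \<le> 2 * \<delta> i + 2 * \<delta> j" for i j
  proof -
    have "Re (l2 (F (r i) - F (r j)) (F (r i) - F (r j))) = (\<integral>x. (cmod (F (r i) x - F (r j) x))\<^sup>2 \<partial>\<rho>)"
      using l2_self[OF form.diff_mem[OF F(1) F(1)]] by (simp add: minus_apply)
    also have "\<dots> \<le> (\<integral>x. 2 * (cmod (F (r i) x - \<phi> x))\<^sup>2 + 2 * (cmod (F (r j) x - \<phi> x))\<^sup>2 \<partial>\<rho>)"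
    proof (rule integral_mono)
      show "integrable \<rho> (\<lambda>x. (cmod (F (r i) x - F (r j) x))\<^sup>2)"
        using H_integrable_sq[OF form.diff_mem[OF F(1) F(1)], of "r i" "r j"] by (simp add: minus_apply)
      show "integrable \<rho> (\<lambda>x. 2 * (cmod (F (r i) x - \<phi> x))\<^sup>2 + 2 * (cmod (F (r j) x - \<phi> x))\<^sup>2)"
        using \<delta>int by auto
      fix x
      let ?a = "cmod (F (r i) x - \<phi> x)" and ?b = "cmod (F (r j) x - \<phi> x)"
      have "cmod (F (r i) x - F (r j) x) \<le> ?a + ?b"
        using norm_triangle_ineq4[of "F (r i) x - \<phi> x" "F (r j) x - \<phi> x"] by simp
      then have "(cmod (F (r i) x - F (r j) x))\<^sup>2 \<le> (?a + ?b)\<^sup>2" by (intro power_mono) auto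
      also have "\<dots> \<le> 2 * ?a\<^sup>2 + 2 * ?b\<^sup>2" using zero_le_power2[of "?a - ?b"] by (simp add: power2_sum power2_diff)
      finally show "(cmod (F (r i) x - F (r j) x))\<^sup>2 \<le> 2 * ?a\<^sup>2 + 2 * ?b\<^sup>2" .
    qed
    also have "\<dots> = 2 * \<delta> i + 2 * \<delta> j" unfolding \<delta>_def using \<delta>int by simp
    finally show ?thesis .
  qed
  show ?thesis
  proof (rule that[OF r])
    fix \<epsilon> :: real assume "\<epsilon> > 0"
    then have "\<forall>\<^sub>F i in sequentially. \<delta> i < \<epsilon> / 4" by (intro order_tendstoD(2)[OF \<delta>0]) simp
    then obtain N where N: "\<And>i. i \<ge> N \<Longrightarrow> \<delta> i < \<epsilon> / 4" by (auto simp: eventually_sequentially)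
    have "Re (l2 (F (r i) - F (r j)) (F (r i) - F (r j))) < \<epsilon>" if "i \<ge> N" "j \<ge> N" for i j
      using q[of i j] N[OF that(1)] N[OF that(2)] by linarith
    then show "\<exists>N. \<forall>i\<ge>N. \<forall>j\<ge>N. Re (l2 (F (r i) - F (r j)) (F (r i) - F (r j))) < \<epsilon>" by blast
  qed
qed

end

section \<open>Completeness of the eigenfunctions\<close>

context continuous_rkhs begin

definition H0 :: "('a \<Rightarrow> complex) set" where
  "H0 = {f \<in> H. \<forall>k\<ge>1. ip f (e k) = 0}"

lemma H0_mem: "f \<in> H0 \<Longrightarrow> f \<in> H" "f \<in> H0 \<Longrightarrow> k \<ge> 1 \<Longrightarrow> ip f (e k) = 0"
  by (auto simp: H0_def)

lemma H0_subspace: "cfun.subspace H0"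
  unfolding cfun.subspace_def H0_def
  using form.zero_mem form.add_mem form.scale_mem
  by (auto simp: form.zero_left e_mem ip_add ip_scale)

text \<open>The form s \<open>ip\<close> - \<open>l2\<close> is semidefinite on the complement and
  vanishes at g. Cauchy-Schwarz for it then annihilates its value at g and any h of the complement,
  which is the eigenvalue equation tested there.\<close>

lemma maximizer_is_eigenfunction:
  assumes g: "g \<in> H0" "Re (ip g g) \<le> 1" "s \<le> Re (l2 g g)" and s: "0 < s"
    and max: "\<And>f. f \<in> H0 \<Longrightarrow> Re (l2 f f) \<le> s * Re (ip f f)"
  shows "is_eigenpair \<rho> H ip s g"
proof -
  have gH: "g \<in> H" using g H0_mem by blast
  have H0H: "H0 \<subseteq> H" using H0_mem by blast
  interpret gap: psd_form H0 "\<lambda>f h. of_real s * ip f h - l2 f h"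
  proof unfold_locales
    fix f h c assume f: "f \<in> H0" and h: "h \<in> H0"
    then have fh: "f \<in> H" "h \<in> H" using H0H by auto
    show "of_real s * ip (cscale c f) h - l2 (cscale c f) h = c * (of_real s * ip f h - l2 f h)"
      using fh by (simp add: ip_scale l2.scale algebra_simps)
    have "ip h f = cnj (ip f h)" "l2 h f = cnj (l2 f h)"
      using ip_cnj[OF fh] l2.sym[OF fh] by simp_all
    then show "of_real s * ip h f - l2 h f = cnj (of_real s * ip f h - l2 f h)" by simp
    show "0 \<le> Re (of_real s * ip f f - l2 f f)" using max[OF f] by simp
    fix h' assume "h' \<in> H0"
    then show "of_real s * ip (f + h) h' - l2 (f + h) h' = of_real s * ip f h' - l2 f h' + (of_real s * ip h h' - l2 h h')"
      using fh H0H by (auto simp: ip_add l2.add algebra_simps)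
  qed (rule H0_subspace)
  have gg: "Re (of_real s * ip g g - l2 g g) \<le> 0"
  proof -
    have "s * Re (ip g g) \<le> s * 1" using g(2) s by (intro mult_left_mono) auto
    then show ?thesis using g(3) by simp
  qed
  have on_H0: "l2 g h = of_real s * ip g h" if h: "h \<in> H0" for h
  proof -
    have "(cmod (of_real s * ip g h - l2 g h))\<^sup>2 \<le> 0"
      using gap.cauchy_schwarz[OF g(1) h] gg gap.nonneg[OF h]
      by (smt (verit) mult_nonpos_nonneg)
    then show ?thesis by simp
  qed
  \<comment> \<open>For a general h split off its projection P; g is orthogonal to the e_k in both
    inner products, hence to the limit P of their combinations.\<close>
  have on_H: "l2 g h = of_real s * ip g h" if h: "h \<in> H" for h
  proof -
    obtain P where P: "hlim (partial h) P" "\<And>k. k \<ge> 1 \<Longrightarrow> ip (h - P) (e k) = 0"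
      using partial_converges[OF h] by blast
    have PH: "P \<in> H" using P(1) by (simp add: hlim_def)
    have l2e: "l2 g (e k) = 0" and ipe: "ip g (e k) = 0" if "k \<ge> 1" for k
    proof -
      show ipe: "ip g (e k) = 0" using H0_mem(2)[OF g(1) that] .
      have "ip (e k) g = 0" using ip_cnj[OF gH e_mem[OF that]] ipe by simp
      then show "l2 g (e k) = 0" using l2.sym[OF e_mem[OF that] gH] e_eigen[OF that gH] by simp
    qed
    have "ip g (partial h N) = 0" for N
      unfolding partial_def by (subst form.sum_right) (auto simp: form.scale_mem e_mem gH form.scale_right ipe)
    with hlim_ip_right[OF P(1) gH] have 1: "ip g P = 0" by (simp add: LIMSEQ_const_iff)
    have "l2 g (partial h N) = 0" for N
      unfolding partial_def by (subst l2.sum_right) (auto simp: form.scale_mem e_mem gH l2.scale_right l2e)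
    with hlim_l2_right[OF P(1) gH] have 2: "l2 g P = 0" by (simp add: LIMSEQ_const_iff)
    have "h - P \<in> H0" using P PH h form.diff_mem by (simp add: H0_def)
    from on_H0[OF this] show ?thesis
      using 1 2 gH PH h by (simp add: form.diff_right l2.diff_right)
  qed
  have "g \<noteq> 0" using g(3) s l2.zero_left[OF form.zero_mem] by auto
  then show ?thesis
    unfolding is_eigenpair_def is_adjoint_image_def
    using gH on_H form.scale_mem by (simp add: ip_scale)
qed

text \<open>The list of eigenfunctions is exhaustive, so g would lie in the span of some e_k, to all
  of which it is orthogonal.\<close>

lemma no_eigenfunction_in_H0:
  assumes g: "g \<in> H0" and s: "0 < s" shows "\<not> is_eigenpair \<rho> H ip s g"
proof
  assume ev: "is_eigenpair \<rho> H ip s g"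
  then have "g \<in> cfun.span {e k | k. 1 \<le> k \<and> lam k = s}"
    using spectral s unfolding spectral_system_def by blast
  moreover have "cfun.span {e k | k. 1 \<le> k \<and> lam k = s} \<subseteq> {u \<in> H. ip u g = 0}"
  proof (rule cfun.span_minimal)
    show "{e k | k. 1 \<le> k \<and> lam k = s} \<subseteq> {u \<in> H. ip u g = 0}"
    proof clarify
      fix k :: nat assume k: "1 \<le> k"
      then show "e k \<in> H \<and> ip (e k) g = 0"
        using ip_cnj[OF H0_mem(1)[OF g] e_mem[OF k]] H0_mem(2)[OF g k] e_mem[OF k] by simp
    qed
    show "cfun.subspace {u \<in> H. ip u g = 0}"
      unfolding cfun.subspace_def
      using form.zero_mem form.add_mem form.scale_mem H0_mem(1)[OF g]
      by (auto simp: form.zero_left ip_add ip_scale)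
  qed
  ultimately have "ip g g = 0" by blast
  moreover have "g \<noteq> 0" using ev by (simp add: is_eigenpair_def)
  ultimately show False using ip_pos[OF H0_mem(1)[OF g]] by simp
qed

text \<open>A nonzero complement has a positive supremum s of \<open>l2\<close> over its unit ball,
  as the embedding is injective. A maximizing sequence is first made Cauchy in L_2 by compactness
  and is then Cauchy in H, so the supremum is attained.\<close>

lemma H0_trivial:
  assumes f1: "f1 \<in> H0" shows "f1 = 0"
proof (rule ccontr)
  assume f1z: "f1 \<noteq> 0"
  define C where "C = B * measure \<rho> D"
  define S where "S = {Re (l2 f f) | f. f \<in> H0 \<and> Re (ip f f) \<le> 1}"
  define s where "s = Sup S"
  have bound: "Re (l2 f f) \<le> \<bar>C\<bar> * Re (ip f f)" if "f \<in> H" for f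
    using l2_le_hnorm[OF that] mult_right_mono[OF abs_ge_self[of C] form.nonneg[OF that]]
    unfolding C_def by linarith
  have bdd: "bdd_above S"
  proof (rule bdd_aboveI[of _ "\<bar>C\<bar>"])
    fix x assume "x \<in> S"
    then obtain f where f: "f \<in> H0" "Re (ip f f) \<le> 1" "x = Re (l2 f f)" unfolding S_def by blast
    have "x \<le> \<bar>C\<bar> * Re (ip f f)" unfolding f(3) by (rule bound[OF H0_mem(1)[OF f(1)]])
    also have "\<dots> \<le> \<bar>C\<bar> * 1" using f(2) by (intro mult_left_mono) auto
    finally show "x \<le> \<bar>C\<bar>" by simp
  qed
  have max: "Re (l2 f f) \<le> s * Re (ip f f)" if f: "f \<in> H0" for f
  proof (cases "f = 0")
    case True
    then show ?thesis by (simp add: l2.zero_left form.zero_left form.zero_mem)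
  next
    case False
    have fH: "f \<in> H" using f H0_mem by blast
    define t where "t = Re (ip f f)"
    have t: "t > 0" unfolding t_def using ip_pos[OF fH False] .
    let ?f = "cscale (of_real (1 / sqrt t)) f"
    have "(cmod (of_real (1 / sqrt t)))\<^sup>2 = 1 / t" using t by (simp add: power_divide norm_divide)
    then have n: "Re (ip ?f ?f) = 1" "Re (l2 ?f ?f) = Re (l2 f f) / t"
      using t fH by (simp_all only: form.self_scale l2.self_scale) (simp_all add: t_def)
    have "?f \<in> H0" using H0_subspace f cfun.subspace_scale by blast
    then have "Re (l2 ?f ?f) \<in> S" unfolding S_def using n(1) by fastforce
    then have "Re (l2 ?f ?f) \<le> s" unfolding s_def using bdd by (rule cSup_upper)
    then show ?thesis unfolding n t_def[symmetric] using t by (simp add: field_simps)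
  qed
  have s: "s > 0"
  proof -
    have "Re (l2 f1 f1) > 0"
      using l2_zero_imp[OF H0_mem(1)[OF f1]] f1z l2.nonneg[OF H0_mem(1)[OF f1]] by (metis less_le)
    with max[OF f1] ip_pos[OF H0_mem(1)[OF f1] f1z] show ?thesis
      by (smt (verit) mult_nonpos_nonneg)
  qed
  have "\<exists>f\<in>H0. Re (ip f f) \<le> 1 \<and> s - 1 / real (Suc n) < Re (l2 f f)" for n
  proof -
    have "S \<noteq> {}" unfolding S_def using cfun.subspace_0[OF H0_subspace]
      by (auto intro!: exI[of _ 0] simp: form.zero_left form.zero_mem)
    moreover have "s - 1 / real (Suc n) < Sup S" unfolding s_def by simp
    ultimately obtain x where "x \<in> S" "s - 1 / real (Suc n) < x" using less_cSupD by blast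
    then show ?thesis unfolding S_def by blast
  qed
  then obtain F where F: "\<And>n. F n \<in> H0" "\<And>n. Re (ip (F n) (F n)) \<le> 1" "\<And>n. s - 1 / real (Suc n) < Re (l2 (F n) (F n))"
    by metis
  have FH: "F n \<in> H" for n using F(1) H0_mem by blast
  obtain r :: "nat \<Rightarrow> nat" where r: "strict_mono r"
    and rC: "\<And>\<epsilon>. \<epsilon> > 0 \<Longrightarrow> \<exists>N. \<forall>i\<ge>N. \<forall>j\<ge>N. Re (l2 (F (r i) - F (r j)) (F (r i) - F (r j))) < \<epsilon>"
    by (rule l2_compact[of F]) (use FH F(2) in auto)
  have near: "s - 1 / real (Suc n) < Re (l2 (F (r n)) (F (r n)))" for n
  proof -
    have "1 / real (Suc (r n)) \<le> 1 / real (Suc n)"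
      using seq_suble[OF r, of n] by (intro divide_left_mono) auto
    with F(3)[of "r n"] show ?thesis by linarith
  qed
  \<comment> \<open>Near-maximizers that are close in \<open>L\<^sub>2\<close> are close in \<open>H\<close>: their midpoint is again a
    near-maximizer, so it cannot have small \<open>H\<close>-norm, and the parallelogram law applies.\<close>
  have close: "Re (ip (F (r i) - F (r j)) (F (r i) - F (r j)))
      \<le> (2 / real (Suc i) + 2 / real (Suc j) + Re (l2 (F (r i) - F (r j)) (F (r i) - F (r j)))) / s" for i j
  proof -
    let ?f = "F (r i)" and ?g = "F (r j)"
    have "Re (l2 (?f + ?g) (?f + ?g)) = 2 * Re (l2 ?f ?f) + 2 * Re (l2 ?g ?g) - Re (l2 (?f - ?g) (?f - ?g))"
      using l2.parallelogram[OF FH FH] by simp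
    moreover have "Re (l2 (?f + ?g) (?f + ?g)) \<le> s * Re (ip (?f + ?g) (?f + ?g))"
      using F(1) H0_subspace by (intro max) (auto intro: cfun.subspace_add)
    moreover have "2 * s - 2 / real (Suc i) \<le> 2 * Re (l2 ?f ?f)" "2 * s - 2 / real (Suc j) \<le> 2 * Re (l2 ?g ?g)"
      using near[of i] near[of j] by simp_all
    moreover have "s * Re (ip (?f + ?g) (?f + ?g)) \<le> s * (4 - Re (ip (?f - ?g) (?f - ?g)))"
      using form.parallelogram[OF FH FH, of "r i" "r j"] F(2)[of "r i"] F(2)[of "r j"] s by (intro mult_left_mono) auto
    ultimately have "s * Re (ip (?f - ?g) (?f - ?g)) \<le> 2 / real (Suc i) + 2 / real (Suc j) + Re (l2 (?f - ?g) (?f - ?g))"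
      unfolding right_diff_distrib by linarith
    then show ?thesis using s by (simp add: field_simps)
  qed
  have "\<exists>g\<in>H. (\<lambda>n::nat. hnorm ip (F (r n) - g)) \<longlonglongrightarrow> 0"
  proof (rule complete[OF FH])
    fix \<epsilon> :: real assume \<epsilon>: "\<epsilon> > 0"
    define a where "a = \<epsilon>\<^sup>2 * s"
    have a: "a > 0" unfolding a_def using \<epsilon> s by simp
    obtain N1 where N1: "\<forall>i\<ge>N1. \<forall>j\<ge>N1. Re (l2 (F (r i) - F (r j)) (F (r i) - F (r j))) < a / 3"
      using rC[of "a / 3"] a by auto
    obtain N2 :: nat where N2: "6 / a < N2" using reals_Archimedean2 by blast
    have small: "2 / real (Suc i) < a / 3" if "i \<ge> N2" for i
    proof -
      have "6 / a < real (Suc i)" using N2 that by linarith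
      then show ?thesis using a by (simp add: field_simps)
    qed
    have "hnorm ip (F (r i) - F (r j)) < \<epsilon>" if ij: "i \<ge> max N1 N2" "j \<ge> max N1 N2" for i j
    proof -
      let ?d = "F (r i) - F (r j)"
      have "2 / real (Suc i) + 2 / real (Suc j) + Re (l2 ?d ?d) < a"
        using N1[rule_format, of i j] small[of i] small[of j] ij by simp
      then have "(2 / real (Suc i) + 2 / real (Suc j) + Re (l2 ?d ?d)) / s < \<epsilon>\<^sup>2"
        using s unfolding a_def by (simp add: pos_divide_less_eq)
      with close[of i j] have "(hnorm ip ?d)\<^sup>2 < \<epsilon>\<^sup>2"
        by (simp only: hnorm_sq[OF form.diff_mem[OF FH FH]])
      then show ?thesis by (rule power_less_imp_less_base) (use \<epsilon> in simp)
    qed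
    then show "\<exists>N. \<forall>i\<ge>N. \<forall>j\<ge>N. hnorm ip (F (r i) - F (r j)) < \<epsilon>" by blast
  qed
  then obtain g where g: "hlim (\<lambda>n. F (r n)) g" unfolding hlim_def using FH by blast
  have gH: "g \<in> H" using g by (simp add: hlim_def)
  have g0: "g \<in> H0"
  proof -
    have "ip g (e k) = 0" if "k \<ge> 1" for k
      using hlim_ip[OF g e_mem[OF that]] H0_mem(2)[OF F(1) that] by (simp add: LIMSEQ_const_iff)
    then show ?thesis using gH by (simp add: H0_def)
  qed
  have "Re (ip g g) \<le> 1" using hlim_norm[OF g] F(2) by (intro LIMSEQ_le_const2) auto
  moreover have "s \<le> Re (l2 g g)"
  proof (rule LIMSEQ_le[OF _ hlim_l2_norm[OF g]])
    show "(\<lambda>n. s - 1 / real (Suc n)) \<longlonglongrightarrow> s"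
      using tendsto_diff[OF tendsto_const LIMSEQ_inverse_real_of_nat, of s] by (simp add: inverse_eq_divide)
    show "\<exists>N. \<forall>n\<ge>N. s - 1 / real (Suc n) \<le> Re (l2 (F (r n)) (F (r n)))"
      using near by (auto intro: less_imp_le)
  qed
  ultimately have "is_eigenpair \<rho> H ip s g"
    using maximizer_is_eigenfunction[OF g0 _ _ s max] by blast
  with no_eigenfunction_in_H0[OF g0 s] show False by blast
qed

theorem partial_hlim: "f \<in> H \<Longrightarrow> hlim (partial f) f"
proof -
  assume f: "f \<in> H"
  obtain g where g: "hlim (partial f) g" "\<And>k. k \<ge> 1 \<Longrightarrow> ip (f - g) (e k) = 0"
    using partial_converges[OF f] by blast
  then have "f - g \<in> H0" using f form.diff_mem by (simp add: H0_def hlim_def)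
  then have "f = g" using H0_trivial[of "f - g"] by simp
  with g show ?thesis by simp
qed

lemma eval_expansion: "f \<in> H \<Longrightarrow> x \<in> D \<Longrightarrow> (\<lambda>N. \<Sum>k\<in>{1..N}. ip f (e k) * e k x) \<longlonglongrightarrow> f x"
  using hlim_eval[OF partial_hlim] by (simp add: partial_apply)

text \<open>Bessel's inequality for the kernel section at x, whose coefficients are the conjugates
  of e_k(x).\<close>

lemma e_sq_sum_le: "x \<in> D \<Longrightarrow> (\<Sum>k\<in>{1..N}. (cmod (e k x))\<^sup>2) \<le> B"
proof -
  assume x: "x \<in> D"
  have "cmod (ip (ksection D K x) (e k)) = cmod (e k x)" if "k \<ge> 1" for k
    using ip_cnj[OF e_mem[OF that] ksection_mem[OF x]] reproducing[OF e_mem[OF that] x] by simp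
  then have "(\<Sum>k\<in>{1..N}. (cmod (e k x))\<^sup>2) = (\<Sum>k\<in>{1..N}. (cmod (ip (ksection D K x) (e k)))\<^sup>2)"
    by (intro sum.cong) auto
  also have "\<dots> \<le> Re (ip (ksection D K x) (ksection D K x))" by (rule bessel[OF ksection_mem[OF x]])
  also have "\<dots> \<le> B" using K_bound[OF x] ksection_ip[OF x x] by simp
  finally show ?thesis .
qed

end

section \<open>Least squares\<close>

text \<open>The rank is the size of a maximal independent subset of the set of columns, and a
  repeated column makes this set smaller.\<close>

lemma (in vec_space) rank_less_if_not_distinct:
  assumes A: "A \<in> carrier_mat n nc" and nd: "\<not> distinct (cols A)"
  shows "rank A < nc"
proof -
  obtain S where S: "maximal S (\<lambda>T. T \<subseteq> set (cols A) \<and> lin_indpt T)"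
    using maximal_exists[of "(\<lambda>T. T \<subseteq> set (cols A) \<and> lin_indpt T)" "card (set (cols A))" "{}"]
    by (meson List.finite_set card_mono empty_iff empty_subsetI finite_lin_indpt2 rev_finite_subset)
  then have "card S \<le> card (set (cols A))" by (simp add: card_mono maximal_def)
  also have "card (set (cols A)) < nc"
    using A nd card_distinct[of "cols A"] card_length[of "cols A"] by (metis carrier_matD(2) cols_length le_neq_implies_less)
  finally show ?thesis using rank_card_indpt[OF A S] by simp
qed

lemma index_mult_mat_vec_sum:
  assumes "A \<in> carrier_mat n d" "v \<in> carrier_vec d" "i < n"
  shows "vec_index (A *\<^sub>v v) i = (\<Sum>k<d. A $$ (i, k) * vec_index v k)"
  using assms by (simp add: scalar_prod_def atLeast0LessThan)

lemma full_column_rank_iff: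
  assumes A: "A \<in> carrier_mat n d"
  shows "full_column_rank A \<longleftrightarrow> (\<forall>v \<in> carrier_vec d. A *\<^sub>v v = 0\<^sub>v n \<longrightarrow> v = 0\<^sub>v d)"
proof -
  interpret vec_space "TYPE(complex)" n .
  have dims: "dim_row A = n" "dim_col A = d" using A by auto
  show ?thesis unfolding full_column_rank_def dims
  proof
    assume r: "rank A = d"
    then have dist: "distinct (cols A)" using rank_less_if_not_distinct[OF A] by fastforce
    show "\<forall>v \<in> carrier_vec d. A *\<^sub>v v = 0\<^sub>v n \<longrightarrow> v = 0\<^sub>v d"
      using lin_depI[OF A _ _ _ dist] full_rank_lin_indpt[OF A r dist] by blast
  next
    assume inj: "\<forall>v \<in> carrier_vec d. A *\<^sub>v v = 0\<^sub>v n \<longrightarrow> v = 0\<^sub>v d"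
    have dist: "distinct (cols A)"
    proof (rule ccontr)
      assume "\<not> distinct (cols A)"
      then obtain i j where ij: "i < d" "j < d" "i \<noteq> j" "cols A ! i = cols A ! j"
        using dims by (auto simp: distinct_conv_nth)
      \<comment> \<open>The difference of two unit vectors is in the kernel when the two columns
        agree.\<close>
      define v where "v = Matrix.vec d (\<lambda>k. if k = i then 1 else if k = j then - 1 else (0 :: complex))"
      have v: "v \<in> carrier_vec d" by (simp add: v_def)
      have eq: "A $$ (l, i) = A $$ (l, j)" if "l < n" for l
        using ij dims that by (metis cols_nth index_col)
      have "A *\<^sub>v v = 0\<^sub>v n"
      proof (rule eq_vecI)
        fix l assume "l < dim_vec (0\<^sub>v n :: complex Matrix.vec)"
        then have l: "l < n" by simp
        have "vec_index (A *\<^sub>v v) l = (\<Sum>k<d. A $$ (l, k) * vec_index v k)"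
          by (rule index_mult_mat_vec_sum[OF A v l])
        also have "\<dots> = (\<Sum>k<d. (if k = i then A $$ (l, k) else 0) - (if k = j then A $$ (l, k) else 0))"
          using ij by (intro sum.cong refl) (auto simp: v_def)
        also have "\<dots> = A $$ (l, i) - A $$ (l, j)"
          using ij by (simp add: sum_subtractf)
        finally show "vec_index (A *\<^sub>v v) l = vec_index (0\<^sub>v n) l" using eq l by simp
      qed (use dims in simp)
      then have "v = 0\<^sub>v d" using inj v by blast
      then have "vec_index v i = 0" using ij by simp
      then show False using ij by (simp add: v_def)
    qed
    show "rank A = d"
      using lin_indpt_full_rank[OF A dist] lin_depE[OF A _ dist] inj by metis
  qed
qed

lemma mat_adjoint_carrier: "A \<in> carrier_mat n d \<Longrightarrow> mat_adjoint A \<in> carrier_mat d n"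
  by (auto simp: mat_adjoint_def)

lemma mat_adjoint_index:
  "(A :: complex Matrix.mat) \<in> carrier_mat n d \<Longrightarrow> k < d \<Longrightarrow> j < n \<Longrightarrow> mat_adjoint A $$ (k, j) = cnj (A $$ (j, k))"
  by (auto simp: mat_adjoint_def mat_of_rows_index conjugate_vec_def conjugate_complex_def)

lemma adjoint_pairing:
  fixes A :: "complex Matrix.mat"
  assumes A: "A \<in> carrier_mat n d" and v: "v \<in> carrier_vec d" and w: "w \<in> carrier_vec n"
  shows "(\<Sum>k<d. cnj (vec_index v k) * vec_index (mat_adjoint A *\<^sub>v w) k)
       = (\<Sum>j<n. cnj (vec_index (A *\<^sub>v v) j) * vec_index w j)"
proof -
  have "(\<Sum>k<d. cnj (vec_index v k) * vec_index (mat_adjoint A *\<^sub>v w) k)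
      = (\<Sum>k<d. \<Sum>j<n. cnj (vec_index v k) * (cnj (A $$ (j, k)) * vec_index w j))"
    by (intro sum.cong refl)
      (simp add: index_mult_mat_vec_sum[OF mat_adjoint_carrier[OF A] w] mat_adjoint_index[OF A] sum_distrib_left)
  also have "\<dots> = (\<Sum>j<n. \<Sum>k<d. cnj (vec_index v k) * (cnj (A $$ (j, k)) * vec_index w j))"
    by (rule sum.swap)
  also have "\<dots> = (\<Sum>j<n. cnj (vec_index (A *\<^sub>v v) j) * vec_index w j)"
    by (intro sum.cong refl)
      (simp add: index_mult_mat_vec_sum[OF A v] sum_distrib_left mult_ac)
  finally show ?thesis .
qed

definition gram :: "complex Matrix.mat \<Rightarrow> complex Matrix.mat" where
  "gram A = mat_adjoint A * A"

lemma gram_carrier: "A \<in> carrier_mat n d \<Longrightarrow> gram A \<in> carrier_mat d d"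
  unfolding gram_def by (meson mult_carrier_mat mat_adjoint_carrier)

lemma gram_index:
  assumes A: "A \<in> carrier_mat n d" and "k < d" "l < d"
  shows "gram A $$ (k, l) = (\<Sum>j<n. cnj (A $$ (j, k)) * A $$ (j, l))"
  unfolding gram_def using assms mat_adjoint_carrier[OF A]
  by (simp add: scalar_prod_def atLeast0LessThan mat_adjoint_index[OF A])

lemma gram_mult_vec:
  assumes A: "A \<in> carrier_mat n d" and v: "v \<in> carrier_vec d"
  shows "gram A *\<^sub>v v = mat_adjoint A *\<^sub>v (A *\<^sub>v v)"
  unfolding gram_def by (rule assoc_mult_mat_vec[OF mat_adjoint_carrier[OF A] A v])

text \<open>The Gram matrix has the kernel of A, because its form at v is |A v|^2. The rank
  condition becomes the nonvanishing of a polynomial in the entries and their conjugates, which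
  makes it measurable.\<close>

lemma full_column_rank_iff_det:
  assumes A: "A \<in> carrier_mat n d"
  shows "full_column_rank A \<longleftrightarrow> Determinant.det (gram A) \<noteq> 0"
proof -
  have "gram A *\<^sub>v v = 0\<^sub>v d \<longleftrightarrow> A *\<^sub>v v = 0\<^sub>v n" if v: "v \<in> carrier_vec d" for v
  proof
    assume "gram A *\<^sub>v v = 0\<^sub>v d"
    then have "(\<Sum>j<n. cnj (vec_index (A *\<^sub>v v) j) * vec_index (A *\<^sub>v v) j) = 0"
      using adjoint_pairing[OF A v, of "A *\<^sub>v v"] A v gram_mult_vec[OF A v] by simp
    then have "complex_of_real (\<Sum>j<n. (cmod (vec_index (A *\<^sub>v v) j))\<^sup>2) = 0"
      by (simp add: complex_norm_square mult.commute del: of_real_power)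
    then have "(\<Sum>j<n. (cmod (vec_index (A *\<^sub>v v) j))\<^sup>2) = 0" using of_real_eq_0_iff by blast
    then have "\<forall>j\<in>{..<n}. (cmod (vec_index (A *\<^sub>v v) j))\<^sup>2 = 0"
      by (subst (asm) sum_nonneg_eq_0_iff) auto
    then show "A *\<^sub>v v = 0\<^sub>v n" using A by (intro eq_vecI) auto
  next
    assume "A *\<^sub>v v = 0\<^sub>v n"
    then show "gram A *\<^sub>v v = 0\<^sub>v d"
      unfolding gram_mult_vec[OF A v] using mat_adjoint_carrier[OF A] by (intro eq_vecI) auto
  qed
  then show ?thesis
    unfolding full_column_rank_iff[OF A] det_0_iff_vec_prod_zero_field[OF gram_carrier[OF A]] by blast
qed

text \<open>Identifies the inverse found by elimination with the cofactor formula, whose entries are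
  visibly measurable functions of G.\<close>

lemma mat_inverse_adj_mat:
  fixes G :: "complex Matrix.mat"
  assumes G: "G \<in> carrier_mat d d" and det: "Determinant.det G \<noteq> 0"
  obtains B where "mat_inverse G = Some B" "B \<in> carrier_mat d d" "B * G = 1\<^sub>m d" "G * B = 1\<^sub>m d"
    "\<And>k l. k < d \<Longrightarrow> l < d \<Longrightarrow> B $$ (k, l) = adj_mat G $$ (k, l) / Determinant.det G"
proof -
  obtain B where B: "mat_inverse G = Some B"
    using mat_inverse(1)[OF G, where b = "()"] det_non_zero_imp_unit[OF G det, where b = "()"] by (cases "mat_inverse G") auto
  have BB: "G * B = 1\<^sub>m d" "B * G = 1\<^sub>m d" "B \<in> carrier_mat d d" using mat_inverse(2)[OF G B] by auto
  have adj: "adj_mat G \<in> carrier_mat d d" "G * adj_mat G = Determinant.det G \<cdot>\<^sub>m 1\<^sub>m d" using adj_mat[OF G] by auto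
  have "adj_mat G = (B * G) * adj_mat G" unfolding BB using adj by simp
  also have "\<dots> = B * (G * adj_mat G)" by (rule assoc_mult_mat[OF BB(3) G adj(1)])
  also have "\<dots> = Determinant.det G \<cdot>\<^sub>m B"
    unfolding adj(2) using BB(3) by (simp add: mult_smult_distrib[of B d d "1\<^sub>m d" d])
  finally have "adj_mat G = Determinant.det G \<cdot>\<^sub>m B" .
  then have "B $$ (k, l) = adj_mat G $$ (k, l) / Determinant.det G" if "k < d" "l < d" for k l
    using that BB(3) det by simp
  with B BB that show ?thesis by blast
qed

definition lsq :: "complex Matrix.mat \<Rightarrow> complex Matrix.vec \<Rightarrow> complex Matrix.vec" where
  "lsq A g = the (mat_inverse (gram A)) *\<^sub>v (mat_adjoint A *\<^sub>v g)"

text \<open>Entry (k, j) of the pseudo-inverse of A, written by Cramer's rule as a quotient of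
  polynomials in the entries and their conjugates.\<close>

definition lsq_weight :: "complex Matrix.mat \<Rightarrow> nat \<Rightarrow> nat \<Rightarrow> complex" where
  "lsq_weight A k j = (\<Sum>l<dim_col A. adj_mat (gram A) $$ (k, l) * cnj (A $$ (j, l))) / Determinant.det (gram A)"

context
  fixes A :: "complex Matrix.mat" and n d
  assumes A: "A \<in> carrier_mat n d" and rank: "full_column_rank A"
begin

lemma det_gram: "Determinant.det (gram A) \<noteq> 0"
  using rank full_column_rank_iff_det[OF A] by simp

lemma lsq_carrier: "g \<in> carrier_vec n \<Longrightarrow> lsq A g \<in> carrier_vec d"
  unfolding lsq_def
  by (rule mat_inverse_adj_mat[OF gram_carrier[OF A] det_gram])
    (metis A mat_adjoint_carrier mult_mat_vec_carrier option.sel)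

lemma lsq_normal: "g \<in> carrier_vec n \<Longrightarrow> gram A *\<^sub>v lsq A g = mat_adjoint A *\<^sub>v g"
proof -
  assume g: "g \<in> carrier_vec n"
  obtain B where B: "mat_inverse (gram A) = Some B" "B \<in> carrier_mat d d" "gram A * B = 1\<^sub>m d"
    by (rule mat_inverse_adj_mat[OF gram_carrier[OF A] det_gram])
  have w: "mat_adjoint A *\<^sub>v g \<in> carrier_vec d" using mat_adjoint_carrier[OF A] g by simp
  show ?thesis
    unfolding lsq_def B(1) option.sel assoc_mult_mat_vec[OF gram_carrier[OF A] B(2) w, symmetric] B(3)
    using w by simp
qed

lemma lsq_exact: "a \<in> carrier_vec d \<Longrightarrow> lsq A (A *\<^sub>v a) = a"
proof -
  assume a: "a \<in> carrier_vec d"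
  obtain B where B: "mat_inverse (gram A) = Some B" "B \<in> carrier_mat d d" "B * gram A = 1\<^sub>m d"
    by (rule mat_inverse_adj_mat[OF gram_carrier[OF A] det_gram])
  show ?thesis
    unfolding lsq_def B(1) option.sel gram_mult_vec[OF A a, symmetric]
      assoc_mult_mat_vec[OF B(2) gram_carrier[OF A] a, symmetric] B(3)
    using a by simp
qed

lemma lsq_index:
  assumes g: "g \<in> carrier_vec n" and k: "k < d"
  shows "vec_index (lsq A g) k = (\<Sum>j<n. lsq_weight A k j * vec_index g j)"
proof -
  obtain B where B: "mat_inverse (gram A) = Some B" "B \<in> carrier_mat d d"
    "\<And>k l. k < d \<Longrightarrow> l < d \<Longrightarrow> B $$ (k, l) = adj_mat (gram A) $$ (k, l) / Determinant.det (gram A)"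
    using mat_inverse_adj_mat[OF gram_carrier[OF A] det_gram] by metis
  have w: "mat_adjoint A *\<^sub>v g \<in> carrier_vec d" using mat_adjoint_carrier[OF A] g by simp
  have "vec_index (lsq A g) k = (\<Sum>l<d. B $$ (k, l) * (\<Sum>j<n. cnj (A $$ (j, l)) * vec_index g j))"
    unfolding lsq_def B(1) option.sel index_mult_mat_vec_sum[OF B(2) w k]
    by (intro sum.cong refl)
      (simp add: index_mult_mat_vec_sum[OF mat_adjoint_carrier[OF A] g] mat_adjoint_index[OF A])
  also have "\<dots> = (\<Sum>l<d. \<Sum>j<n. adj_mat (gram A) $$ (k, l) * cnj (A $$ (j, l)) / Determinant.det (gram A) * vec_index g j)"
    using k by (intro sum.cong refl) (simp add: B(3) sum_distrib_left mult_ac)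
  also have "\<dots> = (\<Sum>j<n. \<Sum>l<d. adj_mat (gram A) $$ (k, l) * cnj (A $$ (j, l)) / Determinant.det (gram A) * vec_index g j)"
    by (rule sum.swap)
  also have "\<dots> = (\<Sum>j<n. lsq_weight A k j * vec_index g j)"
    using A by (intro sum.cong refl) (simp add: lsq_weight_def sum_divide_distrib sum_distrib_right)
  finally show ?thesis .
qed

text \<open>The fitted vector x is the orthogonal projection of the data y onto the range of A: the
  normal equations give |x|^2 = <y, x>, and Cauchy-Schwarz finishes.\<close>

lemma lsq_residual_norm:
  assumes g: "g \<in> carrier_vec n"
  shows "(\<Sum>j<n. (cmod (vec_index (A *\<^sub>v lsq A g) j))\<^sup>2) \<le> (\<Sum>j<n. (cmod (vec_index g j))\<^sup>2)"
proof -
  let ?c = "lsq A g"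
  have c: "?c \<in> carrier_vec d" by (rule lsq_carrier[OF g])
  define x where "x = vec_index (A *\<^sub>v ?c)"
  define y where "y = vec_index g"
  have xs: "dot {..<n} u u = of_real (\<Sum>j<n. (cmod (u j))\<^sup>2)" for u by (rule dot_self)
  have "(\<Sum>j<n. cnj (x j) * x j) = (\<Sum>j<n. cnj (x j) * y j)"
    unfolding x_def y_def
    using adjoint_pairing[OF A c, of "A *\<^sub>v ?c"] adjoint_pairing[OF A c g] lsq_normal[OF g]
      gram_mult_vec[OF A c] A c by simp
  then have "dot {..<n} x x = dot {..<n} y x" by (simp add: dot_def mult.commute)
  then have "dot {..<n} y x = of_real (Re (dot {..<n} x x))" by (metis xs Re_complex_of_real)
  then have "(Re (dot {..<n} x x))\<^sup>2 \<le> Re (dot {..<n} y y) * Re (dot {..<n} x x)"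
    using dot_cauchy_schwarz[of "{..<n}" y x] by simp
  then have "Re (dot {..<n} x x) * Re (dot {..<n} x x) \<le> Re (dot {..<n} y y) * Re (dot {..<n} x x)"
    by (simp add: power2_eq_square)
  then have "Re (dot {..<n} x x) \<le> Re (dot {..<n} y y)"
    using dot_self_nonneg[of "{..<n}" x] dot_self_nonneg[of "{..<n}" y]
    by (cases "Re (dot {..<n} x x) = 0") (auto simp: mult_le_cancel_right)
  then show ?thesis unfolding xs x_def y_def by simp
qed

end

section \<open>Measurability of the least squares weights\<close>

lemma measurable_det:
  fixes G :: "'b \<Rightarrow> complex Matrix.mat"
  assumes G: "\<And>x. G x \<in> carrier_mat d d"
    and m: "\<And>i j. i < d \<Longrightarrow> j < d \<Longrightarrow> (\<lambda>x. G x $$ (i, j)) \<in> borel_measurable M"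
  shows "(\<lambda>x. Determinant.det (G x)) \<in> borel_measurable M"
proof -
  have "Determinant.det (G x) = (\<Sum>p \<in> {p. p permutes {0..<d}}. signof p * (\<Prod>i = 0..<d. G x $$ (i, p i)))" for x
    using G[of x] by (simp add: Determinant.det_def)
  moreover have "(\<lambda>x. \<Sum>p \<in> {p. p permutes {0..<d}}. signof p * (\<Prod>i = 0..<d. G x $$ (i, p i))) \<in> borel_measurable M"
  proof (intro borel_measurable_sum borel_measurable_times borel_measurable_const borel_measurable_prod m)
    fix p i assume "p \<in> {p. p permutes {0..<d}}" "i \<in> {0..<d}"
    then show "i < d" "p i < d" using permutes_in_image[of p "{0..<d}" i] by auto
  qed
  ultimately show ?thesis by simp
qed

lemma measurable_adj_mat:
  fixes G :: "'b \<Rightarrow> complex Matrix.mat"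
  assumes G: "\<And>x. G x \<in> carrier_mat d d"
    and m: "\<And>i j. i < d \<Longrightarrow> j < d \<Longrightarrow> (\<lambda>x. G x $$ (i, j)) \<in> borel_measurable M"
    and kl: "k < d" "l < d"
  shows "(\<lambda>x. adj_mat (G x) $$ (k, l)) \<in> borel_measurable M"
proof -
  have dims: "dim_row (G x) = d" "dim_col (G x) = d" for x using G[of x] by auto
  have "(\<lambda>x. Determinant.det (mat_delete (G x) l k)) \<in> borel_measurable M"
  proof (rule measurable_det)
    show "mat_delete (G x) l k \<in> carrier_mat (d - 1) (d - 1)" for x by (rule mat_delete_carrier[OF G])
    fix i j assume ij: "i < d - 1" "j < d - 1"
    have "(\<lambda>x. G x $$ (if i < l then i else Suc i, if j < k then j else Suc j)) \<in> borel_measurable M"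
      using ij by (intro m) auto
    then show "(\<lambda>x. mat_delete (G x) l k $$ (i, j)) \<in> borel_measurable M"
      using ij by (simp add: mat_delete_def dims)
  qed
  moreover have "adj_mat (G x) $$ (k, l) = (- 1) ^ (l + k) * Determinant.det (mat_delete (G x) l k)" for x
    using kl by (simp add: adj_mat_def dims Determinant.cofactor_def)
  ultimately show ?thesis by (auto intro!: borel_measurable_times)
qed

lemma measurable_gram:
  assumes A: "\<And>x. A x \<in> carrier_mat n d"
    and m: "\<And>j k. j < n \<Longrightarrow> k < d \<Longrightarrow> (\<lambda>x. A x $$ (j, k)) \<in> borel_measurable M"
  shows "k < d \<Longrightarrow> l < d \<Longrightarrow> (\<lambda>x. gram (A x) $$ (k, l)) \<in> borel_measurable M"
  unfolding gram_index[OF A] by (intro borel_measurable_sum borel_measurable_times borel_measurable_cnj m) auto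

lemma measurable_full_column_rank:
  assumes A: "\<And>x. A x \<in> carrier_mat n d"
    and m: "\<And>j k. j < n \<Longrightarrow> k < d \<Longrightarrow> (\<lambda>x. A x $$ (j, k)) \<in> borel_measurable M"
  shows "{x \<in> space M. full_column_rank (A x)} \<in> sets M"
proof -
  have "(\<lambda>x. Determinant.det (gram (A x))) \<in> borel_measurable M"
    by (rule measurable_det[OF gram_carrier[OF A] measurable_gram[OF A m]])
  then show ?thesis unfolding full_column_rank_iff_det[OF A] by measurable
qed

lemma measurable_lsq_weight:
  assumes A: "\<And>x. A x \<in> carrier_mat n d"
    and m: "\<And>j k. j < n \<Longrightarrow> k < d \<Longrightarrow> (\<lambda>x. A x $$ (j, k)) \<in> borel_measurable M"
    and kj: "k < d" "j < n"
  shows "(\<lambda>x. lsq_weight (A x) k j) \<in> borel_measurable M"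
proof -
  have "dim_col (A x) = d" for x using A[of x] by simp
  then show ?thesis
    unfolding lsq_weight_def
    by simp (intro borel_measurable_divide borel_measurable_sum borel_measurable_times borel_measurable_cnj
      measurable_det[OF gram_carrier[OF A] measurable_gram[OF A m]]
      measurable_adj_mat[OF gram_carrier[OF A] measurable_gram[OF A m]] m kj; use kj in simp)
qed

section \<open>The sampling measure\<close>

lemma nonneg_tail_summable:
  fixes f :: "nat \<Rightarrow> real"
  assumes nn: "\<And>k. k \<ge> 1 \<Longrightarrow> 0 \<le> f k" and b: "\<And>N. sum f {1..N} \<le> C" and m: "m \<ge> 1"
  shows "f summable_on {m..}"
proof (rule nonneg_bdd_above_summable_on)
  show "0 \<le> f k" if "k \<in> {m..}" for k using that nn m by simp
  show "bdd_above (sum f ` {F. F \<subseteq> {m..} \<and> finite F})"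
  proof (rule bdd_aboveI2)
    fix F assume "F \<in> {F. F \<subseteq> {m..} \<and> finite F}"
    then have F: "F \<subseteq> {m..}" "finite F" by auto
    have "F \<subseteq> {1..Max (insert 0 F)}" using F m by (auto intro: le_trans)
    then have "sum f F \<le> sum f {1..Max (insert 0 F)}" using nn by (intro sum_mono2) auto
    also have "\<dots> \<le> C" by (rule b)
    finally show "sum f F \<le> C" .
  qed
qed

text \<open>Links the unordered sums of the definitions to limits of truncations.\<close>

lemma tail_infsum_limit:
  fixes f :: "nat \<Rightarrow> 'c::{comm_monoid_add, t2_space}"
  assumes "f summable_on {m..}"
  shows "(\<lambda>N. sum f {m..N}) \<longlonglongrightarrow> infsum f {m..}"
proof -
  have "(sum f \<longlongrightarrow> infsum f {m..}) (finite_subsets_at_top {m..})"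
    using assms has_sum_infsum unfolding has_sum_def by blast
  moreover have "filterlim (\<lambda>N. {m..N}) (finite_subsets_at_top {m..}) sequentially"
    unfolding filterlim_finite_subsets_at_top
  proof (intro allI impI)
    fix X assume X: "finite X \<and> X \<subseteq> {m..}"
    show "\<forall>\<^sub>F N in sequentially. finite {m..N} \<and> X \<subseteq> {m..N} \<and> {m..N} \<subseteq> {m..}"
      using eventually_ge_at_top[of "Max (insert 0 X)"]
      by eventually_elim (use X in \<open>auto intro: order_trans[rotated]\<close>)
  qed
  ultimately show ?thesis by (rule filterlim_compose)
qed

context continuous_rkhs begin

text \<open>Integrating the pointwise bound \<open>e_sq_sum_le\<close>: the embedding is
  Hilbert-Schmidt.\<close>

lemma sum_lam_le: "sum lam {1..N} \<le> B * measure \<rho> D"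
proof -
  interpret finite_measure \<rho> by (rule rho_finite)
  have "sum lam {1..N} = (\<Sum>k\<in>{1..N}. (\<integral>x. (cmod (e k x))\<^sup>2 \<partial>\<rho>))"
    by (intro sum.cong refl) (use e_l2 l2_self[OF e_mem] in auto)
  also have "\<dots> = (\<integral>x. (\<Sum>k\<in>{1..N}. (cmod (e k x))\<^sup>2) \<partial>\<rho>)"
    using H_integrable_sq[OF e_mem] by (intro Bochner_Integration.integral_sum[symmetric]) auto
  also have "\<dots> \<le> (\<integral>x. B \<partial>\<rho>)"
    using H_integrable_sq[OF e_mem] e_sq_sum_le
    by (intro integral_mono Bochner_Integration.integrable_sum) (auto simp: rho_space)
  finally show ?thesis by (simp add: rho_space mult.commute)
qed

end

locale sampling = continuous_rkhs +
  fixes m :: nat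
  assumes m2: "2 \<le> m"
begin

definition Lam :: real where "Lam = (\<Sum>\<^sub>\<infinity>k\<in>{m..}. lam k)"
definition tail :: "'a \<Rightarrow> real" where "tail x = (\<Sum>\<^sub>\<infinity>k\<in>{m..}. (cmod (e k x))\<^sup>2)"
abbreviation dens :: "'a \<Rightarrow> real" where "dens \<equiv> sampling_density lam e m"
abbreviation M :: "'a measure" where "M \<equiv> sampling_measure \<rho> lam e m"
abbreviation \<eta> :: "nat \<Rightarrow> 'a \<Rightarrow> complex" where "\<eta> \<equiv> eta lam e"

lemma summable_lam: "lam summable_on {m..}"
  using m2 lam_pos by (intro nonneg_tail_summable[OF _ sum_lam_le]) (auto intro: less_imp_le)

lemma summable_tail: "x \<in> D \<Longrightarrow> (\<lambda>k. (cmod (e k x))\<^sup>2) summable_on {m..}"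
  using m2 by (intro nonneg_tail_summable[OF _ e_sq_sum_le]) auto

lemma Lam_limit: "(\<lambda>N. sum lam {m..N}) \<longlonglongrightarrow> Lam"
  unfolding Lam_def by (rule tail_infsum_limit[OF summable_lam])

lemma tail_limit: "x \<in> D \<Longrightarrow> (\<lambda>N. \<Sum>k\<in>{m..N}. (cmod (e k x))\<^sup>2) \<longlonglongrightarrow> tail x"
  unfolding tail_def by (rule tail_infsum_limit[OF summable_tail])

lemma sum_le_tail: "x \<in> D \<Longrightarrow> (\<Sum>k\<in>{m..N}. (cmod (e k x))\<^sup>2) \<le> tail x"
  unfolding tail_def by (rule finite_sum_le_infsum[OF summable_tail]) auto

lemma tail_nonneg: "x \<in> D \<Longrightarrow> 0 \<le> tail x"
  using sum_le_tail[of x 0] m2 by simp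

lemma sum_lam_le_Lam: "sum lam {m..N} \<le> Lam"
  unfolding Lam_def using lam_pos m2 by (intro finite_sum_le_infsum[OF summable_lam]) (auto intro: less_imp_le)

lemma Lam_pos: "0 < Lam"
  using sum_lam_le_Lam[of m] lam_pos[of m] m2 by simp

lemma dens_eq: "dens x = 1 / 2 * (1 / real (m - 1) * (\<Sum>k=1..m-1. (cmod (\<eta> k x))\<^sup>2) + 1 / Lam * tail x)"
  by (simp add: sampling_density_def Lam_def tail_def)

lemma sigma_sq: "k \<ge> 1 \<Longrightarrow> (singular_number lam k)\<^sup>2 = lam k"
  using lam_pos[of k] by (simp add: singular_number_def)

lemma sigma_pos: "k \<ge> 1 \<Longrightarrow> 0 < singular_number lam k"
  using lam_pos[of k] by (simp add: singular_number_def)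

lemma eta_scale: "\<eta> k = cscale (1 / of_real (singular_number lam k)) (e k)"
  by (simp add: fun_eq_iff eta_def cscale_def)

lemma eta_mem: "k \<ge> 1 \<Longrightarrow> \<eta> k \<in> H"
  unfolding eta_scale by (intro form.scale_mem e_mem)

lemma e_eta: "k \<ge> 1 \<Longrightarrow> e k x = of_real (singular_number lam k) * \<eta> k x"
  using sigma_pos[of k] by (simp add: eta_def)

lemma e_sq_eta: "k \<ge> 1 \<Longrightarrow> (cmod (e k x))\<^sup>2 = lam k * (cmod (\<eta> k x))\<^sup>2"
  using sigma_pos[of k] by (simp add: e_eta norm_mult power_mult_distrib sigma_sq)

lemma eta_l2: "j \<ge> 1 \<Longrightarrow> k \<ge> 1 \<Longrightarrow> l2 (\<eta> j) (\<eta> k) = (if j = k then 1 else 0)"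
proof -
  assume j: "j \<ge> 1" and k: "k \<ge> 1"
  have "of_real (lam k) = (of_real (singular_number lam k) * of_real (singular_number lam k) :: complex)"
    using sigma_sq[OF k] by (metis of_real_mult power2_eq_square)
  moreover have "l2 (\<eta> j) (\<eta> k) = 1 / of_real (singular_number lam j) * (1 / of_real (singular_number lam k) * l2 (e j) (e k))"
    unfolding eta_scale using e_mem[OF j] e_mem[OF k] form.scale_mem by (simp add: l2.scale l2.scale_right)
  ultimately show ?thesis
    using sigma_pos[OF k] by (cases "j = k") (simp_all add: e_l2[OF j k] e_l2[OF k k])
qed

lemma dens_nonneg: "x \<in> D \<Longrightarrow> 0 \<le> dens x"
  unfolding dens_eq using Lam_pos tail_nonneg by (simp add: sum_nonneg)

text \<open>Each half of the density dominates its own sum. Dropping the other half is the source of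
  the factor 2 in the row bounds 2 (m - 1) and 2 \<open>Lam\<close>.\<close>

lemma eta_sum_le_dens: "x \<in> D \<Longrightarrow> (\<Sum>k=1..m-1. (cmod (\<eta> k x))\<^sup>2) \<le> 2 * real (m - 1) * dens x"
proof -
  assume x: "x \<in> D"
  have "S \<le> 2 * q * (1 / 2 * (1 / q * S + t))" if "0 < q" "0 \<le> t" for S q t :: real
    using that by (simp add: algebra_simps)
  moreover have "0 < real (m - 1)" "0 \<le> 1 / Lam * tail x" using m2 Lam_pos tail_nonneg[OF x] by auto
  ultimately show ?thesis unfolding dens_eq by blast
qed

lemma tail_le_dens: "x \<in> D \<Longrightarrow> tail x \<le> 2 * Lam * dens x"
proof -
  assume x: "x \<in> D"
  have "0 \<le> 1 / real (m - 1) * (\<Sum>k=1..m-1. (cmod (\<eta> k x))\<^sup>2)" by (intro mult_nonneg_nonneg sum_nonneg) auto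
  moreover have "b \<le> 2 * (1 / 2 * (a + b))" if "0 \<le> a" for a b :: real using that by simp
  ultimately have "1 / Lam * tail x \<le> 2 * dens x" unfolding dens_eq by blast
  then show ?thesis using Lam_pos by (simp add: field_simps)
qed

lemma tail_measurable: "tail \<in> borel_measurable \<rho>"
proof (rule borel_measurable_LIMSEQ_metric[of "\<lambda>N x. \<Sum>k\<in>{m..N}. (cmod (e k x))\<^sup>2"])
  show "(\<lambda>x. \<Sum>k\<in>{m..N}. (cmod (e k x))\<^sup>2) \<in> borel_measurable \<rho>" for N
    using m2 by (intro continuous_measurable continuous_intros H_continuous e_mem) auto
qed (simp add: rho_space tail_limit)

lemma dens_measurable: "dens \<in> borel_measurable \<rho>"
proof -
  have "(\<lambda>x. \<Sum>k=1..m-1. (cmod (\<eta> k x))\<^sup>2) \<in> borel_measurable \<rho>"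
    by (intro continuous_measurable continuous_intros H_continuous eta_mem) auto
  then show ?thesis
    using tail_measurable unfolding dens_eq[abs_def]
    by (intro borel_measurable_times borel_measurable_add borel_measurable_const)
qed

lemma integrable_tail: "integrable \<rho> tail"
  and integral_tail: "(\<integral>x. tail x \<partial>\<rho>) = Lam"
proof -
  have tb: "norm (tail x) \<le> B" and sb: "norm (\<Sum>k\<in>{m..N}. (cmod (e k x))\<^sup>2) \<le> B" if x: "x \<in> D" for x N
  proof -
    have *: "(\<Sum>k\<in>{m..N}. (cmod (e k x))\<^sup>2) \<le> B" for N
    proof -
      have "(\<Sum>k\<in>{m..N}. (cmod (e k x))\<^sup>2) \<le> (\<Sum>k\<in>{1..N}. (cmod (e k x))\<^sup>2)"
        using m2 by (intro sum_mono2) auto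
      also have "\<dots> \<le> B" by (rule e_sq_sum_le[OF x])
      finally show ?thesis .
    qed
    have "tail x \<le> B" using * tail_limit[OF x] by (intro LIMSEQ_le_const2) auto
    then show "norm (tail x) \<le> B" using tail_nonneg[OF x] by simp
    show "norm (\<Sum>k\<in>{m..N}. (cmod (e k x))\<^sup>2) \<le> B" using *[of N] by (simp add: sum_nonneg)
  qed
  show int: "integrable \<rho> tail" by (rule integrable_bounded[OF tail_measurable tb])
  have "(\<lambda>N. \<integral>x. (\<Sum>k\<in>{m..N}. (cmod (e k x))\<^sup>2) \<partial>\<rho>) \<longlonglongrightarrow> (\<integral>x. tail x \<partial>\<rho>)"
  proof (rule integral_dominated_convergence[where w = "\<lambda>_. B"])
    show "(\<lambda>x. \<Sum>k\<in>{m..N}. (cmod (e k x))\<^sup>2) \<in> borel_measurable \<rho>" for N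
      using m2 by (intro continuous_measurable continuous_intros H_continuous e_mem) auto
    show "integrable \<rho> (\<lambda>_. B)" by (simp add: finite_measure.integrable_const[OF rho_finite])
  qed (use tail_measurable tail_limit sb in \<open>auto simp: rho_space\<close>)
  moreover have "(\<integral>x. (\<Sum>k\<in>{m..N}. (cmod (e k x))\<^sup>2) \<partial>\<rho>) = sum lam {m..N}" for N
  proof -
    have "(\<integral>x. (\<Sum>k\<in>{m..N}. (cmod (e k x))\<^sup>2) \<partial>\<rho>) = (\<Sum>k\<in>{m..N}. (\<integral>x. (cmod (e k x))\<^sup>2 \<partial>\<rho>))"
      using m2 by (intro Bochner_Integration.integral_sum H_integrable_sq e_mem) auto
    also have "\<dots> = sum lam {m..N}"
      using m2 e_l2 l2_self[OF e_mem] by (intro sum.cong refl) auto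
    finally show ?thesis .
  qed
  ultimately show "(\<integral>x. tail x \<partial>\<rho>) = Lam" using Lam_limit LIMSEQ_unique by simp
qed

lemma M_sets: "sets M = sets \<rho>" and M_space: "space M = D"
  by (simp_all add: sampling_measure_def rho_space)

lemma prob_space_M: "prob_space M"
proof
  have int: "integrable \<rho> (\<lambda>x. \<Sum>k=1..m-1. (cmod (\<eta> k x))\<^sup>2)"
    using H_integrable_sq[OF eta_mem] by (intro Bochner_Integration.integrable_sum) auto
  have "(\<integral>x. (\<Sum>k=1..m-1. (cmod (\<eta> k x))\<^sup>2) \<partial>\<rho>) = (\<Sum>k=1..m-1. (\<integral>x. (cmod (\<eta> k x))\<^sup>2 \<partial>\<rho>))"
    using H_integrable_sq[OF eta_mem] by (intro Bochner_Integration.integral_sum) auto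
  also have "\<dots> = (\<Sum>k=1..m-1. 1)"
    using l2_self[OF eta_mem] eta_l2 by (intro sum.cong refl) (auto simp flip: l2_self[OF eta_mem])
  finally have e1: "(\<integral>x. (\<Sum>k=1..m-1. (cmod (\<eta> k x))\<^sup>2) \<partial>\<rho>) = real (m - 1)" by simp
  have dint: "integrable \<rho> dens"
    unfolding dens_eq[abs_def] using int integrable_tail by (intro integrable_mult_right Bochner_Integration.integrable_add)
  have "(\<integral>x. dens x \<partial>\<rho>) = 1 / 2 * (1 / real (m - 1) * real (m - 1) + 1 / Lam * Lam)"
    unfolding dens_eq[abs_def] using int integrable_tail e1 integral_tail by simp
  also have "\<dots> = 1" using m2 Lam_pos by simp
  finally have d1: "(\<integral>x. dens x \<partial>\<rho>) = 1" .
  have "emeasure M (space M) = (\<integral>\<^sup>+x. ennreal (dens x) \<partial>\<rho>)"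
    unfolding sampling_measure_def using dens_measurable by (subst emeasure_density) (auto intro!: nn_integral_cong)
  also have "\<dots> = ennreal (\<integral>x. dens x \<partial>\<rho>)"
    using dens_nonneg by (intro nn_integral_eq_integral dint AE_I2) (simp add: rho_space)
  finally show "emeasure M (space M) = 1" using d1 by simp
qed

text \<open>The common form of the entries of \<open>ls_matrix\<close> and
  \<open>ls_data\<close>.\<close>

definition wt :: "('a \<Rightarrow> complex) \<Rightarrow> 'a \<Rightarrow> complex" where
  "wt f x = (if dens x \<noteq> 0 then f x / complex_of_real (sqrt (dens x)) else 0)"

lemma wt_measurable: "f \<in> H \<Longrightarrow> wt f \<in> borel_measurable M"
proof -
  assume f: "f \<in> H"
  have [measurable]: "f \<in> borel_measurable \<rho>" "dens \<in> borel_measurable \<rho>" by (rule H_measurable[OF f], rule dens_measurable)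
  have "wt f \<in> borel_measurable \<rho>" unfolding wt_def[abs_def] by measurable
  then show ?thesis by (simp add: measurable_cong_sets[OF M_sets refl])
qed

text \<open>The weight cancels the density in the covariance, so orthogonality in L_2 survives the
  change of measure. The vectors are conjugated because \<open>dot\<close> is conjugate linear in
  its second argument: \<open>dot I z\<close> of such a vector is then the matrix row applied to
  z.\<close>

lemma iid_frame_wt:
  assumes I: "finite I" and u: "\<And>i. i \<in> I \<Longrightarrow> u i \<in> H"
    and ortho: "\<And>i j. i \<in> I \<Longrightarrow> j \<in> I \<Longrightarrow> l2 (u i) (u j) = (if i = j then of_real (w i) else 0)"
    and bound: "\<And>x. x \<in> D \<Longrightarrow> (\<Sum>i\<in>I. (cmod (u i x))\<^sup>2) \<le> R * dens x" and R: "0 \<le> R"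
  shows "iid_frame M I (\<lambda>x i. cnj (wt (u i) x)) R w"
proof -
  interpret prob_space M by (rule prob_space_M)
  have wsq: "(cmod (wt f x))\<^sup>2 = (if dens x \<noteq> 0 then (cmod (f x))\<^sup>2 / dens x else 0)" if "x \<in> D" for f x
    using dens_nonneg[OF that] by (simp add: wt_def norm_divide power_divide)
  \<comment> \<open>Where the density vanishes the functions vanish too, so the default value 0 in
    \<open>wt\<close> loses nothing.\<close>
  have zero: "u i x = 0" if "x \<in> D" "dens x = 0" "i \<in> I" for x i
  proof -
    have "(cmod (u i x))\<^sup>2 \<le> (\<Sum>i\<in>I. (cmod (u i x))\<^sup>2)" using I that by (intro member_le_sum) auto
    also have "\<dots> \<le> 0" using bound[OF that(1)] that(2) by simp
    finally show ?thesis by simp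
  qed
  show ?thesis
  proof unfold_locales
    show "(\<lambda>x. cnj (wt (u i) x)) \<in> borel_measurable M" if "i \<in> I" for i
      by (intro borel_measurable_cnj wt_measurable u that)
    show "Re (dot I (\<lambda>i. cnj (wt (u i) x)) (\<lambda>i. cnj (wt (u i) x))) \<le> R" if x: "x \<in> space M" for x
    proof (cases "dens x = 0")
      case True
      then show ?thesis using R by (simp add: dot_def wt_def)
    next
      case False
      have xD: "x \<in> D" using x by (simp add: M_space)
      then have "dens x > 0" using False dens_nonneg[of x] by simp
      then have "(\<Sum>i\<in>I. (cmod (u i x))\<^sup>2 / dens x) \<le> R"
        using bound[OF xD] by (simp add: sum_divide_distrib[symmetric] field_simps)
      then show ?thesis using False by (simp add: dot_self wsq[OF xD])
    qed
    show "(\<integral>x. cnj (wt (u i) x) * cnj (cnj (wt (u j) x)) \<partial>M) = (if i = j then of_real (w i) else 0)"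
      if ij: "i \<in> I" "j \<in> I" for i j
    proof -
      have meas: "(\<lambda>x. cnj (wt (u i) x) * wt (u j) x) \<in> borel_measurable \<rho>"
        using wt_measurable[OF u] ij by (intro borel_measurable_times borel_measurable_cnj)
          (simp_all add: measurable_cong_sets[OF M_sets refl])
      have "(\<integral>x. cnj (wt (u i) x) * wt (u j) x \<partial>M) = (\<integral>x. dens x *\<^sub>R (cnj (wt (u i) x) * wt (u j) x) \<partial>\<rho>)"
        unfolding sampling_measure_def
        using dens_nonneg by (intro integral_density meas dens_measurable AE_I2) (simp add: rho_space)
      also have "\<dots> = (\<integral>x. u j x * cnj (u i x) \<partial>\<rho>)"
      proof (rule Bochner_Integration.integral_cong[OF refl])
        fix x assume "x \<in> space \<rho>"
        then have x: "x \<in> D" by (simp add: rho_space)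
        have "complex_of_real (sqrt (dens x)) * complex_of_real (sqrt (dens x)) = of_real (dens x)"
          using dens_nonneg[OF x] by (metis of_real_mult real_sqrt_mult_self abs_of_nonneg)
        then show "dens x *\<^sub>R (cnj (wt (u i) x) * wt (u j) x) = u j x * cnj (u i x)"
          using zero[OF x _ ij(1)] by (simp add: wt_def scaleR_conv_of_real)
      qed
      also have "\<dots> = l2 (u j) (u i)" by (simp add: l2_inner_def)
      finally show ?thesis using ortho ij by auto
    qed
  qed (use I in auto)
qed

text \<open>The index i stands for the function number i + 1, as in the columns of
  \<open>ls_matrix\<close>.\<close>

lemma lower_frame: "iid_frame M {..<m - 1} (\<lambda>x i. cnj (wt (\<eta> (Suc i)) x)) (2 * real (m - 1)) (\<lambda>_. 1)"
proof (rule iid_frame_wt)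
  show "(\<Sum>i<m - 1. (cmod (\<eta> (Suc i) x))\<^sup>2) \<le> 2 * real (m - 1) * dens x" if "x \<in> D" for x
    using eta_sum_le_dens[OF that] by (simp add: sum.atLeast1_atMost_eq)
qed (auto simp: eta_mem eta_l2)

lemma upper_frame: "iid_frame M {m..N} (\<lambda>x k. cnj (wt (e k) x)) (2 * Lam) lam"
proof (rule iid_frame_wt)
  show "(\<Sum>k\<in>{m..N}. (cmod (e k x))\<^sup>2) \<le> 2 * Lam * dens x" if "x \<in> D" for x
    using sum_le_tail[OF that] tail_le_dens[OF that] by (rule order_trans)
qed (use m2 Lam_pos in \<open>auto simp: e_mem e_l2\<close>)

end

section \<open>The worst case error\<close>

context sampling begin

abbreviation L :: "nat \<Rightarrow> (nat \<Rightarrow> 'a) \<Rightarrow> complex Matrix.mat" where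
  "L n X \<equiv> ls_matrix lam e m n X"
abbreviation data :: "nat \<Rightarrow> (nat \<Rightarrow> 'a) \<Rightarrow> ('a \<Rightarrow> complex) \<Rightarrow> complex Matrix.vec" where
  "data n X f \<equiv> ls_data lam e m n X f"
abbreviation S :: "nat \<Rightarrow> (nat \<Rightarrow> 'a) \<Rightarrow> ('a \<Rightarrow> complex) \<Rightarrow> 'a \<Rightarrow> complex" where
  "S n X f \<equiv> ls_operator lam e m n X f"

lemma L_carrier: "L n X \<in> carrier_mat n (m - 1)"
  by (simp add: ls_matrix_def)

lemma L_index: "j < n \<Longrightarrow> i < m - 1 \<Longrightarrow> L n X $$ (j, i) = wt (\<eta> (Suc i)) (X j)"
  by (simp add: ls_matrix_def wt_def)

lemma data_carrier: "data n X f \<in> carrier_vec n"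
  by (simp add: ls_data_def)

lemma data_index: "j < n \<Longrightarrow> vec_index (data n X f) j = wt f (X j)"
  by (simp add: ls_data_def wt_def)

lemma S_apply: "S n X f x = (\<Sum>i<m - 1. vec_index (lsq (L n X) (data n X f)) i * \<eta> (Suc i) x)"
  by (simp add: ls_operator_def ls_coeffs_def lsq_def gram_def Let_def sum.atLeast1_atMost_eq)

lemma L_mult_vec:
  "v \<in> carrier_vec (m - 1) \<Longrightarrow> j < n \<Longrightarrow>
    vec_index (L n X *\<^sub>v v) j = dot {..<m - 1} (vec_index v) (\<lambda>i. cnj (wt (\<eta> (Suc i)) (X j)))"
  by (simp add: index_mult_mat_vec_sum[OF L_carrier] L_index dot_def mult.commute)

text \<open>For fixed nodes and fixed x the reconstruction is a linear functional of the samples;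
  these are its coefficients.\<close>

definition S_weight :: "nat \<Rightarrow> (nat \<Rightarrow> 'a) \<Rightarrow> 'a \<Rightarrow> nat \<Rightarrow> complex" where
  "S_weight n X x j = (\<Sum>i<m - 1. lsq_weight (L n X) i j * \<eta> (Suc i) x)"

lemma S_weight_eq:
  assumes "full_column_rank (L n X)"
  shows "S n X f x = (\<Sum>j<n. S_weight n X x j * wt f (X j))"
proof -
  have "S n X f x = (\<Sum>i<m - 1. \<Sum>j<n. lsq_weight (L n X) i j * \<eta> (Suc i) x * wt f (X j))"
    unfolding S_apply
    by (intro sum.cong refl)
      (simp add: lsq_index[OF L_carrier assms data_carrier] data_index sum_distrib_left sum_distrib_right mult_ac)
  also have "\<dots> = (\<Sum>j<n. \<Sum>i<m - 1. lsq_weight (L n X) i j * \<eta> (Suc i) x * wt f (X j))" by (rule sum.swap)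
  finally show ?thesis by (simp add: S_weight_def sum_distrib_right)
qed

lemma wt_add: "wt (f + g) x = wt f x + wt g x"
  by (simp add: wt_def plus_fun_apply add_divide_distrib)

lemma wt_sum: "wt (\<lambda>y. \<Sum>k\<in>A. c k * f k y) x = (\<Sum>k\<in>A. c k * wt (f k) x)"
  by (simp add: wt_def sum_divide_distrib)

lemma wt_tendsto: "(\<lambda>N. F N x) \<longlonglongrightarrow> f x \<Longrightarrow> (\<lambda>N. wt (F N) x) \<longlonglongrightarrow> wt f x"
  by (auto simp: wt_def intro!: tendsto_intros)

lemma S_add:
  "full_column_rank (L n X) \<Longrightarrow> S n X (f + g) x = S n X f x + S n X g x"
  by (simp add: S_weight_eq wt_add algebra_simps sum.distrib)

lemma S_partial:
  assumes r: "full_column_rank (L n X)"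
  shows "S n X (partial f (m - 1)) x = partial f (m - 1) x"
proof -
  \<comment> \<open>Coefficients with respect to the L_2-normalized functions: e_k is the singular
    number times \<eta>_k.\<close>
  define a where "a = Matrix.vec (m - 1) (\<lambda>i. ip f (e (Suc i)) * of_real (singular_number lam (Suc i)))"
  have a: "a \<in> carrier_vec (m - 1)" by (simp add: a_def)
  have p: "partial f (m - 1) y = (\<Sum>i<m - 1. vec_index a i * \<eta> (Suc i) y)" for y
    unfolding partial_apply by (simp add: sum.atLeast1_atMost_eq a_def e_eta mult.assoc)
  have "data n X (partial f (m - 1)) = L n X *\<^sub>v a"
  proof (rule eq_vecI)
    fix j assume "j < dim_vec (L n X *\<^sub>v a)"
    then have j: "j < n" using L_carrier[of n X] by simp
    have "wt (partial f (m - 1)) (X j) = wt (\<lambda>y. \<Sum>i<m - 1. vec_index a i * \<eta> (Suc i) y) (X j)"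
      by (simp only: wt_def p)
    then show "vec_index (data n X (partial f (m - 1))) j = vec_index (L n X *\<^sub>v a) j"
      by (simp add: data_index[OF j] L_mult_vec[OF a j] wt_sum dot_def)
  qed (use L_carrier[of n X] data_carrier[of n X] in simp)
  then have "lsq (L n X) (data n X (partial f (m - 1))) = a"
    using lsq_exact[OF L_carrier r a] by simp
  then show ?thesis unfolding S_apply p by simp
qed

lemma coeff_tail_le:
  assumes f: "f \<in> H" "hnorm ip f \<le> 1" shows "(\<Sum>k\<in>{m..N}. (cmod (ip f (e k)))\<^sup>2) \<le> 1"
proof -
  have "(\<Sum>k\<in>{m..N}. (cmod (ip f (e k)))\<^sup>2) \<le> (\<Sum>k\<in>{1..N}. (cmod (ip f (e k)))\<^sup>2)"
    using m2 by (intro sum_mono2) auto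
  also have "\<dots> \<le> (hnorm ip f)\<^sup>2" using bessel[OF f(1)] by (simp add: hnorm_sq[OF f(1)])
  also have "\<dots> \<le> 1" using f hnorm_nonneg by (simp add: power_le_one)
  finally show ?thesis .
qed

lemma remainder_limit:
  assumes f: "f \<in> H" and x: "x \<in> D"
  shows "(\<lambda>N. \<Sum>k\<in>{m..N}. ip f (e k) * e k x) \<longlonglongrightarrow> (f - partial f (m - 1)) x"
proof -
  have "\<forall>\<^sub>F N in sequentially. (\<Sum>k\<in>{1..N}. ip f (e k) * e k x) - partial f (m - 1) x = (\<Sum>k\<in>{m..N}. ip f (e k) * e k x)"
    using eventually_ge_at_top[of m]
  proof eventually_elim
    case (elim N)
    have "{1..N} = {1..m - 1} \<union> {m..N}" using m2 elim by auto
    then have "(\<Sum>k\<in>{1..N}. ip f (e k) * e k x) = (\<Sum>k\<in>{1..m - 1}. ip f (e k) * e k x) + (\<Sum>k\<in>{m..N}. ip f (e k) * e k x)"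
      by (simp add: sum.union_disjoint[symmetric])
    then show ?case by (simp add: partial_apply)
  qed
  moreover have "(\<lambda>N. (\<Sum>k\<in>{1..N}. ip f (e k) * e k x) - partial f (m - 1) x) \<longlonglongrightarrow> f x - partial f (m - 1) x"
    by (intro tendsto_intros eval_expansion f x)
  ultimately show ?thesis unfolding minus_apply by (rule Lim_transform_eventually[rotated])
qed

lemma remainder_bound:
  assumes f: "f \<in> H" "hnorm ip f \<le> 1" and x: "x \<in> D"
  shows "(cmod ((f - partial f (m - 1)) x))\<^sup>2 \<le> tail x"
proof (rule LIMSEQ_le_const2)
  show "(\<lambda>N. (cmod (\<Sum>k\<in>{m..N}. ip f (e k) * e k x))\<^sup>2) \<longlonglongrightarrow> (cmod ((f - partial f (m - 1)) x))\<^sup>2"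
    by (intro tendsto_intros remainder_limit f x)
  have "(cmod (\<Sum>k\<in>{m..N}. ip f (e k) * e k x))\<^sup>2 \<le> tail x" for N
  proof -
    have "(cmod (dot {m..N} (\<lambda>k. ip f (e k)) (\<lambda>k. cnj (e k x))))\<^sup>2
        \<le> (\<Sum>k\<in>{m..N}. (cmod (ip f (e k)))\<^sup>2) * (\<Sum>k\<in>{m..N}. (cmod (e k x))\<^sup>2)"
      using dot_cauchy_schwarz[of "{m..N}" "\<lambda>k. ip f (e k)" "\<lambda>k. cnj (e k x)"] by (simp add: dot_self)
    also have "\<dots> \<le> 1 * tail x"
      by (intro mult_mono coeff_tail_le f sum_le_tail x) (auto intro: sum_nonneg)
    finally show ?thesis by (simp add: dot_def)
  qed
  then show "\<exists>N0. \<forall>N\<ge>N0. (cmod (\<Sum>k\<in>{m..N}. ip f (e k) * e k x))\<^sup>2 \<le> tail x" by blast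
qed

text \<open>The remainder is the limit of its truncations at the finitely many nodes. If its data
  exceeded c, so would those of all late truncations, against the frame bound at one of the
  infinitely many good N; the coefficients have norm at most 1 by Bessel.\<close>

lemma remainder_data_bound:
  assumes X: "\<And>j. j < n \<Longrightarrow> X j \<in> D" and f: "f \<in> H" "hnorm ip f \<le> 1" and c: "0 \<le> c"
    and up: "\<exists>\<^sub>F N in sequentially. \<forall>z. (\<Sum>j<n. (cmod (dot {m..N} z (\<lambda>k. cnj (wt (e k) (X j)))))\<^sup>2) \<le> c * Re (dot {m..N} z z)"
  shows "(\<Sum>j<n. (cmod (wt (f - partial f (m - 1)) (X j)))\<^sup>2) \<le> c"
proof (rule ccontr)
  let ?Q = "\<lambda>N. \<Sum>j<n. (cmod (dot {m..N} (\<lambda>k. ip f (e k)) (\<lambda>k. cnj (wt (e k) (X j)))))\<^sup>2"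
  assume "\<not> ?thesis"
  moreover have "?Q \<longlonglongrightarrow> (\<Sum>j<n. (cmod (wt (f - partial f (m - 1)) (X j)))\<^sup>2)"
  proof (intro tendsto_intros)
    fix j assume "j \<in> {..<n}"
    then have "(\<lambda>N. wt (\<lambda>x. \<Sum>k\<in>{m..N}. ip f (e k) * e k x) (X j)) \<longlonglongrightarrow> wt (f - partial f (m - 1)) (X j)"
      by (intro wt_tendsto remainder_limit f X) simp
    then show "(\<lambda>N. dot {m..N} (\<lambda>k. ip f (e k)) (\<lambda>k. cnj (wt (e k) (X j)))) \<longlonglongrightarrow> wt (f - partial f (m - 1)) (X j)"
      by (simp add: dot_def wt_sum)
  qed
  ultimately have "\<forall>\<^sub>F N in sequentially. c < ?Q N" by (intro order_tendstoD(1)) auto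
  with up have "\<exists>\<^sub>F N in sequentially. False"
  proof (rule frequently_rev_mp[OF _ eventually_mono])
    fix N assume 1: "c < ?Q N"
    show "(\<forall>z. (\<Sum>j<n. (cmod (dot {m..N} z (\<lambda>k. cnj (wt (e k) (X j)))))\<^sup>2) \<le> c * Re (dot {m..N} z z)) \<longrightarrow> False"
    proof
      assume "\<forall>z. (\<Sum>j<n. (cmod (dot {m..N} z (\<lambda>k. cnj (wt (e k) (X j)))))\<^sup>2) \<le> c * Re (dot {m..N} z z)"
      then have "?Q N \<le> c * Re (dot {m..N} (\<lambda>k. ip f (e k)) (\<lambda>k. ip f (e k)))" by blast
      also have "\<dots> \<le> c * 1"
        using coeff_tail_le[OF f] c by (intro mult_left_mono) (auto simp: dot_self)
      finally show False using 1 by simp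
    qed
  qed
  then show False by simp
qed

lemma full_rank_if_lower:
  assumes n: "n \<ge> 1"
    and low: "\<And>z. n / 4 * Re (dot {..<m - 1} z z) \<le> (\<Sum>j<n. (cmod (dot {..<m - 1} z (\<lambda>i. cnj (wt (\<eta> (Suc i)) (X j)))))\<^sup>2)"
  shows "full_column_rank (L n X)"
  unfolding full_column_rank_iff[OF L_carrier]
proof (intro ballI impI)
  fix v assume v: "v \<in> carrier_vec (m - 1)" and z: "L n X *\<^sub>v v = 0\<^sub>v n"
  have "(\<Sum>j<n. (cmod (dot {..<m - 1} (vec_index v) (\<lambda>i. cnj (wt (\<eta> (Suc i)) (X j)))))\<^sup>2) = 0"
  proof (intro sum.neutral ballI)
    fix j assume "j \<in> {..<n}"
    then have "dot {..<m - 1} (vec_index v) (\<lambda>i. cnj (wt (\<eta> (Suc i)) (X j))) = vec_index (L n X *\<^sub>v v) j"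
      using L_mult_vec[OF v] by simp
    then show "(cmod (dot {..<m - 1} (vec_index v) (\<lambda>i. cnj (wt (\<eta> (Suc i)) (X j)))))\<^sup>2 = 0"
      unfolding z using \<open>j \<in> {..<n}\<close> by simp
  qed
  with low[of "vec_index v"] have "real n / 4 * (\<Sum>i<m - 1. (cmod (vec_index v i))\<^sup>2) \<le> 0" by (simp add: dot_self)
  then have "(\<Sum>i<m - 1. (cmod (vec_index v i))\<^sup>2) \<le> 0" using n by (simp add: mult_le_0_iff)
  then have "(\<Sum>i<m - 1. (cmod (vec_index v i))\<^sup>2) = 0" by (intro antisym sum_nonneg) auto
  then have "\<forall>i\<in>{..<m - 1}. (cmod (vec_index v i))\<^sup>2 = 0" by (subst (asm) sum_nonneg_eq_0_iff) auto
  then show "v = 0\<^sub>v (m - 1)" using v by (intro eq_vecI) auto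
qed

text \<open>With g the remainder and b the coefficients fitted to it, n / 4 |b|^2 \<le> |L b|^2
  \<le> |data of g|^2 \<le> c. At x the fitted function is at most |b| times the norm of the basis
  values; squaring the sum of the two errors doubles each term, whence 2 and 8.\<close>

lemma pointwise_error:
  assumes n: "n \<ge> 1" and X: "\<And>j. j < n \<Longrightarrow> X j \<in> D" and c: "0 \<le> c"
    and low: "\<And>z. n / 4 * Re (dot {..<m - 1} z z) \<le> (\<Sum>j<n. (cmod (dot {..<m - 1} z (\<lambda>i. cnj (wt (\<eta> (Suc i)) (X j)))))\<^sup>2)"
    and up: "\<exists>\<^sub>F N in sequentially. \<forall>z. (\<Sum>j<n. (cmod (dot {m..N} z (\<lambda>k. cnj (wt (e k) (X j)))))\<^sup>2) \<le> c * Re (dot {m..N} z z)"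
    and f: "f \<in> H" "hnorm ip f \<le> 1" and x: "x \<in> D"
  shows "(cmod (f x - S n X f x))\<^sup>2 \<le> 2 * tail x + 8 * c / n * (\<Sum>k=1..m-1. (cmod (\<eta> k x))\<^sup>2)"
proof -
  have r: "full_column_rank (L n X)" by (rule full_rank_if_lower[OF n low])
  let ?g = "f - partial f (m - 1)"
  define b where "b = lsq (L n X) (data n X ?g)"
  have b: "b \<in> carrier_vec (m - 1)" unfolding b_def by (rule lsq_carrier[OF L_carrier r data_carrier])
  have "S n X f x = S n X (?g + partial f (m - 1)) x" by simp
  also have "\<dots> = S n X ?g x + partial f (m - 1) x" by (simp only: S_add[OF r] S_partial[OF r])
  finally have err: "f x - S n X f x = ?g x - S n X ?g x" by (simp add: minus_apply)
  have "real n / 4 * (\<Sum>i<m - 1. (cmod (vec_index b i))\<^sup>2) \<le> (\<Sum>j<n. (cmod (vec_index (L n X *\<^sub>v b) j))\<^sup>2)"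
    using low[of "vec_index b"] by (simp add: dot_self L_mult_vec[OF b])
  also have "\<dots> \<le> (\<Sum>j<n. (cmod (vec_index (data n X ?g) j))\<^sup>2)"
    unfolding b_def by (rule lsq_residual_norm[OF L_carrier r data_carrier])
  also have "\<dots> = (\<Sum>j<n. (cmod (wt ?g (X j)))\<^sup>2)" by (simp add: data_index)
  also have "\<dots> \<le> c" by (rule remainder_data_bound[OF X f c up])
  finally have bn: "(\<Sum>i<m - 1. (cmod (vec_index b i))\<^sup>2) \<le> 4 * c / n" using n by (simp add: field_simps)
  have "(cmod (S n X ?g x))\<^sup>2 = (cmod (dot {..<m - 1} (vec_index b) (\<lambda>i. cnj (\<eta> (Suc i) x))))\<^sup>2"
    unfolding S_apply b_def dot_def by simp
  also have "\<dots> \<le> (\<Sum>i<m - 1. (cmod (vec_index b i))\<^sup>2) * (\<Sum>i<m - 1. (cmod (\<eta> (Suc i) x))\<^sup>2)"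
    using dot_cauchy_schwarz[of "{..<m - 1}" "vec_index b" "\<lambda>i. cnj (\<eta> (Suc i) x)"] by (simp add: dot_self)
  also have "\<dots> \<le> 4 * c / n * (\<Sum>i<m - 1. (cmod (\<eta> (Suc i) x))\<^sup>2)"
    by (intro mult_right_mono bn sum_nonneg) auto
  also have "(\<Sum>i<m - 1. (cmod (\<eta> (Suc i) x))\<^sup>2) = (\<Sum>k=1..m-1. (cmod (\<eta> k x))\<^sup>2)"
    by (simp add: sum.atLeast1_atMost_eq)
  finally have 2: "(cmod (S n X ?g x))\<^sup>2 \<le> 4 * c / n * (\<Sum>k=1..m-1. (cmod (\<eta> k x))\<^sup>2)" .
  have "(cmod (?g x - S n X ?g x))\<^sup>2 \<le> (cmod (?g x) + cmod (S n X ?g x))\<^sup>2"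
    by (intro power_mono norm_triangle_ineq4) auto
  also have "\<dots> \<le> 2 * (cmod (?g x))\<^sup>2 + 2 * (cmod (S n X ?g x))\<^sup>2"
    using zero_le_power2[of "cmod (?g x) - cmod (S n X ?g x)"] by (simp add: power2_sum power2_diff)
  finally show ?thesis unfolding err using 2 remainder_bound[OF f x] by simp
qed

section \<open>Measurability of the success event\<close>

lemma worst_case_le_iff:
  "worst_case_sq_error D H ip T \<le> b \<longleftrightarrow>
     (\<forall>f\<in>H. hnorm ip f \<le> 1 \<longrightarrow> (\<forall>x\<in>D. ennreal ((cmod (f x - T f x))\<^sup>2) \<le> b))"
proof -
  have "(sup_norm D g)\<^sup>2 \<le> b \<longleftrightarrow> (\<forall>x\<in>D. ennreal ((cmod (g x))\<^sup>2) \<le> b)" for g :: "'a \<Rightarrow> complex"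
  proof
    assume b: "(sup_norm D g)\<^sup>2 \<le> b"
    show "\<forall>x\<in>D. ennreal ((cmod (g x))\<^sup>2) \<le> b"
    proof
      fix x assume "x \<in> D"
      then have "ennreal (cmod (g x)) \<le> sup_norm D g" unfolding sup_norm_def by (rule SUP_upper)
      then have "(ennreal (cmod (g x)))\<^sup>2 \<le> (sup_norm D g)\<^sup>2" by (rule power_mono) simp
      then show "ennreal ((cmod (g x))\<^sup>2) \<le> b" using b by (simp add: ennreal_power)
    qed
  next
    assume b: "\<forall>x\<in>D. ennreal ((cmod (g x))\<^sup>2) \<le> b"
    show "(sup_norm D g)\<^sup>2 \<le> b"
    proof (cases b)
      case (real \<beta>)
      have "sup_norm D g \<le> ennreal (sqrt \<beta>)"
        unfolding sup_norm_def
      proof (rule SUP_least)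
        fix x assume "x \<in> D"
        then have "(cmod (g x))\<^sup>2 \<le> \<beta>" using b real by (simp add: ennreal_le_iff)
        then show "ennreal (cmod (g x)) \<le> ennreal (sqrt \<beta>)" by (intro ennreal_leI real_le_rsqrt)
      qed
      then have "(sup_norm D g)\<^sup>2 \<le> (ennreal (sqrt \<beta>))\<^sup>2" by (rule power_mono) simp
      also have "\<dots> = b" using real by (simp add: ennreal_power)
      finally show ?thesis .
    qed simp
  qed
  then show ?thesis
    unfolding worst_case_sq_error_def SUP_le_iff by (simp add: minus_apply) blast
qed

text \<open>At a fixed x the supremum over the unit ball is the squared norm of the error
  functional, which is the sum of its squared values at the orthonormal basis. The error of each f
  is continuous in x, so a dense T suffices. The result is a countable family of conditions.\<close>

lemma error_ball_iff:
  assumes r: "full_column_rank (L n X)" and X: "\<And>j. j < n \<Longrightarrow> X j \<in> D"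
    and T: "T \<subseteq> D" "D \<subseteq> closure T"
  shows "(\<forall>f\<in>H. hnorm ip f \<le> 1 \<longrightarrow> (\<forall>x\<in>D. ennreal ((cmod (f x - S n X f x))\<^sup>2) \<le> b)) \<longleftrightarrow>
    (\<forall>x\<in>T. \<forall>N. ennreal (\<Sum>k\<in>{1..N}. (cmod (e k x - (\<Sum>j<n. S_weight n X x j * wt (e k) (X j))))\<^sup>2) \<le> b)"
    (is "?lhs \<longleftrightarrow> ?rhs")
proof (cases b)
  case (real \<beta>)
  define \<delta> where "\<delta> x f = f x - (\<Sum>j<n. S_weight n X x j * wt f (X j))" for x f
  have \<delta>: "f x - S n X f x = \<delta> x f" for f x unfolding \<delta>_def S_weight_eq[OF r] ..
  have \<delta>_sum: "\<delta> x (\<lambda>y. \<Sum>k\<in>A. a k * e k y) = (\<Sum>k\<in>A. a k * \<delta> x (e k))" for x a and A :: "nat set"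
  proof -
    have "(\<Sum>j<n. S_weight n X x j * (\<Sum>k\<in>A. a k * wt (e k) (X j)))
        = (\<Sum>k\<in>A. a k * (\<Sum>j<n. S_weight n X x j * wt (e k) (X j)))"
      unfolding sum_distrib_left by (subst sum.swap) (simp add: mult_ac)
    then show ?thesis
      unfolding \<delta>_def wt_sum right_diff_distrib sum_subtractf by simp
  qed
  have le: "ennreal t \<le> b \<longleftrightarrow> t \<le> \<beta>" if "0 \<le> t" for t using real by (simp add: ennreal_le_iff)
  show ?thesis
    unfolding \<delta> \<delta>_def[symmetric]
  proof
    assume A: "\<forall>f\<in>H. hnorm ip f \<le> 1 \<longrightarrow> (\<forall>x\<in>D. ennreal ((cmod (\<delta> x f))\<^sup>2) \<le> b)"
    show "\<forall>x\<in>T. \<forall>N. ennreal (\<Sum>k\<in>{1..N}. (cmod (\<delta> x (e k)))\<^sup>2) \<le> b"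
    proof (intro ballI allI)
      fix x N assume x: "x \<in> T"
      define t where "t = (\<Sum>k\<in>{1..N}. (cmod (\<delta> x (e k)))\<^sup>2)"
      have t0: "0 \<le> t" unfolding t_def by (intro sum_nonneg) auto
      show "ennreal (\<Sum>k\<in>{1..N}. (cmod (\<delta> x (e k)))\<^sup>2) \<le> b"
      proof (cases "t = 0")
        case True
        then show ?thesis unfolding t_def by simp
      next
        case False
        then have tp: "t > 0" using t0 by simp
        \<comment> \<open>The extremal function of the functional restricted to the first N basis
          functions: unit norm, and its error at x is sqrt t.\<close>
        define a where "a k = cnj (\<delta> x (e k)) / of_real (sqrt t)" for k
        define f where "f = (\<Sum>k\<in>{1..N}. cscale (a k) (e k))"
        have fH: "f \<in> H" unfolding f_def by (intro form.sum_mem form.scale_mem e_mem) auto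
        have fe: "ip f (e k) = a k" if "k \<in> {1..N}" for k
        proof -
          have "ip f (e k) = (\<Sum>l\<in>{1..N}. a l * (if l = k then 1 else 0))"
            unfolding f_def using that
            by (subst form.sum_left) (auto simp: form.scale_mem e_mem ip_scale e_ortho)
          also have "\<dots> = (\<Sum>l\<in>{1..N}. if l = k then a k else 0)" by (intro sum.cong) auto
          finally show ?thesis using that by simp
        qed
        have "ip f f = (\<Sum>k\<in>{1..N}. cnj (a k) * ip f (e k))"
          by (subst (2) f_def, subst form.sum_right) (auto simp: form.scale_mem e_mem form.scale_right fH)
        also have "\<dots> = (\<Sum>k\<in>{1..N}. of_real ((cmod (a k))\<^sup>2))"
          by (intro sum.cong refl) (simp add: fe complex_norm_square mult.commute del: of_real_power)
        also have "\<dots> = of_real (\<Sum>k\<in>{1..N}. (cmod (\<delta> x (e k)))\<^sup>2 / t)"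
          unfolding a_def using tp by (simp add: norm_divide power_divide)
        also have "\<dots> = 1" unfolding sum_divide_distrib[symmetric] t_def[symmetric] using tp by simp
        finally have "hnorm ip f \<le> 1" by (simp add: hnorm_def)
        then have "ennreal ((cmod (\<delta> x f))\<^sup>2) \<le> b" using A fH x T by blast
        moreover have "\<delta> x f = of_real (sqrt t)"
        proof -
          have "f = (\<lambda>y. \<Sum>k\<in>{1..N}. a k * e k y)" by (simp add: f_def fun_eq_iff sum_fun_apply cscale_def)
          then have "\<delta> x f = (\<Sum>k\<in>{1..N}. a k * \<delta> x (e k))" by (simp only: \<delta>_sum)
          also have "\<dots> = (\<Sum>k\<in>{1..N}. of_real ((cmod (\<delta> x (e k)))\<^sup>2 / sqrt t))"
            unfolding a_def by (intro sum.cong refl) (simp add: complex_norm_square mult.commute del: of_real_power)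
          also have "\<dots> = of_real (t / sqrt t)" by (simp only: of_real_sum[symmetric] sum_divide_distrib[symmetric] t_def)
          also have "t / sqrt t = sqrt t" using tp by (simp add: real_div_sqrt)
          finally show ?thesis .
        qed
        ultimately show ?thesis using t0 unfolding t_def[symmetric] by simp
      qed
    qed
  next
    assume A: "\<forall>x\<in>T. \<forall>N. ennreal (\<Sum>k\<in>{1..N}. (cmod (\<delta> x (e k)))\<^sup>2) \<le> b"
    show "\<forall>f\<in>H. hnorm ip f \<le> 1 \<longrightarrow> (\<forall>x\<in>D. ennreal ((cmod (\<delta> x f))\<^sup>2) \<le> b)"
    proof (intro ballI impI)
      fix f x assume f: "f \<in> H" "hnorm ip f \<le> 1" and x: "x \<in> D"
      have onT: "(cmod (\<delta> y f))\<^sup>2 \<le> \<beta>" if y: "y \<in> T" for y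
      proof (rule LIMSEQ_le_const2)
        have yD: "y \<in> D" using y T by blast
        have "(\<lambda>N. \<delta> y (\<lambda>z. \<Sum>k\<in>{1..N}. ip f (e k) * e k z)) \<longlonglongrightarrow> \<delta> y f"
          unfolding \<delta>_def
          by (intro tendsto_intros eval_expansion[OF f(1)] yD wt_tendsto X) auto
        then show "(\<lambda>N. (cmod (\<Sum>k\<in>{1..N}. ip f (e k) * \<delta> y (e k)))\<^sup>2) \<longlonglongrightarrow> (cmod (\<delta> y f))\<^sup>2"
          unfolding \<delta>_sum by (intro tendsto_intros)
        have "(cmod (\<Sum>k\<in>{1..N}. ip f (e k) * \<delta> y (e k)))\<^sup>2 \<le> \<beta>" for N
        proof -
          have "(cmod (dot {1..N} (\<lambda>k. ip f (e k)) (\<lambda>k. cnj (\<delta> y (e k)))))\<^sup>2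
              \<le> (\<Sum>k\<in>{1..N}. (cmod (ip f (e k)))\<^sup>2) * (\<Sum>k\<in>{1..N}. (cmod (\<delta> y (e k)))\<^sup>2)"
            using dot_cauchy_schwarz[of "{1..N}" "\<lambda>k. ip f (e k)" "\<lambda>k. cnj (\<delta> y (e k))"] by (simp add: dot_self)
          also have "\<dots> \<le> 1 * \<beta>"
          proof (rule mult_mono)
            have "(\<Sum>k\<in>{1..N}. (cmod (ip f (e k)))\<^sup>2) \<le> (hnorm ip f)\<^sup>2"
              using bessel[OF f(1)] by (simp add: hnorm_sq[OF f(1)])
            also have "\<dots> \<le> 1" using f hnorm_nonneg by (simp add: power_le_one)
            finally show "(\<Sum>k\<in>{1..N}. (cmod (ip f (e k)))\<^sup>2) \<le> 1" .
            show "(\<Sum>k\<in>{1..N}. (cmod (\<delta> y (e k)))\<^sup>2) \<le> \<beta>"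
              using A[rule_format, OF y, of N] by (subst (asm) le) (auto intro: sum_nonneg)
          qed (auto intro: sum_nonneg)
          finally show ?thesis by (simp add: dot_def)
        qed
        then show "\<exists>N0. \<forall>N\<ge>N0. (cmod (\<Sum>k\<in>{1..N}. ip f (e k) * \<delta> y (e k)))\<^sup>2 \<le> \<beta>" by blast
      qed
      have "continuous_on D (\<lambda>y. \<delta> y f)"
        unfolding \<delta>_def S_weight_def
        by (intro continuous_intros H_continuous[OF f(1)] H_continuous[OF eta_mem]) auto
      obtain y where y: "\<And>i. y i \<in> T" "y \<longlonglongrightarrow> x"
        using x T closure_sequential[of x T] by blast
      have "y i \<in> D" for i using y(1) T by blast
      then have "(\<lambda>i. \<delta> (y i) f) \<longlonglongrightarrow> \<delta> x f"
        using y x by (intro continuous_on_tendsto_compose[OF \<open>continuous_on D (\<lambda>y. \<delta> y f)\<close>]) auto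
      then have "(\<lambda>i. (cmod (\<delta> (y i) f))\<^sup>2) \<longlonglongrightarrow> (cmod (\<delta> x f))\<^sup>2" by (intro tendsto_intros)
      then have "(cmod (\<delta> x f))\<^sup>2 \<le> \<beta>" using onT y by (intro LIMSEQ_le_const2) auto
      then show "ennreal ((cmod (\<delta> x f))\<^sup>2) \<le> b" by (simp add: le)
    qed
  qed
qed simp

text \<open>Without measurability the event would be assigned measure 0, and containing a large good
  event would say nothing about it.\<close>

lemma event_measurable:
  "{X \<in> space (Pi\<^sub>M {..<n} (\<lambda>_. M)). full_column_rank (L n X) \<and> worst_case_sq_error D H ip (S n X) \<le> b}
    \<in> sets (Pi\<^sub>M {..<n} (\<lambda>_. M))" (is "?E \<in> sets ?P")
proof -
  obtain T where T: "countable T" "T \<subseteq> D" "D \<subseteq> closure T" by (rule separable)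
  have XD: "X j \<in> D" if "X \<in> space ?P" "j < n" for X j using that by (auto simp: space_PiM M_space)
  have wtm: "(\<lambda>X. wt f (X j)) \<in> borel_measurable ?P" if "f \<in> H" "j < n" for f j
    by (rule measurable_compose[OF _ wt_measurable[OF that(1)]])
      (use that in \<open>auto intro: measurable_component_singleton\<close>)
  have Lm: "(\<lambda>X. L n X $$ (j, i)) \<in> borel_measurable ?P" if "j < n" "i < m - 1" for i j
    using that by (simp add: L_index wtm eta_mem)
  have wm: "(\<lambda>X. S_weight n X x j) \<in> borel_measurable ?P" if "j < n" for x j
    unfolding S_weight_def
    by (intro borel_measurable_sum borel_measurable_times borel_measurable_const measurable_lsq_weight[OF L_carrier Lm])
      (use that in auto)
  define Q where "Q x N X = (\<Sum>k\<in>{1..N}. (cmod (e k x - (\<Sum>j<n. S_weight n X x j * wt (e k) (X j))))\<^sup>2)" for x N X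
  have Qm: "Q x N \<in> borel_measurable ?P" for x N
    unfolding Q_def[abs_def]
    by (intro borel_measurable_sum borel_measurable_power measurable_compose[OF _ borel_measurable_norm] borel_measurable_diff
      borel_measurable_const borel_measurable_times wm wtm e_mem) auto
  have "?E = {X \<in> space ?P. full_column_rank (L n X)} \<inter> {X \<in> space ?P. \<forall>x\<in>T. \<forall>N. ennreal (Q x N X) \<le> b}"
  proof -
    have "worst_case_sq_error D H ip (S n X) \<le> b \<longleftrightarrow> (\<forall>x\<in>T. \<forall>N. ennreal (Q x N X) \<le> b)"
      if "full_column_rank (L n X)" "X \<in> space ?P" for X
      unfolding worst_case_le_iff Q_def
      by (rule error_ball_iff[OF that(1) _ T(2,3)]) (rule XD[OF that(2)])
    then show ?thesis by blast
  qed
  moreover have "{X \<in> space ?P. \<forall>x\<in>T. \<forall>N. ennreal (Q x N X) \<le> b} \<in> sets ?P"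
  \<comment> \<open>A countable intersection needs a nonempty index set; for empty T the condition
    is void.\<close>
  proof (cases "T = {}")
    case False
    have m: "{X \<in> space ?P. \<forall>N. ennreal (Q x N X) \<le> b} \<in> sets ?P" for x
    proof (intro sets.sets_Collect_countable_All)
      fix N
      have [measurable]: "Q x N \<in> borel_measurable ?P" by (rule Qm)
      show "{X \<in> space ?P. ennreal (Q x N X) \<le> b} \<in> sets ?P" by measurable
    qed
    have "{X \<in> space ?P. \<forall>x\<in>T. \<forall>N. ennreal (Q x N X) \<le> b} = (\<Inter>x\<in>T. {X \<in> space ?P. \<forall>N. ennreal (Q x N X) \<le> b})"
      using False by auto
    also have "\<dots> \<in> sets ?P" by (intro sets.countable_INT' T(1) False) (use m in blast)
    finally show ?thesis .
  qed simp
  moreover have "{X \<in> space ?P. full_column_rank (L n X)} \<in> sets ?P"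
    by (rule measurable_full_column_rank[OF L_carrier Lm])
  ultimately show ?thesis by auto
qed

end

section \<open>The bound in terms of the Christoffel function\<close>

text \<open>Spread the k-th term evenly over the indices j with k / 2 \<le> j \<le> k, of which
  there are at least k / 2, and use that l j / j does not increase. After exchanging the sums, j
  receives only terms with k \<le> 2 j, which the sum up to 4 j - 1 contains.\<close>

lemma weighted_tail_bound:
  fixes l b :: "nat \<Rightarrow> real"
  assumes m: "2 \<le> m" and l: "\<And>k. k \<ge> 1 \<Longrightarrow> 0 \<le> l k" "\<And>j k. 1 \<le> j \<Longrightarrow> j \<le> k \<Longrightarrow> l k \<le> l j"
    and b: "\<And>k. 0 \<le> b k"
  shows "(\<Sum>k\<in>{m..N}. l k * b k) \<le> 2 * (\<Sum>j\<in>{m div 2..N}. (\<Sum>k=1..4*j-1. b k) * l j / j)"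
proof -
  let ?c = "\<lambda>k j. if j \<le> k \<and> k \<le> 2 * j then b k * l j / j else 0"
  have m1: "1 \<le> m div 2" using m by simp
  have "(\<Sum>k\<in>{m..N}. l k * b k) \<le> (\<Sum>k\<in>{m..N}. 2 * (\<Sum>j\<in>{m div 2..N}. ?c k j))"
  proof (rule sum_mono)
    fix k assume k: "k \<in> {m..N}"
    \<comment> \<open>The lower end is k / 2 rounded up; for k \<ge> m it is at least
      \<open>m div 2\<close>, where the outer sum starts.\<close>
    let ?J = "{(k + 1) div 2..k}"
    have J: "?J \<subseteq> {j \<in> {m div 2..N}. j \<le> k \<and> k \<le> 2 * j}" using k by auto
    have "l k * b k \<le> 2 * (real (card ?J) * (b k * l k / k))"
    proof -
      have "k \<le> 2 * (Suc k - (k + 1) div 2)" by presburger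
      then have "k \<le> 2 * card ?J" by (simp only: card_atLeastAtMost)
      then have "real k \<le> 2 * real (card ?J)" by linarith
      then have "real k * (b k * l k / k) \<le> 2 * real (card ?J) * (b k * l k / k)"
        using b l(1)[of k] k m by (intro mult_right_mono) auto
      then show ?thesis using k m by (simp add: mult_ac)
    qed
    also have "real (card ?J) * (b k * l k / k) = (\<Sum>j\<in>?J. b k * l k / k)" by simp
    also have "\<dots> \<le> (\<Sum>j\<in>?J. b k * l j / j)"
    proof (rule sum_mono)
      fix j assume j: "j \<in> ?J"
      have j1: "1 \<le> j" using j k m by auto
      then show "b k * l k / k \<le> b k * l j / j"
        using j b l by (intro frac_le mult_left_mono mult_nonneg_nonneg) auto
    qed
    also have "\<dots> \<le> (\<Sum>j\<in>{j \<in> {m div 2..N}. j \<le> k \<and> k \<le> 2 * j}. b k * l j / j)"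
      using J b l(1) m1 by (intro sum_mono2) (auto intro!: divide_nonneg_nonneg mult_nonneg_nonneg)
    also have "\<dots> = (\<Sum>j\<in>{m div 2..N}. ?c k j)" by (intro sum.inter_filter) simp
    finally show "l k * b k \<le> 2 * (\<Sum>j\<in>{m div 2..N}. ?c k j)" by simp
  qed
  also have "\<dots> = 2 * (\<Sum>j\<in>{m div 2..N}. \<Sum>k\<in>{m..N}. ?c k j)"
    unfolding sum_distrib_left[symmetric] by (subst sum.swap) simp
  also have "\<dots> \<le> 2 * (\<Sum>j\<in>{m div 2..N}. (\<Sum>k=1..4*j-1. b k) * l j / j)"
  proof (intro mult_left_mono sum_mono)
    fix j assume j: "j \<in> {m div 2..N}"
    then have j1: "1 \<le> j" using m1 by simp
    have "(\<Sum>k\<in>{m..N}. ?c k j) = (\<Sum>k\<in>{k \<in> {m..N}. j \<le> k \<and> k \<le> 2 * j}. b k * l j / j)"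
      by (intro sum.inter_filter[symmetric]) simp
    also have "\<dots> \<le> (\<Sum>k=1..4*j-1. b k * l j / j)"
      using j1 m b l(1) by (intro sum_mono2) (auto intro!: divide_nonneg_nonneg mult_nonneg_nonneg)
    also have "\<dots> = (\<Sum>k=1..4*j-1. b k) * l j / j" by (simp add: sum_distrib_right sum_divide_distrib)
    finally show "(\<Sum>k\<in>{m..N}. ?c k j) \<le> (\<Sum>k=1..4*j-1. b k) * l j / j" .
  qed simp
  finally show ?thesis .
qed

lemma ennreal_sum_le_infsum:
  fixes f :: "'i \<Rightarrow> ennreal"
  assumes "finite F" "F \<subseteq> A" shows "sum f F \<le> infsum f A"
  using assms by (subst nonneg_infsum_complete) (auto intro: SUP_upper)

context sampling begin

abbreviation eta_sum :: "nat \<Rightarrow> 'a \<Rightarrow> real" where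
  "eta_sum N x \<equiv> (\<Sum>k=1..N-1. (cmod (\<eta> k x))\<^sup>2)"

lemma eta_sum_le_christoffel: "x \<in> D \<Longrightarrow> ennreal (eta_sum N x) \<le> christoffel D lam e N"
  unfolding christoffel_def by (rule SUP_upper)

lemma tail_le_series:
  assumes x: "x \<in> D"
  shows "ennreal (tail x) \<le> 2 * (\<Sum>\<^sub>\<infinity>k\<in>{m div 2..}. christoffel D lam e (4 * k) * ennreal ((singular_number lam k)\<^sup>2) / of_nat k)"
    (is "_ \<le> 2 * ?R")
proof (rule LIMSEQ_le_const2)
  show "(\<lambda>N. ennreal (\<Sum>k\<in>{m..N}. (cmod (e k x))\<^sup>2)) \<longlonglongrightarrow> ennreal (tail x)"
    by (intro tendsto_ennrealI tail_limit x)
  have "ennreal (\<Sum>k\<in>{m..N}. (cmod (e k x))\<^sup>2) \<le> 2 * ?R" for N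
  proof -
    have m1: "1 \<le> m div 2" using m2 by simp
    have "(\<Sum>k\<in>{m..N}. (cmod (e k x))\<^sup>2) = (\<Sum>k\<in>{m..N}. lam k * (cmod (\<eta> k x))\<^sup>2)"
      using m2 by (intro sum.cong refl) (simp add: e_sq_eta)
    also have "\<dots> \<le> 2 * (\<Sum>j\<in>{m div 2..N}. eta_sum (4 * j) x * lam j / j)"
      using lam_pos lam_antimono by (intro weighted_tail_bound m2) (auto intro: less_imp_le)
    finally have "ennreal (\<Sum>k\<in>{m..N}. (cmod (e k x))\<^sup>2) \<le> ennreal (2 * (\<Sum>j\<in>{m div 2..N}. eta_sum (4 * j) x * lam j / j))"
      by (rule ennreal_leI)
    also have "\<dots> = 2 * (\<Sum>j\<in>{m div 2..N}. ennreal (eta_sum (4 * j) x * lam j / j))"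
    proof -
      have "0 \<le> eta_sum (4 * j) x * lam j / j" if "j \<in> {m div 2..N}" for j
        using lam_pos[of j] that m1 by (intro divide_nonneg_nonneg mult_nonneg_nonneg sum_nonneg) auto
      then show ?thesis by (simp only: sum_ennreal) (simp add: ennreal_mult')
    qed
    also have "\<dots> \<le> 2 * (\<Sum>j\<in>{m div 2..N}. christoffel D lam e (4 * j) * ennreal ((singular_number lam j)\<^sup>2) / of_nat j)"
    proof (intro mult_left_mono sum_mono)
      fix j assume "j \<in> {m div 2..N}"
      then have j: "1 \<le> j" using m1 by simp
      have "ennreal (eta_sum (4 * j) x * lam j / j) = ennreal (eta_sum (4 * j) x) * ennreal (lam j) / of_nat j"
        using j lam_pos[OF j]
        by (simp add: ennreal_of_nat_eq_real_of_nat divide_ennreal[symmetric] ennreal_mult' sum_nonneg)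
      also have "\<dots> \<le> christoffel D lam e (4 * j) * ennreal ((singular_number lam j)\<^sup>2) / of_nat j"
        unfolding sigma_sq[OF j]
        by (intro divide_right_mono_ennreal mult_right_mono eta_sum_le_christoffel x) simp
      finally show "ennreal (eta_sum (4 * j) x * lam j / j) \<le> christoffel D lam e (4 * j) * ennreal ((singular_number lam j)\<^sup>2) / of_nat j" .
    qed simp
    also have "\<dots> \<le> 2 * ?R" by (intro mult_left_mono ennreal_sum_le_infsum) auto
    finally show ?thesis .
  qed
  then show "\<exists>N0. \<forall>N\<ge>N0. ennreal (\<Sum>k\<in>{m..N}. (cmod (e k x))\<^sup>2) \<le> 2 * ?R" by blast
qed

lemma partial_le_first:
  assumes x: "x \<in> D"
  shows "ennreal (eta_sum m x / m * sum lam {m div 2..N}) \<le> christoffel D lam e m / of_nat m * (\<Sum>\<^sub>\<infinity>k\<in>{m div 2..}. ennreal ((singular_number lam k)\<^sup>2))"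
proof -
  have m1: "1 \<le> m div 2" using m2 by simp
  have ln: "0 \<le> lam k" if "k \<in> {m div 2..N}" for k using that m1 lam_pos[of k] by simp
  have "ennreal (eta_sum m x / m * sum lam {m div 2..N}) = ennreal (eta_sum m x) / of_nat m * ennreal (sum lam {m div 2..N})"
  proof -
    have es: "0 \<le> eta_sum m x" by (intro sum_nonneg) auto
    have "ennreal (eta_sum m x / m) = ennreal (eta_sum m x) / of_nat m"
      using m2 es by (simp only: ennreal_of_nat_eq_real_of_nat) (subst divide_ennreal, auto)
    moreover have "ennreal (eta_sum m x / m * sum lam {m div 2..N}) = ennreal (eta_sum m x / m) * ennreal (sum lam {m div 2..N})"
      using es by (intro ennreal_mult') simp
    ultimately show ?thesis by simp
  qed
  also have "ennreal (sum lam {m div 2..N}) = (\<Sum>k\<in>{m div 2..N}. ennreal ((singular_number lam k)\<^sup>2))"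
    using ln m1 by (subst sum_ennreal[symmetric]) (auto simp: sigma_sq intro!: sum.cong)
  also have "ennreal (eta_sum m x) / of_nat m * \<dots> \<le> christoffel D lam e m / of_nat m * (\<Sum>\<^sub>\<infinity>k\<in>{m div 2..}. ennreal ((singular_number lam k)\<^sup>2))"
    by (intro mult_mono divide_right_mono_ennreal eta_sum_le_christoffel x ennreal_sum_le_infsum) auto
  finally show ?thesis .
qed

text \<open>With E the error bound: the tail is at most 2 E, \<open>eta_sum\<close> times
  \<open>Lam\<close> / m at most E, and \<open>eta_sum\<close> times \<open>lam m\<close> at most 2
  E. The total is (4 + 0.8 + 128) E, below 200 E.\<close>

lemma total_bound:
  assumes x: "x \<in> D" and c: "c / n \<le> Lam / (10 * m) + 8 * lam m"
  shows "ennreal (2 * tail x + 8 * c / n * eta_sum m x) \<le> ennreal 200 * error_bound D lam e m"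
proof (cases "error_bound D lam e m")
  case (real E)
  have first: "christoffel D lam e m / of_nat m * (\<Sum>\<^sub>\<infinity>k\<in>{m div 2..}. ennreal ((singular_number lam k)\<^sup>2)) \<le> ennreal E"
    and second: "(\<Sum>\<^sub>\<infinity>k\<in>{m div 2..}. christoffel D lam e (4 * k) * ennreal ((singular_number lam k)\<^sup>2) / of_nat k) \<le> ennreal E"
    unfolding real(2)[symmetric] error_bound_def by (rule max.cobounded1, rule max.cobounded2)
  have es: "0 \<le> eta_sum m x" by (intro sum_nonneg) auto
  have m1: "1 \<le> m div 2" using m2 by simp
  have "ennreal (tail x) \<le> 2 * ennreal E"
    using tail_le_series[OF x] mult_left_mono[OF second, of 2] by (meson order_trans zero_le)
  then have 1: "tail x \<le> 2 * E" using real(1)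
    by (metis ennreal_le_iff ennreal_mult' ennreal_numeral mult_nonneg_nonneg zero_le_numeral)
  have part: "eta_sum m x / m * sum lam {m div 2..N} \<le> E" for N
    using order_trans[OF partial_le_first[OF x] first] real(1) by (simp add: ennreal_le_iff)
  have 2: "eta_sum m x / m * Lam \<le> E"
  proof (rule LIMSEQ_le_const2)
    show "(\<lambda>N. eta_sum m x / m * sum lam {m..N}) \<longlonglongrightarrow> eta_sum m x / m * Lam" by (intro tendsto_intros Lam_limit)
    have "eta_sum m x / m * sum lam {m..N} \<le> E" for N
    proof -
      have "0 \<le> lam k" if "m div 2 \<le> k" for k using lam_pos[of k] that m1 by simp
      then have "sum lam {m..N} \<le> sum lam {m div 2..N}" by (intro sum_mono2) auto
      then have "eta_sum m x / m * sum lam {m..N} \<le> eta_sum m x / m * sum lam {m div 2..N}"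
        using es by (intro mult_left_mono) auto
      then show ?thesis using part[of N] by linarith
    qed
    then show "\<exists>N0. \<forall>N\<ge>N0. eta_sum m x / m * sum lam {m..N} \<le> E" by blast
  qed
  \<comment> \<open>The range from \<open>m div 2\<close> to m has at least m / 2 indices, on each
    of which the eigenvalue is at least \<open>lam m\<close>. The series starting at
    \<open>m div 2\<close> thus also pays for the single eigenvalue.\<close>
  have 3: "eta_sum m x * lam m \<le> 2 * E"
  proof -
    have "(\<Sum>k\<in>{m div 2..m}. lam m) \<le> sum lam {m div 2..m}"
      using lam_antimono m1 by (intro sum_mono) auto
    moreover have "real m / 2 * lam m \<le> (\<Sum>k\<in>{m div 2..m}. lam m)"
    proof -
      have "m \<le> 2 * (Suc m - m div 2)" by presburger
      then have "m \<le> 2 * card {m div 2..m}" by (simp only: card_atLeastAtMost)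
      then have "real m / 2 \<le> real (card {m div 2..m})" by linarith
      then have "real m / 2 * lam m \<le> real (card {m div 2..m}) * lam m"
        using lam_pos[of m] m2 by (intro mult_right_mono) auto
      then show ?thesis by simp
    qed
    ultimately have "eta_sum m x / m * (real m / 2 * lam m) \<le> eta_sum m x / m * sum lam {m div 2..m}"
      using es by (intro mult_left_mono) auto
    also have "\<dots> \<le> E" by (rule part)
    finally show ?thesis using m2 by simp
  qed
  have "8 * c / n * eta_sum m x \<le> 8 * ((Lam / (10 * m) + 8 * lam m) * eta_sum m x)"
    using mult_right_mono[OF c es] by simp
  also have "\<dots> = 8 / 10 * (eta_sum m x / m * Lam) + 64 * (eta_sum m x * lam m)" by (simp add: field_simps)
  also have "\<dots> \<le> 8 / 10 * E + 64 * (2 * E)" using 2 3 by linarith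
  finally have "2 * tail x + 8 * c / n * eta_sum m x \<le> 200 * E" using 1 real(1) by linarith
  then have "ennreal (2 * tail x + 8 * c / n * eta_sum m x) \<le> ennreal (200 * E)" by (rule ennreal_leI)
  also have "\<dots> = ennreal 200 * error_bound D lam e m" unfolding real(2) by (rule ennreal_mult') simp
  finally show ?thesis .
qed (simp add: ennreal_mult_top)

section \<open>Choice of the parameters\<close>

text \<open>With t = r ln n the number n powr (1 - r) is n exp (-t). The lower frame bound fails
  with probability at most n exp (-t), the upper one with at most 2 n exp (-t); together they give
  the constant 3.\<close>

theorem success_probability:
  fixes n :: nat and r :: real
  assumes n: "2 \<le> n" and r: "1 < r" and nm: "200 * (r * ln n) * m \<le> n"
  shows "measure (Pi\<^sub>M {..<n} (\<lambda>_. M)) {X \<in> space (Pi\<^sub>M {..<n} (\<lambda>_. M)).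
      full_column_rank (L n X) \<and> worst_case_sq_error D H ip (S n X) \<le> ennreal 200 * error_bound D lam e m}
    \<ge> 1 - 3 * n powr (1 - r)"
proof -
  let ?P = "Pi\<^sub>M {..<n} (\<lambda>_. M)"
  interpret M: prob_space M by (rule prob_space_M)
  interpret P: prob_space ?P by (intro prob_space_PiM M.prob_space_axioms)
  define t where "t = r * ln n"
  have "ln 2 \<le> ln (real n)" using n by (subst ln_le_cancel_iff) auto
  then have "2 / 3 \<le> ln (real n)" using ln2_ge_two_thirds by linarith
  moreover have "1 * ln (real n) \<le> t" unfolding t_def using r n by (intro mult_right_mono) auto
  ultimately have t: "2 / 3 \<le> t" by simp
  have nm: "200 * t * m \<le> n" using nm by (simp add: t_def)
  have "200 * (2 / 3) * 2 \<le> 200 * t * m" using t m2 by (intro mult_mono) auto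
  then have n16: "16 \<le> n" using nm by simp
  have pw: "n powr (1 - r) = n * exp (- t)"
  proof -
    have "n powr (1 - r) = exp (ln (real n) + - t)"
      using n unfolding powr_def t_def by (simp add: algebra_simps)
    then show ?thesis using n by (simp only: exp_add) simp
  qed
  define q where "q = real (m - 1)"
  have q: "1 \<le> q" "q \<le> m" "q \<le> n" unfolding q_def
  proof -
    have "1 * real m \<le> 200 * t * m" using t by (intro mult_right_mono) auto
    then show "1 \<le> real (m - 1)" "real (m - 1) \<le> real m" "real (m - 1) \<le> real n" using m2 nm by linarith+
  qed
  interpret lo: iid_frame M "{..<m - 1}" "\<lambda>x i. cnj (wt (\<eta> (Suc i)) x)" "2 * real (m - 1)" "\<lambda>_. 1"
    by (rule lower_frame)
  obtain G1 where G1: "G1 \<in> sets ?P" "measure ?P G1 \<ge> 1 - card {..<m - 1} * exp (- 3 * real n / (256 * (2 * real (m - 1))))"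
    "\<And>X z. X \<in> G1 \<Longrightarrow> n / 4 * Re (dot {..<m - 1} z z) \<le> (\<Sum>j<n. (cmod (dot {..<m - 1} z (\<lambda>i. cnj (wt (\<eta> (Suc i)) (X j)))))\<^sup>2)"
    by (rule lo.lower_frame_bound[OF n16]) (use m2 in auto)
  have p1: "measure ?P G1 \<ge> 1 - n * exp (- t)"
  proof -
    \<comment> \<open>512 is 256 times the factor 2 in R = 2 q; the exponent 3 n / (512 q) has to
      reach t.\<close>
    have "512 * t * q \<le> 600 * t * m" using q t by (intro mult_mono) auto
    then have "t * (512 * q) \<le> 3 * real n" using nm by linarith
    then have "t \<le> 3 * real n / (256 * (2 * q))" using q by (simp add: pos_le_divide_eq)
    then have "q * exp (- 3 * real n / (256 * (2 * q))) \<le> n * exp (- t)"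
      using q by (intro mult_mono) auto
    then show ?thesis using G1(2) unfolding q_def by simp
  qed
  \<comment> \<open>Chosen so that exp (-p / 3) \<le> exp (-t); rounding up keeps p \<le> 5 t,
    because t \<ge> 2/3.\<close>
  define p where "p = nat \<lceil>3 * t\<rceil>"
  have p: "1 \<le> p" "3 * t \<le> p" "p \<le> 5 * t" unfolding p_def using t by linarith+
  \<comment> \<open>The sum of the two lower bounds that \<open>upper_frame_bound\<close> demands,
    with R = 2 \<open>Lam\<close> and s = \<open>lam m\<close>.\<close>
  define c where "c = 2 * real p * (2 * Lam) + 8 * real n * lam m"
  have lm: "0 < lam m" using lam_pos m2 by simp
  have c: "0 < c" "2 * real p * (2 * Lam) \<le> c" "8 * real n * lam m \<le> c"
    unfolding c_def using Lam_pos lm p n by (auto intro!: add_pos_pos)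
  have "\<exists>G. G \<in> sets ?P \<and> measure ?P G \<ge> 1 - 2 * real n * exp (- real p / 3) \<and>
    (\<forall>X\<in>G. \<forall>z. (\<Sum>j<n. (cmod (dot {m..N} z (\<lambda>k. cnj (wt (e k) (X j)))))\<^sup>2) \<le> c * Re (dot {m..N} z z))" for N
  proof -
    interpret up: iid_frame M "{m..N}" "\<lambda>x k. cnj (wt (e k) x)" "2 * Lam" lam by (rule upper_frame)
    have "lam i \<le> lam m" if "i \<in> {m..N}" for i using that m2 by (intro lam_antimono) auto
    then show ?thesis using up.upper_frame_bound[OF p(1) c(1,2,3)] lm by (metis less_imp_le)
  qed
  then obtain G where G: "\<And>N. G N \<in> sets ?P" "\<And>N. measure ?P (G N) \<ge> 1 - 2 * real n * exp (- real p / 3)"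
    "\<And>N X z. X \<in> G N \<Longrightarrow> (\<Sum>j<n. (cmod (dot {m..N} z (\<lambda>k. cnj (wt (e k) (X j)))))\<^sup>2) \<le> c * Re (dot {m..N} z z)"
    by metis
  \<comment> \<open>The truncated frame bounds hold for infinitely many \<open>N\<close> at once with the same probability.\<close>
  define A where "A N = (\<Union>i\<in>{N..}. G i)" for N
  have A: "A N \<in> sets ?P" for N unfolding A_def using G(1) by auto
  have "measure ?P (A N) \<ge> 1 - 2 * n * exp (- t)" for N
  proof -
    have "measure ?P (G N) \<le> measure ?P (A N)"
      by (rule P.finite_measure_mono) (use A in \<open>auto simp: A_def\<close>)
    moreover have "exp (- real p / 3) \<le> exp (- t)" using p by simp
    then have "2 * real n * exp (- real p / 3) \<le> 2 * n * exp (- t)" by (intro mult_mono) auto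
    ultimately show ?thesis using G(2)[of N] by linarith
  qed
  moreover have "(\<lambda>N. measure ?P (A N)) \<longlonglongrightarrow> measure ?P (\<Inter>N. A N)"
  proof (rule P.finite_Lim_measure_decseq)
    show "range A \<subseteq> sets ?P" using A by auto
    show "decseq A" unfolding A_def decseq_def by (intro allI impI UN_mono) auto
  qed
  ultimately have p2: "measure ?P (\<Inter>N. A N) \<ge> 1 - 2 * n * exp (- t)" by (intro LIMSEQ_le_const) auto
  let ?E = "{X \<in> space ?P. full_column_rank (L n X) \<and> worst_case_sq_error D H ip (S n X) \<le> ennreal 200 * error_bound D lam e m}"
  have A': "(\<Inter>N. A N) \<in> sets ?P" using A by auto
  have "G1 \<inter> (\<Inter>N. A N) \<subseteq> ?E"
  proof
    fix X assume X: "X \<in> G1 \<inter> (\<Inter>N. A N)"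
    then have Xs: "X \<in> space ?P" using G1(1) sets.sets_into_space by blast
    then have XD: "X j \<in> D" if "j < n" for j using that by (auto simp: space_PiM M_space)
    have low: "n / 4 * Re (dot {..<m - 1} z z) \<le> (\<Sum>j<n. (cmod (dot {..<m - 1} z (\<lambda>i. cnj (wt (\<eta> (Suc i)) (X j)))))\<^sup>2)" for z
      using G1(3) X by blast
    have up: "\<exists>\<^sub>F N in sequentially. \<forall>z. (\<Sum>j<n. (cmod (dot {m..N} z (\<lambda>k. cnj (wt (e k) (X j)))))\<^sup>2) \<le> c * Re (dot {m..N} z z)"
      unfolding frequently_sequentially
    proof
      fix N
      have "X \<in> A N" using X by blast
      then show "\<exists>i\<ge>N. \<forall>z. (\<Sum>j<n. (cmod (dot {m..i} z (\<lambda>k. cnj (wt (e k) (X j)))))\<^sup>2) \<le> c * Re (dot {m..i} z z)"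
        unfolding A_def using G(3) by blast
    qed
    have n1: "1 \<le> n" using n by simp
    have cn: "c / n \<le> Lam / (10 * m) + 8 * lam m"
    proof -
      have "4 * real p * Lam / n \<le> Lam / (10 * m)"
      proof -
        \<comment> \<open>Here 40 p m \<le> 200 t m \<le> n: this is where the oversampling constant
          200 is used in full.\<close>
        have "4 * real p * (10 * m) \<le> n" 
        proof -
          have "40 * real m * p \<le> 40 * real m * (5 * t)" using p by (intro mult_left_mono) auto
          then show ?thesis using nm by (simp add: mult_ac)
        qed
        then have "4 * real p * (10 * m) * Lam \<le> n * Lam" using Lam_pos by (intro mult_right_mono) auto
        then show ?thesis using n m2 by (simp add: field_simps)
      qed
      moreover have "c / n = 4 * real p * Lam / n + 8 * lam m" unfolding c_def using n by (simp add: field_simps)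
      ultimately show ?thesis by simp
    qed
    have "full_column_rank (L n X)" by (rule full_rank_if_lower[OF n1 low])
    moreover have "worst_case_sq_error D H ip (S n X) \<le> ennreal 200 * error_bound D lam e m"
      unfolding worst_case_le_iff
    proof (intro ballI impI)
      fix f x assume f: "f \<in> H" "hnorm ip f \<le> 1" and x: "x \<in> D"
      have "(cmod (f x - S n X f x))\<^sup>2 \<le> 2 * tail x + 8 * c / n * eta_sum m x"
        by (rule pointwise_error[OF n1 XD _ low up f x]) (use c in auto)
      then have "ennreal ((cmod (f x - S n X f x))\<^sup>2) \<le> ennreal (2 * tail x + 8 * c / n * eta_sum m x)" by (rule ennreal_leI)
      also have "\<dots> \<le> ennreal 200 * error_bound D lam e m" by (rule total_bound[OF x cn])
      finally show "ennreal ((cmod (f x - S n X f x))\<^sup>2) \<le> ennreal 200 * error_bound D lam e m" .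
    qed
    ultimately show "X \<in> ?E" using Xs by blast
  qed
  then have "measure ?P (G1 \<inter> (\<Inter>N. A N)) \<le> measure ?P ?E"
    by (intro P.finite_measure_mono event_measurable)
  moreover have "measure ?P (G1 \<inter> (\<Inter>N. A N)) \<ge> measure ?P G1 + measure ?P (\<Inter>N. A N) - 1"
  proof -
    have "measure ?P (G1 \<union> (\<Inter>N. A N)) = measure ?P G1 + measure ?P (\<Inter>N. A N) - measure ?P (G1 \<inter> (\<Inter>N. A N))"
      by (rule measure_Un3) (use G1(1) A' in \<open>auto simp: fmeasurable_def P.emeasure_eq_measure\<close>)
    then show ?thesis using P.prob_le_1[of "G1 \<union> (\<Inter>N. A N)"] by linarith
  qed
  ultimately show ?thesis unfolding pw using p1 p2 by linarith
qed

end

theorem theorem3p1: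
  shows "\<exists>c1 c2 c3 :: real. 0 < c1 \<and> 0 < c2 \<and> 0 < c3 \<and>
    (\<forall>(d :: nat) (D :: (nat \<Rightarrow> real) set) (K :: (nat \<Rightarrow> real) \<Rightarrow> (nat \<Rightarrow> real) \<Rightarrow> complex)
      (H :: ((nat \<Rightarrow> real) \<Rightarrow> complex) set)
      (ip :: ((nat \<Rightarrow> real) \<Rightarrow> complex) \<Rightarrow> ((nat \<Rightarrow> real) \<Rightarrow> complex) \<Rightarrow> complex)
      (\<rho> :: (nat \<Rightarrow> real) measure)
      (lam :: nat \<Rightarrow> real) (e :: nat \<Rightarrow> (nat \<Rightarrow> real) \<Rightarrow> complex)
      (r :: real) (n :: nat) (m :: nat).
        D \<subseteq> real_space d \<and> compact D \<and>
        continuous_on (D \<times> D) (\<lambda>(x, y). K x y) \<and>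
        hermitian_pos_def D K \<and>
        bdd_above ((\<lambda>x. sqrt (Re (K x x))) ` D) \<and>
        rkhs D K H ip \<and> infinite_dimensional H \<and>
        finite_borel_full_support D \<rho> \<and>
        spectral_system \<rho> H ip lam e \<and>
        1 < r \<and>
        m = nat \<lfloor>real n / (c1 * r * ln (real n))\<rfloor> \<and> 2 \<le> m \<longrightarrow>
        \<P>(X in Pi\<^sub>M {..<n} (\<lambda>_. sampling_measure \<rho> lam e m).
            full_column_rank (ls_matrix lam e m n X) \<and>
            worst_case_sq_error D H ip (ls_operator lam e m n X)
              \<le> ennreal c3 * error_bound D lam e m)
          \<ge> 1 - c2 * real n powr (1 - r))"
proof (rule exI[of _ 200], rule exI[of _ 3], rule exI[of _ 200], intro conjI allI impI; (elim conjE)?)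
  fix d :: nat and D :: "(nat \<Rightarrow> real) set" and K :: "(nat \<Rightarrow> real) \<Rightarrow> (nat \<Rightarrow> real) \<Rightarrow> complex"
    and H :: "((nat \<Rightarrow> real) \<Rightarrow> complex) set" and ip :: "((nat \<Rightarrow> real) \<Rightarrow> complex) \<Rightarrow> ((nat \<Rightarrow> real) \<Rightarrow> complex) \<Rightarrow> complex"
    and \<rho> :: "(nat \<Rightarrow> real) measure" and lam :: "nat \<Rightarrow> real" and e :: "nat \<Rightarrow> (nat \<Rightarrow> real) \<Rightarrow> complex"
    and r :: real and n m :: nat
  assume K: "continuous_on (D \<times> D) (\<lambda>(x, y). K x y :: complex)" and bdd: "bdd_above ((\<lambda>x. sqrt (Re (K x x))) ` D)"
    and H: "rkhs D K H ip" and \<rho>: "finite_borel_full_support D \<rho>" and sp: "spectral_system \<rho> H ip lam e"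
    and r: "1 < r" and m: "m = nat \<lfloor>real n / (200 * r * ln (real n))\<rfloor>" and m2: "2 \<le> m"
  obtain b where b: "\<And>x. x \<in> D \<Longrightarrow> sqrt (Re (K x x)) \<le> b" using bdd by (auto simp: bdd_above_def)
  have Kb: "Re (K x x) \<le> b\<^sup>2" if "x \<in> D" for x
    using b[OF that] by (metis real_sqrt_le_iff order_trans abs_ge_self real_sqrt_abs)
  interpret rkhs D K H ip by (rule H)
  interpret sampling D K H ip \<rho> lam e "b\<^sup>2" m
    by unfold_locales (use K Kb \<rho> sp m2 in auto)
  \<comment> \<open>For n = 0 and n = 1 the logarithm is 0, division by it yields 0, and m would be
    0.\<close>
  have "2 \<le> n" by (rule ccontr) (use m m2 in \<open>auto simp: not_le less_Suc_eq numeral_2_eq_2\<close>)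
  moreover from this have "0 < 200 * r * ln (real n)" using r by simp
  moreover have "real m \<le> real n / (200 * r * ln (real n))"
    unfolding m using m m2 by (intro of_nat_floor) linarith
  ultimately show "1 - 3 * real n powr (1 - r) \<le> \<P>(X in Pi\<^sub>M {..<n} (\<lambda>_. sampling_measure \<rho> lam e m).
            full_column_rank (ls_matrix lam e m n X) \<and>
            worst_case_sq_error D H ip (ls_operator lam e m n X)
              \<le> ennreal 200 * error_bound D lam e m)"
    by (intro success_probability r) (auto simp: pos_le_divide_eq mult_ac)
qed simp_all

end
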